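(* Let $\mathbf{k}$ be an algebraically closed field of characteristic zero, $A=\mathbf{k}[x,y,z]/\langle x^2+y^2+z^2-1\rangle$ and $\mathcal{V}=\mathrm{Der}_{\mathbf{k}}(A)$. In the category $\mathfrak{T}$ of tensor modules on $\mathbb{S}^2$, tensor products of simple modules decompose as direct sums of simple tensor modules: if $M$ and $N$ are simple tensor modules on $\mathbb{S}^2$, then the $A\mathcal{V}$-module $M\otimes_A N$ is a direct sum of simple tensor modules.
   Context: An $A\mathcal{V}$-module is a $\mathbf{k}$-vector space $M$ that is both a module over the commutative unital algebra $A$ and a module over the Lie algebra $\mathcal{V}$, such that $\eta\cdot(a\cdot m)=\eta(a)\cdot m+a\cdot(\eta\cdot m)$ for all $a\in A$, $\eta\in\mathcal{V}$, $m\in M$. Morphisms and submodules respect both structures. The tensor product of $A\mathcal{V}$-modules $M,N$ is $M\otimes_AN$ with its usual $A$-action and $\eta\cdot(m\otimes n)=(\eta\cdot m)\otimes n+m\otimes(\eta\cdot n)$. Charts. For $h\in\{x,y,z\}$ let $A_{(h)}=A[h^{-1}]$ be the localization. The chart parameters $(t_1,t_2)$ of the chart $N(h)=\{P\in\mathbb{S}^2: h(P)\neq0\}$ are the two coordinates other than $h$: $(y,z)$ for $h=x$, $(x,z)$ for $h=y$, $(x,y)$ for $h=z$. The derivations $\frac{\partial}{\partial t_1},\frac{\partial}{\partial t_2}$ of $\mathbf{k}[t_1,t_2]\subset A$ extend uniquely to derivations of $A_{(h)}$ (for instance for $h=z$: $\frac{\partial z}{\partial x}=-\frac{x}{z}$,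 $\frac{\partial z}{\partial y}=-\frac{y}{z}$), and $\mathrm{Der}(A_{(h)})=A_{(h)}\frac{\partial}{\partial t_1}\oplus A_{(h)}\frac{\partial}{\partial t_2}$. Every $\eta\in\mathcal{V}$ extends uniquely to $A_{(h)}$, so $\mathcal{V}\subset\mathrm{Der}(A_{(h)})$. For a finite-dimensional $\mathfrak{gl}_2$-module $U$, the space $A_{(h)}\otimes_{\mathbf{k}}U$ is an $A\mathcal{V}$-module: $A$ acts by multiplication on the left factor, and $$\Big(\sum_{i=1}^{2}f_i\frac{\partial}{\partial t_i}\Big)\cdot(g\otimes u)=\sum_{i=1}^{2}f_i\frac{\partial g}{\partial t_i}\otimes u+\sum_{p=1}^{2}\sum_{i=1}^{2}g\frac{\partial f_i}{\partial t_p}\otimes(E_{p,i}\cdot u),$$ where $E_{p,i}$ are the matrix units of $\mathfrak{gl}_2$. A rational $\mathrm{GL}_2$-module is regarded as a $\mathfrak{gl}_2$-module by differentiation. Change of charts. Let $V$ be the natural module of $\mathrm{GL}_2$ with basis $e_1,e_2$ ($E_{p,i}e_j=\delta_{ij}e_p$), and regard $\mathrm{GL}_2=\mathrm{GL}(V)$. For charts $N(h)$, $N(\tilde h)$ with chart parameters $(t_1,t_2)$, $(\tilde t_1,\tilde t_2)$, write $A_{(h,\tilde h)}$ for the localization of $A$ at both $h$ and $\tilde h$, and let $C$ be the invertible $A_{(h,\tilde h)}$-linear map of $A_{(h,\tilde h)}\otimes V$ given by $Ce_i=\sum_{j=1}^{2}\frac{\partial t_i}{\partial\tilde t_j}e_j$.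 For a finite-dimensional rational representation $\rho:\mathrm{GL}_2\to\mathrm{GL}(U)$, $\rho(C)$ denotes the induced invertible $A_{(h,\tilde h)}$-linear map of $A_{(h,\tilde h)}\otimes U$ (substitute the matrix of $C$, with entries in $A_{(h,\tilde h)}$, into the rational representation $\rho$). Tensor modules. A tensor module on $\mathbb{S}^2$ is an $A\mathcal{V}$-module $M$ which is finitely generated over $A$ and for which there exist a finite-dimensional rational $\mathrm{GL}_2$-module $(U,\rho)$ and injective $A\mathcal{V}$-module homomorphisms $\varphi_h:M\to A_{(h)}\otimes U$ for each $h\in\{x,y,z\}$, such that for every pair $h,\tilde h$ one has $\rho(C)\circ\varphi_h=\varphi_{\tilde h}$ as maps $M\to A_{(h,\tilde h)}\otimes U$ (using $A_{(h)}\otimes U,\ A_{(\tilde h)}\otimes U\subset A_{(h,\tilde h)}\otimes U$). $\mathfrak{T}$ is the full subcategory of $A\mathcal{V}$-modules whose objects are the tensor modules. A simple tensor module is a tensor module that is simple (nonzero, with no proper nonzero submodules) as an $A\mathcal{V}$-module. *)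

theory Defs
  imports
    "HOL-Computational_Algebra.Computational_Algebra"
    "HOL-Algebra.Algebraic_Closure_Type"
    "HOL-Algebra.Module"
    "HOL-Library.Poly_Mapping"
    "Jordan_Normal_Form.Matrix"
    "Jordan_Normal_Form.Determinant"
begin

section \<open>The coordinate ring of the sphere\<close>

lemma no_square_multiple:
  fixes p u a b :: "'r::idom poly"
  assumes p: "prime_elem p" "degree p > 0" and u: "\<not> p dvd u" and eq: "a ^ 2 = p * u * b ^ 2"
  shows "b = 0"
  using eq
proof (induction "degree b" arbitrary: a b rule: less_induct)
  case less
  show "b = 0"
  proof (rule ccontr)
    assume b: "b \<noteq> 0"
    have p0: "p \<noteq> 0" using p by auto
    have "p dvd a ^ 2" using less.prems by (metis dvd_triv_left mult.assoc)
    then have "p dvd a" using p(1) prime_elem_dvd_power by blast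
    then obtain a' where a': "a = p * a'" by blast
    have "p * (p * a' ^ 2) = p * (u * b ^ 2)"
      using less.prems by (simp add: a' power2_eq_square algebra_simps)
    then have e: "p * a' ^ 2 = u * b ^ 2" using p0 by simp
    then have "p dvd u * b ^ 2" by (metis dvd_triv_left)
    then have "p dvd b ^ 2" using u p(1) prime_elem_dvd_multD by blast
    then have "p dvd b" using p(1) prime_elem_dvd_power by blast
    then obtain b' where b': "b = p * b'" by blast
    have "p * (a' ^ 2) = p * (p * u * b' ^ 2)"
      using e by (simp add: b' power2_eq_square algebra_simps)
    then have e': "a' ^ 2 = p * u * b' ^ 2" using p0 by simp
    have "b' \<noteq> 0" using b b' by auto
    then have "degree b = degree p + degree b'" using b' p0 by (simp add: degree_mult_eq)
    then have "degree b' < degree b" using p by simp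
    then show False using less.hyps e' \<open>b' \<noteq> 0\<close> by blast
  qed
qed

lemma quadratic_remainder:
  fixes d :: "'r::idom"
  shows "\<exists>q a b. P = q * [:-d, 0, 1:] + [:a, b:]"
proof (induction P)
  case 0
  show ?case by (intro exI[of _ 0]) simp
next
  case (pCons c P)
  then obtain q a b where P: "P = q * [:-d, 0, 1:] + [:a, b:]" by blast
  have "pCons c P = (pCons b q) * [:-d, 0, 1:] + [:c + b * d, a:]"
    unfolding P by (simp add: algebra_simps)
  then show ?case by blast
qed

lemma quadratic_dvd_linear:
  fixes d :: "'r::idom"
  assumes "[:-d, 0, 1:] dvd [:a, b:]"
  shows "a = 0 \<and> b = 0"
proof (rule ccontr)
  assume "\<not> ?thesis"
  then have "[:a, b:] \<noteq> 0" by auto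
  then have "degree [:-d, 0, 1:] \<le> degree [:a, b:]" using assms dvd_imp_degree_le by blast
  then show False by (auto split: if_splits)
qed

lemma prime_elem_quadratic:
  fixes d :: "'r::idom"
  assumes nosq: "\<And>a b. a ^ 2 = d * b ^ 2 \<Longrightarrow> b = 0"
  shows "prime_elem [:-d, 0, 1:]"
proof (rule prime_elemI)
  let ?f = "[:-d, 0, 1:]"
  show "?f \<noteq> 0" by simp
  show "\<not> ?f dvd 1"
    using quadratic_dvd_linear[of d 1 0] by (auto simp: one_pCons)
  fix P Q assume dv: "?f dvd P * Q"
  obtain q a b where P: "P = q * ?f + [:a, b:]" using quadratic_remainder by blast
  obtain q' a' b' where Q: "Q = q' * ?f + [:a', b':]" using quadratic_remainder by blast
  define R where "R = q * Q + [:a, b:] * q' + [:b * b':]"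
  have "[:a, b:] * [:a', b':] = [:b * b':] * ?f + [:a * a' + b * b' * d, a * b' + b * a':]"
    by (simp add: algebra_simps)
  moreover have "P * Q = (q * Q + [:a, b:] * q') * ?f + [:a, b:] * [:a', b':]"
    unfolding P Q by (simp only: distrib_left distrib_right ac_simps)
  ultimately have "P * Q = R * ?f + [:a * a' + b * b' * d, a * b' + b * a':]"
    unfolding R_def by (simp only: distrib_right add.assoc)
  then have "?f dvd [:a * a' + b * b' * d, a * b' + b * a':]"
    using dv by (metis dvd_add_right_iff dvd_triv_right)
  then have z: "a * a' + b * b' * d = 0" "a * b' + b * a' = 0"
    using quadratic_dvd_linear by blast+
  have "(a^2 - d * b^2) * (a'^2 - d * b'^2) = (a * a' + b * b' * d)^2 - d * (a * b' + b * a')^2"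
    by (simp add: power2_eq_square algebra_simps)
  then have "a^2 = d * b^2 \<or> a'^2 = d * b'^2" using z by simp
  then show "?f dvd P \<or> ?f dvd Q"
  proof
    assume h: "a^2 = d * b^2"
    then have "b = 0" by (rule nosq)
    then have "P = q * ?f" using h P by simp
    then show ?thesis by (metis dvd_triv_right)
  next
    assume h: "a'^2 = d * b'^2"
    then have "b' = 0" by (rule nosq)
    then have "Q = q' * ?f" using h Q by simp
    then show ?thesis by (metis dvd_triv_right)
  qed
qed

text \<open>
  The ring \<open>k[x,y,z]\<close> is \<open>k[x][y][z]\<close>; the polynomial below is \<open>x\<^sup>2 + y\<^sup>2 + z\<^sup>2 - 1\<close>.
\<close>

datatype coord = CX | CY | CZ

fun coord_poly :: "coord \<Rightarrow> 'k::comm_ring_1 poly poly poly" where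
  "coord_poly CX = [:[:[:0, 1:]:]:]"
| "coord_poly CY = [:[:0, 1:]:]"
| "coord_poly CZ = [:0, 1:]"

definition sphere_poly :: "'k::comm_ring_1 poly poly poly" where
  "sphere_poly = coord_poly CX ^ 2 + coord_poly CY ^ 2 + coord_poly CZ ^ 2 - 1"

lemma prime_elem_sphere_poly: "prime_elem (sphere_poly :: 'k::field_char_0 poly poly poly)"
proof -
  let ?p = "[:-1, 1:] :: 'k poly" and ?u = "[:-1, -1:] :: 'k poly"
  let ?c = "[:-(?p * ?u), 0, 1:] :: 'k poly poly"
  have dvd_iff: "?p dvd q \<longleftrightarrow> poly q 1 = 0" for q
    using poly_eq_0_iff_dvd[of q 1] by simp
  have p: "prime_elem ?p"
    by (rule prime_elemI; (unfold dvd_iff)?) auto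
  have u: "\<not> ?p dvd ?u" unfolding dvd_iff by simp
  have c: "prime_elem ?c"
    by (rule prime_elem_quadratic, rule no_square_multiple[OF p _ u]) auto
  have "prime_elem [:-(?c * -1), 0, 1:]"
  proof (rule prime_elem_quadratic, rule no_square_multiple[OF c])
    show "\<not> ?c dvd -1" using c by (metis dvd_minus_iff prime_elem_not_unit)
  qed auto
  also have "[:-(?c * -1), 0, 1:] = (sphere_poly :: 'k poly poly poly)"
    by (simp add: sphere_poly_def power2_eq_square one_pCons)
  finally show ?thesis .
qed

lemma diff_diff_swap: "(a - b) - (c - d) = (a - c) - (b - d)" for a b c d :: "'r::ab_group_add"
  by simp

lemma mult_diff_telescope: "(a - b) * c + b * (c - d) = a * c - b * d" for a b c d :: "'r::comm_ring"
  by (simp add: algebra_simps)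

quotient_type (overloaded) 'k sphere = "'k::field_char_0 poly poly poly" /
  "\<lambda>p q. sphere_poly dvd p - q"
proof (rule equivpI)
  show "reflp (\<lambda>p q :: 'k poly poly poly. sphere_poly dvd p - q)"
    by (rule reflpI) (simp only: diff_self dvd_0_right)
  show "symp (\<lambda>p q :: 'k poly poly poly. sphere_poly dvd p - q)"
  proof (rule sympI)
    fix p q :: "'k poly poly poly"
    assume "sphere_poly dvd p - q"
    then have "sphere_poly dvd - (p - q)" by (simp only: dvd_minus_iff)
    then show "sphere_poly dvd q - p" by (simp only: minus_diff_eq)
  qed
  show "transp (\<lambda>p q :: 'k poly poly poly. sphere_poly dvd p - q)"
  proof (rule transpI)
    fix p q r :: "'k poly poly poly"
    assume "sphere_poly dvd p - q" "sphere_poly dvd q - r"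
    then have "sphere_poly dvd (p - q) + (q - r)" by (rule dvd_add)
    then show "sphere_poly dvd p - r" by (simp only: add_diff_eq diff_add_cancel)
  qed
qed

instantiation sphere :: (field_char_0) idom
begin

lift_definition zero_sphere :: "'a sphere" is 0 .
lift_definition one_sphere :: "'a sphere" is 1 .
lift_definition plus_sphere :: "'a sphere \<Rightarrow> 'a sphere \<Rightarrow> 'a sphere" is "(+)"
  by (simp only: add_diff_add dvd_add)
lift_definition minus_sphere :: "'a sphere \<Rightarrow> 'a sphere \<Rightarrow> 'a sphere" is "(-)"
proof -
  fix a b c d :: "'a poly poly poly"
  assume "sphere_poly dvd a - b" "sphere_poly dvd c - d"
  then have "sphere_poly dvd (a - b) - (c - d)" by (rule dvd_diff)
  also have "(a - b) - (c - d) = (a - c) - (b - d)" by (rule diff_diff_swap)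
  finally show "sphere_poly dvd (a - c) - (b - d)" .
qed
lift_definition uminus_sphere :: "'a sphere \<Rightarrow> 'a sphere" is uminus
  by (simp only: minus_diff_minus dvd_minus_iff)
lift_definition times_sphere :: "'a sphere \<Rightarrow> 'a sphere \<Rightarrow> 'a sphere" is "(*)"
proof -
  fix a b c d :: "'a poly poly poly"
  assume "sphere_poly dvd a - b" "sphere_poly dvd c - d"
  then have "sphere_poly dvd (a - b) * c + b * (c - d)"
    by (intro dvd_add dvd_mult dvd_mult2)
  also have "(a - b) * c + b * (c - d) = a * c - b * d"
    by (rule mult_diff_telescope)
  finally show "sphere_poly dvd a * c - b * d" .
qed

instance
proof
  have eq_imp_dvd: "p = q \<Longrightarrow> sphere_poly dvd p - q" for p q :: "'a poly poly poly"
    by (simp only: diff_self dvd_0_right)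
  fix a b c :: "'a sphere"
  show "a * b * c = a * (b * c)" by (transfer, rule eq_imp_dvd, rule mult.assoc)
  show "a * b = b * a" by (transfer, rule eq_imp_dvd, rule mult.commute)
  show "1 * a = a" by (transfer, rule eq_imp_dvd, rule mult_1_left)
  show "a + b + c = a + (b + c)" by (transfer, rule eq_imp_dvd, rule add.assoc)
  show "a + b = b + a" by (transfer, rule eq_imp_dvd, rule add.commute)
  show "0 + a = a" by (transfer, rule eq_imp_dvd, rule add_0_left)
  show "- a + a = 0" by (transfer, rule eq_imp_dvd, rule left_minus)
  show "a - b = a + - b" by (transfer, rule eq_imp_dvd, rule diff_conv_add_uminus)
  show "(a + b) * c = a * c + b * c" by (transfer, rule eq_imp_dvd, rule distrib_right)
  show "a * (b + c) = a * b + a * c" by (transfer, rule eq_imp_dvd, rule distrib_left)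
  show "0 * a = 0" by (transfer, rule eq_imp_dvd, rule mult_zero_left)
  show "a * 0 = 0" by (transfer, rule eq_imp_dvd, rule mult_zero_right)
  have "\<not> sphere_poly dvd (1 :: 'a poly poly poly)"
    using prime_elem_sphere_poly by (rule prime_elem_not_unit)
  then show "(0 :: 'a sphere) \<noteq> 1"
    by transfer (simp only: diff_0 dvd_minus_iff not_False_eq_True)
  show "a \<noteq> 0 \<Longrightarrow> b \<noteq> 0 \<Longrightarrow> a * b \<noteq> 0"
    by transfer (simp only: diff_0_right prime_elem_dvd_mult_iff[OF prime_elem_sphere_poly]
        de_Morgan_disj simp_thms)
qed

end

lift_definition sphere_const :: "'k::field_char_0 \<Rightarrow> 'k sphere" is "\<lambda>c. [:[:[:c:]:]:]" .

lift_definition sphere_coord :: "coord \<Rightarrow> 'k::field_char_0 sphere" is coord_poly .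

lemma sphere_relation:
  "sphere_coord CX ^ 2 + sphere_coord CY ^ 2 + sphere_coord CZ ^ 2 = (1 :: 'k::field_char_0 sphere)"
  unfolding power2_eq_square
  by transfer (simp only: sphere_poly_def power2_eq_square dvd_refl)

abbreviation sphere_ring :: "'k::field_char_0 sphere ring" where
  "sphere_ring \<equiv> ring_of_type_algebra"


section \<open>Derivations\<close>

text \<open>
  Derivations over \<open>k\<close> of a subring \<open>S\<close> that contains the image of \<open>\<iota> : k \<rightarrow> S\<close>. They are
  extensional, so that a derivation is determined by its values on \<open>S\<close>.
\<close>

definition derivations :: "('k \<Rightarrow> 'r) \<Rightarrow> 'r set \<Rightarrow> ('r \<Rightarrow> 'r::comm_ring_1) set" where
  "derivations \<iota> S = {D \<in> S \<rightarrow>\<^sub>E S.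
     (\<forall>f\<in>S. \<forall>g\<in>S. D (f + g) = D f + D g) \<and>
     (\<forall>c. \<forall>f\<in>S. D (\<iota> c * f) = \<iota> c * D f) \<and>
     (\<forall>f\<in>S. \<forall>g\<in>S. D (f * g) = D f * g + f * D g)}"

definition vector_fields :: "('k::field_char_0 sphere \<Rightarrow> 'k sphere) set" where
  "vector_fields = derivations sphere_const UNIV"


section \<open>Modules over functions and vector fields\<close>

record ('a, 'm) av_structure = "('a, 'm) module" +
  lie_act :: "('a \<Rightarrow> 'a) \<Rightarrow> 'm \<Rightarrow> 'm"

text \<open>
  The \<open>k\<close>-vector space structure is the one obtained by restriction of scalars along
  \<open>k \<rightarrow> A\<close>.
\<close>

locale av_module = module sphere_ring M
  for M :: "('k::field_char_0 sphere, 'm) av_structure" (structure) +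
  assumes lie_closed:
      "\<lbrakk>\<eta> \<in> vector_fields; m \<in> carrier M\<rbrakk> \<Longrightarrow> lie_act M \<eta> m \<in> carrier M"
    and lie_add_right:
      "\<lbrakk>\<eta> \<in> vector_fields; m \<in> carrier M; n \<in> carrier M\<rbrakk> \<Longrightarrow>
        lie_act M \<eta> (m \<oplus>\<^bsub>M\<^esub> n) = lie_act M \<eta> m \<oplus>\<^bsub>M\<^esub> lie_act M \<eta> n"
    and lie_scale_right:
      "\<lbrakk>\<eta> \<in> vector_fields; m \<in> carrier M\<rbrakk> \<Longrightarrow>
        lie_act M \<eta> (sphere_const c \<odot>\<^bsub>M\<^esub> m) = sphere_const c \<odot>\<^bsub>M\<^esub> lie_act M \<eta> m"
    and lie_add_left:
      "\<lbrakk>\<eta> \<in> vector_fields; \<mu> \<in> vector_fields; m \<in> carrier M\<rbrakk> \<Longrightarrow>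
        lie_act M (\<lambda>a. \<eta> a + \<mu> a) m = lie_act M \<eta> m \<oplus>\<^bsub>M\<^esub> lie_act M \<mu> m"
    and lie_scale_left:
      "\<lbrakk>\<eta> \<in> vector_fields; m \<in> carrier M\<rbrakk> \<Longrightarrow>
        lie_act M (\<lambda>a. sphere_const c * \<eta> a) m = sphere_const c \<odot>\<^bsub>M\<^esub> lie_act M \<eta> m"
    and lie_bracket:
      "\<lbrakk>\<eta> \<in> vector_fields; \<mu> \<in> vector_fields; m \<in> carrier M\<rbrakk> \<Longrightarrow>
        lie_act M (\<lambda>a. \<eta> (\<mu> a) - \<mu> (\<eta> a)) m =
          lie_act M \<eta> (lie_act M \<mu> m) \<ominus>\<^bsub>M\<^esub> lie_act M \<mu> (lie_act M \<eta> m)"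
    and lie_leibniz:
      "\<lbrakk>\<eta> \<in> vector_fields; m \<in> carrier M\<rbrakk> \<Longrightarrow>
        lie_act M \<eta> (a \<odot>\<^bsub>M\<^esub> m) = \<eta> a \<odot>\<^bsub>M\<^esub> m \<oplus>\<^bsub>M\<^esub> a \<odot>\<^bsub>M\<^esub> lie_act M \<eta> m"

definition av_submodule :: "'m set \<Rightarrow> ('k::field_char_0 sphere, 'm) av_structure \<Rightarrow> bool" where
  "av_submodule S M \<longleftrightarrow> submodule S sphere_ring M \<and>
     (\<forall>\<eta>\<in>vector_fields. \<forall>m\<in>S. lie_act M \<eta> m \<in> S)"

definition av_hom ::
  "('k::field_char_0 sphere, 'm) av_structure \<Rightarrow> ('k sphere, 'n) av_structure \<Rightarrow> ('m \<Rightarrow> 'n) set"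
where
  "av_hom M N = {\<phi> \<in> carrier M \<rightarrow> carrier N.
     (\<forall>m\<in>carrier M. \<forall>n\<in>carrier M. \<phi> (m \<oplus>\<^bsub>M\<^esub> n) = \<phi> m \<oplus>\<^bsub>N\<^esub> \<phi> n) \<and>
     (\<forall>a. \<forall>m\<in>carrier M. \<phi> (a \<odot>\<^bsub>M\<^esub> m) = a \<odot>\<^bsub>N\<^esub> \<phi> m) \<and>
     (\<forall>\<eta>\<in>vector_fields. \<forall>m\<in>carrier M. \<phi> (lie_act M \<eta> m) = lie_act N \<eta> (\<phi> m))}"

definition av_simple :: "('k::field_char_0 sphere, 'm) av_structure \<Rightarrow> bool" where
  "av_simple M \<longleftrightarrow> av_module M \<and> carrier M \<noteq> {\<zero>\<^bsub>M\<^esub>} \<and>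
     (\<forall>S. av_submodule S M \<longrightarrow> S = {\<zero>\<^bsub>M\<^esub>} \<or> S = carrier M)"

definition finitely_generated_over_A :: "('k::field_char_0 sphere, 'm) av_structure \<Rightarrow> bool" where
  "finitely_generated_over_A M \<longleftrightarrow> (\<exists>G \<subseteq> carrier M. finite G \<and>
     (\<forall>m\<in>carrier M. \<exists>c. m = (\<Oplus>\<^bsub>M\<^esub>g\<in>G. c g \<odot>\<^bsub>M\<^esub> g)))"

text \<open>Internal direct sums, possibly with infinitely many summands.\<close>

definition is_direct_sum :: "('k::field_char_0 sphere, 'm) av_structure \<Rightarrow> 'm set set \<Rightarrow> bool" where
  "is_direct_sum M \<S> \<longleftrightarrow> (\<forall>S\<in>\<S>. av_submodule S M) \<and>
     (\<forall>m\<in>carrier M. \<exists>!f. f \<in> (\<Pi>\<^sub>E S\<in>\<S>. S) \<and> finite {S\<in>\<S>. f S \<noteq> \<zero>\<^bsub>M\<^esub>} \<and>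
        m = (\<Oplus>\<^bsub>M\<^esub>S\<in>{S\<in>\<S>. f S \<noteq> \<zero>\<^bsub>M\<^esub>}. f S))"


section \<open>Tensor products\<close>

text \<open>
  \<open>M \<otimes>\<^sub>A N\<close> is the quotient of the free abelian group on the pairs \<open>(m, n)\<close> by the subgroup
  generated by the usual relators; its elements are cosets.
\<close>

inductive_set tensor_relations ::
  "('k::field_char_0 sphere, 'm) av_structure \<Rightarrow> ('k sphere, 'n) av_structure \<Rightarrow>
   ('m \<times> 'n \<Rightarrow>\<^sub>0 int) set"
  for M N where
  zero: "0 \<in> tensor_relations M N"
| diff: "\<lbrakk>u \<in> tensor_relations M N; v \<in> tensor_relations M N\<rbrakk> \<Longrightarrow> u - v \<in> tensor_relations M N"
| add_left: "\<lbrakk>m \<in> carrier M; m' \<in> carrier M; n \<in> carrier N\<rbrakk> \<Longrightarrow>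
    frag_of (m \<oplus>\<^bsub>M\<^esub> m', n) - frag_of (m, n) - frag_of (m', n) \<in> tensor_relations M N"
| add_right: "\<lbrakk>m \<in> carrier M; n \<in> carrier N; n' \<in> carrier N\<rbrakk> \<Longrightarrow>
    frag_of (m, n \<oplus>\<^bsub>N\<^esub> n') - frag_of (m, n) - frag_of (m, n') \<in> tensor_relations M N"
| balanced: "\<lbrakk>m \<in> carrier M; n \<in> carrier N\<rbrakk> \<Longrightarrow>
    frag_of (a \<odot>\<^bsub>M\<^esub> m, n) - frag_of (m, a \<odot>\<^bsub>N\<^esub> n) \<in> tensor_relations M N"

definition tensor_class ::
  "('k::field_char_0 sphere, 'm) av_structure \<Rightarrow> ('k sphere, 'n) av_structure \<Rightarrow>
   ('m \<times> 'n \<Rightarrow>\<^sub>0 int) \<Rightarrow> ('m \<times> 'n \<Rightarrow>\<^sub>0 int) set"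
where
  "tensor_class M N u = {u + r | r. r \<in> tensor_relations M N}"

text \<open>
  The operations are induced from the free abelian group. A union of the classes of the images of
  all representatives is used to descend to cosets; as the maps respect the relators, all of these
  classes coincide. The fields \<open>mult\<close> and \<open>one\<close>, which every module record inherits from
  rings, are irrelevant.
\<close>

definition av_tensor ::
  "('k::field_char_0 sphere, 'm) av_structure \<Rightarrow> ('k sphere, 'n) av_structure \<Rightarrow>
   ('k sphere, ('m \<times> 'n \<Rightarrow>\<^sub>0 int) set) av_structure"
where
  "av_tensor M N = \<lparr>
     carrier = {tensor_class M N u | u. Poly_Mapping.keys u \<subseteq> carrier M \<times> carrier N},
     monoid.mult = (\<lambda>_ _. undefined),
     one = undefined,
     ring.zero = tensor_class M N 0,
     add = (\<lambda>S T. \<Union>u\<in>S. \<Union>v\<in>T. tensor_class M N (u + v)),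
     module.smult = (\<lambda>a S. \<Union>u\<in>S. tensor_class M N
       (frag_extend (\<lambda>(m, n). frag_of (a \<odot>\<^bsub>M\<^esub> m, n)) u)),
     lie_act = (\<lambda>\<eta> S. \<Union>u\<in>S. tensor_class M N
       (frag_extend (\<lambda>(m, n). frag_of (lie_act M \<eta> m, n) + frag_of (m, lie_act N \<eta> n)) u))\<rparr>"


section \<open>Rational representations of the general linear group\<close>

text \<open>
  A rational representation on \<open>k\<^sup>n\<close> is a matrix with entries in the coordinate ring
  \<open>k[c\<^sub>0\<^sub>0, c\<^sub>0\<^sub>1, c\<^sub>1\<^sub>0, c\<^sub>1\<^sub>1, det\<^sup>-\<^sup>1]\<close> of \<open>GL\<^sub>2\<close>. It is given by the numerators of the
  entries over a common denominator, a power of \<open>det\<close>. The four nested polynomial variables are,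
  from the innermost to the outermost, \<open>c\<^sub>0\<^sub>0\<close>, \<open>c\<^sub>0\<^sub>1\<close>, \<open>c\<^sub>1\<^sub>0\<close>, \<open>c\<^sub>1\<^sub>1\<close>.
  Row and column indices start from \<open>0\<close>.
\<close>

type_synonym 'k gl2_matrix = "'k poly poly poly poly mat \<times> nat"

abbreviation numerators :: "'k::zero gl2_matrix \<Rightarrow> 'k poly poly poly poly mat" where
  "numerators \<equiv> fst"

abbreviation det_exponent :: "'k::zero gl2_matrix \<Rightarrow> nat" where
  "det_exponent \<equiv> snd"

abbreviation rep_dim :: "'k::zero gl2_matrix \<Rightarrow> nat" where
  "rep_dim \<rho> \<equiv> dim_row (numerators \<rho>)"

definition eval_entries ::
  "('k::comm_ring_1 \<Rightarrow> 'r::comm_ring_1) \<Rightarrow> 'r mat \<Rightarrow> 'k poly poly poly poly \<Rightarrow> 'r"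
where
  "eval_entries \<iota> g P =
     poly (map_poly (\<lambda>P1.
       poly (map_poly (\<lambda>P2.
         poly (map_poly (\<lambda>P3.
           poly (map_poly \<iota> P3) (g $$ (0, 0))) P2) (g $$ (0, 1))) P1) (g $$ (1, 0))) P) (g $$ (1, 1))"

text \<open>
  Substitution of an invertible \<open>2 \<times> 2\<close> matrix over a \<open>k\<close>-algebra with structure map \<open>\<iota>\<close>.
\<close>

definition rep_subst ::
  "('k::comm_ring_1 \<Rightarrow> 'r::{comm_ring_1, inverse}) \<Rightarrow> 'k gl2_matrix \<Rightarrow> 'r mat \<Rightarrow> 'r mat"
where
  "rep_subst \<iota> \<rho> g =
     map_mat (\<lambda>P. eval_entries \<iota> g P * inverse (det g ^ det_exponent \<rho>)) (numerators \<rho>)"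

definition rational_rep :: "'k::field gl2_matrix \<Rightarrow> bool" where
  "rational_rep \<rho> \<longleftrightarrow> square_mat (numerators \<rho>) \<and>
     rep_subst (\<lambda>c. c) \<rho> (1\<^sub>m 2) = 1\<^sub>m (rep_dim \<rho>) \<and>
     (\<forall>g h. g \<in> carrier_mat 2 2 \<and> h \<in> carrier_mat 2 2 \<and> invertible_mat g \<and> invertible_mat h \<longrightarrow>
        rep_subst (\<lambda>c. c) \<rho> (g * h) = rep_subst (\<lambda>c. c) \<rho> g * rep_subst (\<lambda>c. c) \<rho> h)"

text \<open>
  The matrix of the action of the matrix unit \<open>E\<^sub>p\<^sub>,\<^sub>i\<close> in the differentiated representation: the
  coefficient of \<open>\<epsilon>\<close> in \<open>\<rho>(1 + \<epsilon> E\<^sub>p\<^sub>,\<^sub>i)\<close>, computed over \<open>k[[\<epsilon>]]\<close>.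
\<close>

definition rep_deriv :: "'k::field gl2_matrix \<Rightarrow> nat \<Rightarrow> nat \<Rightarrow> 'k mat" where
  "rep_deriv \<rho> p i = map_mat (\<lambda>F. fps_nth F 1)
     (rep_subst fps_const \<rho>
       (1\<^sub>m 2 + mat 2 2 (\<lambda>(a, b). if a = p \<and> b = i then fps_X else 0)))"


section \<open>Charts\<close>

text \<open>All localizations of \<open>A\<close> are regarded as subrings of the field of fractions of \<open>A\<close>.\<close>

definition frac_const :: "'k::field_char_0 \<Rightarrow> 'k sphere fract" where
  "frac_const c = to_fract (sphere_const c)"

definition localization :: "coord \<Rightarrow> 'k::field_char_0 sphere fract set" where
  "localization h = {to_fract a / to_fract (sphere_coord h) ^ n | a n. True}"

fun chart_coord :: "coord \<Rightarrow> nat \<Rightarrow> coord" where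
  "chart_coord CX i = [CY, CZ] ! i"
| "chart_coord CY i = [CX, CZ] ! i"
| "chart_coord CZ i = [CX, CY] ! i"

abbreviation chart_param :: "coord \<Rightarrow> nat \<Rightarrow> 'k::field_char_0 sphere" where
  "chart_param h i \<equiv> sphere_coord (chart_coord h i)"

definition chart_deriv ::
  "coord \<Rightarrow> nat \<Rightarrow> 'k::field_char_0 sphere fract \<Rightarrow> 'k sphere fract"
where
  "chart_deriv h i = (THE D. D \<in> derivations frac_const (localization h) \<and>
     (\<forall>j<2. D (to_fract (chart_param h j)) = (if j = i then 1 else 0)))"

text \<open>
  The coefficient of \<open>\<partial>/\<partial>t\<^sub>i\<close> in \<open>\<eta>\<close> is \<open>\<eta>(t\<^sub>i)\<close>.
\<close>

definition field_coeff ::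
  "coord \<Rightarrow> ('k::field_char_0 sphere \<Rightarrow> 'k sphere) \<Rightarrow> nat \<Rightarrow> 'k sphere fract"
where
  "field_coeff h \<eta> i = to_fract (\<eta> (chart_param h i))"

text \<open>
  For \<open>U = k\<^sup>n\<close>, the tensor product of the localization at \<open>h\<close> with \<open>U\<close> over \<open>k\<close> consists of
  the vectors of length \<open>n\<close> with entries in that localization.
\<close>

definition chart_module ::
  "'k::field_char_0 gl2_matrix \<Rightarrow> coord \<Rightarrow> ('k sphere, 'k sphere fract vec) av_structure"
where
  "chart_module \<rho> h = \<lparr>
     carrier = {v \<in> carrier_vec (rep_dim \<rho>). set\<^sub>v v \<subseteq> localization h},
     monoid.mult = (\<lambda>_ _. undefined),
     one = undefined,
     ring.zero = 0\<^sub>v (rep_dim \<rho>),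
     add = (+),
     module.smult = (\<lambda>a v. to_fract a \<cdot>\<^sub>v v),
     lie_act = (\<lambda>\<eta> v. vec (rep_dim \<rho>) (\<lambda>k.
       (\<Sum>i<2. field_coeff h \<eta> i * chart_deriv h i (vec_index v k)) +
       (\<Sum>p<2. \<Sum>i<2. chart_deriv h p (field_coeff h \<eta> i) *
          vec_index (map_mat frac_const (rep_deriv \<rho> p i) *\<^sub>v v) k)))\<rparr>"

text \<open>
  The matrix of \<open>C\<close>: column \<open>i\<close> holds the coordinates \<open>\<partial>t\<^sub>i/\<partial>t'\<^sub>j\<close> of \<open>C e\<^sub>i\<close>.
\<close>

definition chart_change :: "coord \<Rightarrow> coord \<Rightarrow> 'k::field_char_0 sphere fract mat" where
  "chart_change h h' = mat 2 2 (\<lambda>(j, i). chart_deriv h' j (to_fract (chart_param h i)))"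


section \<open>Tensor modules\<close>

definition tensor_module :: "('k::field_char_0 sphere, 'm) av_structure \<Rightarrow> bool" where
  "tensor_module M \<longleftrightarrow> av_module M \<and> finitely_generated_over_A M \<and>
     (\<exists>\<rho> \<phi>. rational_rep \<rho> \<and>
        (\<forall>h. \<phi> h \<in> av_hom M (chart_module \<rho> h) \<and> inj_on (\<phi> h) (carrier M)) \<and>
        (\<forall>h h'. \<forall>m\<in>carrier M.
           rep_subst frac_const \<rho> (chart_change h h') *\<^sub>v \<phi> h m = \<phi> h' m))"

definition simple_tensor_module :: "('k::field_char_0 sphere, 'm) av_structure \<Rightarrow> bool" where
  "simple_tensor_module M \<longleftrightarrow> tensor_module M \<and> av_simple M"

definition direct_sum_of_simple_tensor_modules ::
  "('k::field_char_0 sphere, 'm) av_structure \<Rightarrow> bool"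
where
  "direct_sum_of_simple_tensor_modules M \<longleftrightarrow> av_module M \<and>
     (\<exists>\<S>. is_direct_sum M \<S> \<and> (\<forall>S\<in>\<S>. simple_tensor_module (M\<lparr>carrier := S\<rparr>)))"

end

theory Submission
  imports Defs "HOL-Library.Function_Algebras"
begin

text \<open>
  Fix a chart, let \<open>K\<close> be the fraction field of \<open>A\<close>, and regard a tensor module as a subset of
  \<open>K\<^sup>n\<close>. The operators \<open>(f \<eta>) - f \<eta>\<close> show that the \<open>K\<close>-span of a submodule is stable under the
  matrix units of \<open>gl\<^sub>2\<close> and under the chart derivations. Conversely, as \<open>A\<close> has no proper nonzero
  ideal stable under \<open>\<V>\<close>, a submodule of a finitely generated module is determined by its span.

  For a simple module the span contains a highest weight vector that is killed by the chart
  derivations, hence it is the \<open>K\<close>-space of a single highest weight string. The span of \<open>M \<otimes> N\<close> is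
  the tensor product of two strings, which the Clebsch-Gordan vectors decompose into strings of
  distinct highest weights. The corresponding submodules are simple, and their sum is
  everything because it has the right span. As submodules of \<open>M \<otimes> N\<close> they are tensor modules for
  the tensor product of the two representations.
\<close>

section \<open>The coordinate ring\<close>

text \<open>Over K the statement is the Clebsch-Gordan rule; the obstacles lie in the return to A. A
  decomposition over K has denominators, and M \<otimes> N could have torsion that its map to
  vectors over K does not see. Both difficulties yield to one argument: the elements of A that move
  one submodule into another form an ideal stable under \<V>, so a single nonzero common denominator
  already forces equality, and finite generation supplies it. The passage to K keeps weight theory
  usable because the matrix units act by matrices over k. As k is algebraically closed, their
  eigenvalues are constants; the chart derivations kill constants, so they preserve weight spaces,
  and flat vectors can be found there. Complete reducibility is not invoked: the summands of a
  product of two strings are exhibited and then separated by their Casimir eigenvalues. One chart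
  carries the decomposition; the others enter when the summands are recognized as tensor
  modules.\<close>

definition leibniz :: "('r::comm_ring_1 \<Rightarrow> 'r) \<Rightarrow> bool" where
  "leibniz D \<longleftrightarrow> (\<forall>p q. D (p + q) = D p + D q) \<and> (\<forall>p q. D (p * q) = D p * q + p * D q)"

lemma leibniz_add: "leibniz D \<Longrightarrow> D (p + q) = D p + D q"
  and leibniz_mult: "leibniz D \<Longrightarrow> D (p * q) = D p * q + p * D q"
  by (auto simp: leibniz_def)

lemma leibniz_0 [simp]: "leibniz D \<Longrightarrow> D 0 = 0"
  using leibniz_add[of D 0 0] by simp

lemma leibniz_1 [simp]: "leibniz D \<Longrightarrow> D 1 = 0"
  using leibniz_mult[of D 1 1] by simp

lemma leibniz_minus: "leibniz D \<Longrightarrow> D (- p) = - D p"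
  using leibniz_add[of D p "- p"] by (simp add: add_eq_0_iff)

lemma leibniz_diff: "leibniz D \<Longrightarrow> D (p - q) = D p - D q"
  using leibniz_add[of D p "- q"] by (simp add: leibniz_minus)

lemma leibniz_pderiv: "leibniz (pderiv :: 'r::idom poly \<Rightarrow> _)"
  unfolding leibniz_def by (simp add: pderiv_add pderiv_mult mult.commute)

lemma map_poly_plus:
  "(\<And>a b. f (a + b) = f a + f b) \<Longrightarrow> f 0 = 0 \<Longrightarrow> map_poly f (p + q) = map_poly f p + map_poly f q"
  by (rule poly_eqI) (simp add: coeff_map_poly)

lemma leibniz_map_poly:
  assumes D: "leibniz D"
  shows "leibniz (map_poly D)"
proof -
  note [simp] = leibniz_0[OF D] leibniz_add[OF D] leibniz_mult[OF D]
  have add: "map_poly D (p + q) = map_poly D p + map_poly D q" for p q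
    by (rule map_poly_plus) simp_all
  have sm: "map_poly D (smult a q) = smult (D a) q + smult a (map_poly D q)" for a q
    by (rule poly_eqI) (simp add: coeff_map_poly)
  have "map_poly D (p * q) = map_poly D p * q + p * map_poly D q" for p q
    by (induction p) (simp_all add: add sm map_poly_pCons algebra_simps)
  then show ?thesis using add by (simp add: leibniz_def)
qed

fun partial_deriv :: "coord \<Rightarrow> 'k::idom poly poly poly \<Rightarrow> 'k poly poly poly" where
  "partial_deriv CX = map_poly (map_poly pderiv)"
| "partial_deriv CY = map_poly pderiv"
| "partial_deriv CZ = pderiv"

lemma leibniz_partial_deriv: "leibniz (partial_deriv a)"
  by (cases a) (auto intro: leibniz_map_poly leibniz_pderiv)

lemma partial_deriv_coord: "partial_deriv a (coord_poly b) = (if a = b then 1 else 0)"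
  by (cases a; cases b) (simp_all add: pderiv_pCons map_poly_pCons one_pCons)

lemma partial_deriv_const: "partial_deriv a [:[:[:c:]:]:] = 0"
  by (cases a) (simp_all add: map_poly_pCons)

text \<open>The infinitesimal rotation in the plane of two coordinates. It kills x^2 + y^2 + z^2 and
  so descends to A. Rotating a chart parameter t_i against h gives h d/dt_i, a vector field on A in
  place of a derivation with denominators.\<close>

definition rot_poly :: "coord \<Rightarrow> coord \<Rightarrow> 'k::idom poly poly poly \<Rightarrow> 'k poly poly poly" where
  "rot_poly a b p = coord_poly b * partial_deriv a p - coord_poly a * partial_deriv b p"

lemma leibniz_rot_poly: "leibniz (rot_poly a b)"
proof -
  note A = leibniz_partial_deriv[of a] and B = leibniz_partial_deriv[of b]
  show ?thesis unfolding leibniz_def rot_poly_def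
    by (simp only: leibniz_add[OF A] leibniz_add[OF B] leibniz_mult[OF A] leibniz_mult[OF B])
      (simp only: algebra_simps simp_thms)
qed

lemma rot_poly_coord:
  "rot_poly a b (coord_poly c) =
    (if c = a then coord_poly b else 0) - (if c = b then coord_poly a else 0)"
  unfolding rot_poly_def partial_deriv_coord by (auto simp only: mult_1_right mult_zero_right split: if_splits)

lemma rot_poly_sphere: "rot_poly a b sphere_poly = 0"
proof -
  note R = leibniz_rot_poly
  show ?thesis
    unfolding sphere_poly_def power2_eq_square
    by (cases a; cases b; simp only: leibniz_diff[OF R] leibniz_add[OF R] leibniz_mult[OF R]
        rot_poly_coord leibniz_1[OF R] coord.distinct if_True if_False;
        simp add: algebra_simps del: coord_poly.simps)
qed

lift_definition rot :: "coord \<Rightarrow> coord \<Rightarrow> 'k::field_char_0 sphere \<Rightarrow> 'k sphere" is rot_poly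
proof -
  fix a b and p q :: "'k poly poly poly"
  note R = leibniz_rot_poly[of a b]
  assume "sphere_poly dvd p - q"
  then obtain s where s: "p - q = sphere_poly * s" by blast
  have "rot_poly a b p - rot_poly a b q = sphere_poly * rot_poly a b s"
    unfolding leibniz_diff[OF R, symmetric] s leibniz_mult[OF R] rot_poly_sphere
    by (simp only: mult_zero_left add_0_left)
  then show "sphere_poly dvd rot_poly a b p - rot_poly a b q" by (metis dvd_triv_left)
qed

lemma sphere_dvd_refl: "p = q \<Longrightarrow> sphere_poly dvd p - q"
  by (simp only: diff_self dvd_0_right)

lemma rot_add: "rot a b (p + q) = rot a b p + rot a b q"
  by (transfer, rule sphere_dvd_refl, rule leibniz_add[OF leibniz_rot_poly])

lemma rot_mult: "rot a b (p * q) = rot a b p * q + p * rot a b q"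
  by (transfer, rule sphere_dvd_refl, rule leibniz_mult[OF leibniz_rot_poly])

lemma leibniz_rot: "leibniz (rot a b)"
  by (simp add: leibniz_def rot_add rot_mult)

lemma rot_const [simp]: "rot a b (sphere_const c) = 0"
  by (transfer, rule sphere_dvd_refl)
    (simp only: rot_poly_def partial_deriv_const mult_zero_right diff_self)

lemma rot_coord:
  "rot a b (sphere_coord c) =
    (if c = a then sphere_coord b else 0) - (if c = b then sphere_coord a else 0)"
  by (cases "c = a"; cases "c = b"; simp only: if_True if_False; transfer;
      simp only: rot_poly_coord if_True if_False diff_self dvd_0_right)

lemma sphere_const_hom [simp]:
  "sphere_const 0 = 0" "sphere_const 1 = 1"
  "sphere_const (a + b) = sphere_const a + sphere_const b"
  "sphere_const (a * b) = sphere_const a * sphere_const b"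
  "sphere_const (- a) = - sphere_const a"
  "sphere_const (a - b) = sphere_const a - sphere_const b"
  by (transfer, rule sphere_dvd_refl, simp add: one_pCons)+

lemma sphere_const_inj: "sphere_const a = sphere_const b \<longleftrightarrow> a = b"
proof
  assume "sphere_const a = sphere_const b"
  then have "sphere_const (a - b) = 0" by simp
  moreover have "sphere_const (a - b) * sphere_const (inverse (a - b)) = 1" if "a \<noteq> b"
    using that by (simp only: sphere_const_hom(4)[symmetric]) simp
  ultimately show "a = b" by auto
qed simp

definition sphere_of :: "'k::field_char_0 poly poly poly \<Rightarrow> 'k sphere" where
  "sphere_of p = abs_sphere p"

lemma sphere_of_hom:
  "sphere_of 0 = 0" "sphere_of 1 = 1"
  "sphere_of (p + q) = sphere_of p + sphere_of q"
  "sphere_of (p - q) = sphere_of p - sphere_of q"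
  "sphere_of (p * q) = sphere_of p * sphere_of q"
  by (simp_all only: sphere_of_def zero_sphere.abs_eq one_sphere.abs_eq plus_sphere.abs_eq
      minus_sphere.abs_eq times_sphere.abs_eq)

lemma sphere_of_coord: "sphere_of (coord_poly a) = sphere_coord a"
  by (simp only: sphere_of_def sphere_coord.abs_eq)

lemma sphere_of_const: "sphere_of [:[:[:c:]:]:] = sphere_const c"
  by (simp only: sphere_of_def sphere_const.abs_eq)

lemma rot_sphere_of: "rot a b (sphere_of p) = sphere_of (rot_poly a b p)"
  by (simp only: sphere_of_def rot.abs_eq)

lemma sphere_of_surj: "\<exists>p. a = sphere_of p"
  unfolding sphere_of_def by (metis Quotient3_abs_rep Quotient3_sphere)

lemma sphere_of_eq_0_iff: "sphere_of p = 0 \<longleftrightarrow> sphere_poly dvd p"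
  unfolding sphere_of_def zero_sphere.abs_eq sphere.abs_eq_iff by (simp only: diff_0_right)

text \<open>A is generated by constants and coordinates; the stages of the proof adjoin the nested
  variables from the inside outwards. Identities between derivations are reduced to generators in
  this way.\<close>

lemma sphere_induct [case_names const coord add mult]:
  fixes a :: "'k::field_char_0 sphere"
  assumes const: "\<And>c. P (sphere_const c)" and coord: "\<And>h. P (sphere_coord h)"
    and add: "\<And>a b. P a \<Longrightarrow> P b \<Longrightarrow> P (a + b)" and mult: "\<And>a b. P a \<Longrightarrow> P b \<Longrightarrow> P (a * b)"
  shows "P a"
proof -
  have pC: "pCons a p = [:a:] + [:0, 1:] * p" for a :: "'r::comm_ring_1" and p by simp
  have 0: "P (sphere_of 0)" using const[of 0] by (simp only: sphere_of_hom sphere_const_hom)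
  have 1: "P (sphere_of [:[:p:]:])" for p
  proof (induction p)
    case 0 then show ?case using \<open>P (sphere_of 0)\<close> by simp
  next
    case (pCons a p)
    have "[:[:pCons a p:]:] = [:[:[:a:]:]:] + coord_poly CX * [:[:p:]:]"
      by (subst pC) simp
    then show ?case using pCons const[of a] coord[of CX]
      by (simp only: sphere_of_hom sphere_of_coord sphere_of_const add mult)
  qed
  have 2: "P (sphere_of [:p:])" for p
  proof (induction p)
    case 0 then show ?case using \<open>P (sphere_of 0)\<close> by simp
  next
    case (pCons a p)
    have "[:pCons a p:] = [:[:a:]:] + coord_poly CY * [:p:]"
      by (subst pC) simp
    then show ?case using pCons 1[of a] coord[of CY]
      by (simp only: sphere_of_hom sphere_of_coord add mult)
  qed
  have 3: "P (sphere_of p)" for p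
  proof (induction p)
    case 0 then show ?case using \<open>P (sphere_of 0)\<close> by simp
  next
    case (pCons a p)
    have "pCons a p = [:a:] + coord_poly CZ * p"
      by (subst pC) simp
    then show ?case using pCons 2[of a] coord[of CZ]
      by (simp only: sphere_of_hom sphere_of_coord add mult)
  qed
  show ?thesis using sphere_of_surj[of a] 3 by auto
qed

section \<open>A as a free module over k[x, y] with basis 1, z\<close>

definition sphere_xy :: "'k::field_char_0 poly poly \<Rightarrow> 'k sphere" where
  "sphere_xy p = sphere_of [:p:]"

definition radicand :: "'k::field_char_0 poly poly" where
  "radicand = 1 - [:0, 1:]^2 - [:[:0, 1:]:]^2"

lemma sphere_poly_radicand: "sphere_poly = [:-radicand, 0, 1:]"
  by (simp add: sphere_poly_def radicand_def power2_eq_square one_pCons)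

lemma sphere_xy_hom:
  "sphere_xy (p + q) = sphere_xy p + sphere_xy q"
  "sphere_xy (p - q) = sphere_xy p - sphere_xy q"
  "sphere_xy (p * q) = sphere_xy p * sphere_xy q"
  unfolding sphere_xy_def sphere_of_hom(3-)[symmetric] by (simp_all add: mult.commute)

lemma sphere_xy_linear_0: "sphere_xy a + sphere_xy b * sphere_coord CZ = 0 \<longleftrightarrow> a = 0 \<and> b = 0"
proof -
  have "sphere_xy a + sphere_xy b * sphere_coord CZ = sphere_of [:a, b:]"
    unfolding sphere_xy_def sphere_of_coord[symmetric] sphere_of_hom(3-)[symmetric] by simp
  then show ?thesis
    using quadratic_dvd_linear[of radicand a b]
    by (auto simp add: sphere_of_eq_0_iff sphere_poly_radicand)
qed

lemma sphere_normal_form: "\<exists>a b. f = sphere_xy a + sphere_xy b * sphere_coord CZ"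
proof -
  obtain p where p: "f = sphere_of p" using sphere_of_surj by blast
  obtain q a b where "p = q * [:-radicand, 0, 1:] + [:a, b:]" using quadratic_remainder by blast
  then have "p - ([:a:] + [:b:] * coord_poly CZ) = sphere_poly * q"
    by (simp add: sphere_poly_radicand mult.commute)
  then have "sphere_of (p - ([:a:] + [:b:] * coord_poly CZ)) = 0"
    unfolding sphere_of_eq_0_iff by (metis dvd_triv_left)
  then show ?thesis unfolding p sphere_xy_def sphere_of_coord[symmetric] sphere_of_hom
    by (metis eq_iff_diff_eq_0)
qed

lemma sphere_coord_nonzero [simp]: "sphere_coord h \<noteq> (0 :: 'k::field_char_0 sphere)"
proof -
  have "sphere_xy [:0, 1:] = (sphere_coord CY :: 'k sphere)"
    "sphere_xy [:[:0, 1:]:] = (sphere_coord CX :: 'k sphere)"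
    "sphere_xy 0 = (0 :: 'k sphere)" "sphere_xy 1 = (1 :: 'k sphere)"
    unfolding sphere_xy_def sphere_of_coord[symmetric]
    by (simp_all add: sphere_of_hom one_pCons[symmetric])
  moreover have "sphere_xy p \<noteq> 0" if "p \<noteq> 0" for p :: "'k poly poly"
    using that sphere_xy_linear_0[of p 0] calculation(3) by (simp only: mult_zero_left add_0_right simp_thms)
  moreover have "sphere_coord CZ \<noteq> (0 :: 'k sphere)"
    using sphere_xy_linear_0[of 0 "1 :: 'k poly poly"] calculation(3,4)
    by (simp only: mult_1_left add_0_left one_neq_zero simp_thms)
  ultimately show ?thesis
    by (cases h) (metis pCons_eq_0_iff one_neq_zero)+
qed

subsection \<open>Vector fields\<close>

lemma vector_fieldsI:
  assumes "leibniz D" "\<And>c. D (sphere_const c) = 0"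
  shows "D \<in> vector_fields"
  using assms by (auto simp: vector_fields_def derivations_def leibniz_def)

lemma vector_fieldsD:
  assumes "D \<in> vector_fields"
  shows "leibniz D" "D (sphere_const c) = 0"
proof -
  have *: "D (sphere_const c * f) = sphere_const c * D f" for c f
    using assms by (auto simp: vector_fields_def derivations_def leibniz_def)
  show L: "leibniz D"
    using assms by (auto simp: vector_fields_def derivations_def leibniz_def)
  show "D (sphere_const c) = 0"
    using *[of c 1] L by simp
qed

lemma rot_vector_field: "rot a b \<in> vector_fields"
  by (rule vector_fieldsI[OF leibniz_rot]) simp

lemma vector_fields_mult: "\<eta> \<in> vector_fields \<Longrightarrow> (\<lambda>a. f * \<eta> a) \<in> vector_fields"
  by (rule vector_fieldsI) (auto simp: leibniz_def leibniz_add[OF vector_fieldsD(1)]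
      leibniz_mult[OF vector_fieldsD(1)] vector_fieldsD(2) algebra_simps)

lemma vector_fields_add:
  "\<eta> \<in> vector_fields \<Longrightarrow> \<mu> \<in> vector_fields \<Longrightarrow> (\<lambda>a. \<eta> a + \<mu> a) \<in> vector_fields"
  by (rule vector_fieldsI) (auto simp: leibniz_def leibniz_add[OF vector_fieldsD(1)]
      leibniz_mult[OF vector_fieldsD(1)] vector_fieldsD(2) algebra_simps)

lemma vector_fields_bracket:
  "\<eta> \<in> vector_fields \<Longrightarrow> \<mu> \<in> vector_fields \<Longrightarrow> (\<lambda>a. \<eta> (\<mu> a) - \<mu> (\<eta> a)) \<in> vector_fields"
  by (rule vector_fieldsI) (auto simp: leibniz_def leibniz_add[OF vector_fieldsD(1)]
      leibniz_mult[OF vector_fieldsD(1)] vector_fieldsD(2) leibniz_0[OF vector_fieldsD(1)] algebra_simps)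

section \<open>Differential simplicity of A\<close>

lemma rot_sphere_xy_y: "rot CY CZ (sphere_xy p) = sphere_coord CZ * sphere_xy (pderiv p)"
  unfolding sphere_xy_def rot_sphere_of sphere_of_coord[symmetric] sphere_of_hom(3-)[symmetric]
  by (simp add: rot_poly_def map_poly_pCons del: coord_poly.simps)

lemma rot_sphere_xy_x:
  "rot CX CZ (sphere_xy [:p:]) = sphere_coord CZ * sphere_xy [:pderiv p:]"
  unfolding sphere_xy_def rot_sphere_of sphere_of_coord[symmetric] sphere_of_hom(3-)[symmetric]
  by (simp add: rot_poly_def map_poly_pCons del: coord_poly.simps)

text \<open>Such an ideal contains 1 as soon as it is nonzero (\<open>nonzero_imp_1\<close>). The
  norm brings an element into k[x, y]; the derivations z d/dx and z d/dy lower its degree but cost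
  powers of z; a power of z in the ideal is then differentiated down to 1.\<close>

locale stable_ideal =
  fixes I :: "'k::field_char_0 sphere set"
  assumes add: "a \<in> I \<Longrightarrow> b \<in> I \<Longrightarrow> a + b \<in> I"
    and mult: "a \<in> I \<Longrightarrow> f * a \<in> I"
    and stable: "\<eta> \<in> vector_fields \<Longrightarrow> a \<in> I \<Longrightarrow> \<eta> a \<in> I"
begin

abbreviation (input) "z \<equiv> sphere_coord CZ :: 'k sphere"

lemma diff: "a \<in> I \<Longrightarrow> b \<in> I \<Longrightarrow> a - b \<in> I"
  using add[of a "-1 * b"] mult[of b "-1"] by simp

lemma rot_power: "rot a b (f ^ Suc M) = of_nat (Suc M) * f ^ M * rot a b (f :: 'k sphere)"
  by (induction M) (simp_all add: rot_mult algebra_simps)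

text \<open>Differentiating z^M costs one power of z; the extra factor z turns this term into a
  multiple of z^M g, which lies in I and can be subtracted. This is why the exponent grows by
  two.\<close>

lemma lower:
  assumes I: "z ^ M * g \<in> I" and R: "rot c CZ g = z * g'" and c: "c \<noteq> CZ"
  shows "z ^ (M + 2) * g' \<in> I"
proof -
  have s: "z * rot c CZ (z ^ M * g) \<in> I"
    by (rule mult[OF stable[OF rot_vector_field I]])
  have z: "rot c CZ z = - sphere_coord c" using c by (simp add: rot_coord)
  have r: "rot c CZ (z ^ M) * z = - of_nat M * z ^ M * sphere_coord c"
  proof (cases M)
    case 0
    then show ?thesis by (simp add: leibniz_1[OF leibniz_rot])
  next
    case (Suc m)
    have "rot c CZ (z ^ M) * z = of_nat (Suc m) * z ^ m * - sphere_coord c * z"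
      unfolding Suc rot_power z ..
    then show ?thesis by (simp add: Suc ac_simps del: of_nat_Suc)
  qed
  have "z * rot c CZ (z ^ M * g) = (rot c CZ (z ^ M) * z) * g + z ^ M * z * rot c CZ g"
    unfolding rot_mult by (simp add: algebra_simps)
  also have "\<dots> = (- of_nat M * sphere_coord c) * (z ^ M * g) + z ^ (M + 2) * g'"
    unfolding r R by (simp add: algebra_simps power2_eq_square)
  finally have "z ^ (M + 2) * g' = z * rot c CZ (z ^ M * g) - (- of_nat M * sphere_coord c) * (z ^ M * g)"
    by simp
  then show ?thesis using diff[OF s mult[OF I, of "- of_nat M * sphere_coord c"]] by (simp only:)
qed

text \<open>Rotating z^(M+1) against another coordinate c gives z^M c up to the invertible factor
  -(M+1). So z^M c lies in I for all three coordinates, and x^2 + y^2 + z^2 = 1 recombines these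
  elements to z^M.\<close>

lemma z_power_imp_1: "z ^ M \<in> I \<Longrightarrow> 1 \<in> I"
proof (induction M)
  case (Suc M)
  have x: "z ^ M * sphere_coord c \<in> I" for c
  proof (cases "c = CZ")
    case True then show ?thesis using Suc.prems by (simp add: mult.commute)
  next
    case False
    have "rot c CZ z = - sphere_coord c" using False by (simp add: rot_coord)
    then have "rot c CZ (z ^ Suc M) = of_nat (Suc M) * (- (z ^ M * sphere_coord c))"
      by (simp only: rot_power) simp
    moreover have "rot c CZ (z ^ Suc M) \<in> I"
      by (rule stable[OF rot_vector_field Suc.prems])
    ultimately have "sphere_const (- inverse (of_nat (Suc M))) * (of_nat (Suc M) * (- (z ^ M * sphere_coord c))) \<in> I"
      using mult by (simp only:)
    moreover have "(of_nat n :: 'k sphere) = sphere_const (of_nat n)" for n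
      by (induction n) simp_all
    moreover have "sphere_const (- inverse (of_nat (Suc M)) :: 'k) * sphere_const (of_nat (Suc M)) = -1"
      by (simp only: sphere_const_hom(4)[symmetric])
        (simp del: of_nat_Suc add: sphere_const_hom(5)[symmetric])
    ultimately show ?thesis by (simp only: mult.assoc[symmetric]) simp
  qed
  have "sphere_coord CX * (z ^ M * sphere_coord CX) + sphere_coord CY * (z ^ M * sphere_coord CY)
     + sphere_coord CZ * (z ^ M * sphere_coord CZ) \<in> I"
    by (intro add mult x)
  also have "sphere_coord CX * (z ^ M * sphere_coord CX) + sphere_coord CY * (z ^ M * sphere_coord CY)
     + sphere_coord CZ * (z ^ M * sphere_coord CZ)
     = z ^ M * (sphere_coord CX ^ 2 + sphere_coord CY ^ 2 + sphere_coord CZ ^ 2)"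
    by (simp add: algebra_simps power2_eq_square)
  finally show ?case using Suc.IH by (simp add: sphere_relation)
qed simp

lemma x_poly_imp_1: "z ^ M * sphere_xy [:p:] \<in> I \<Longrightarrow> p \<noteq> 0 \<Longrightarrow> 1 \<in> I"
proof (induction "degree p" arbitrary: p M)
  case 0
  then obtain c where p: "p = [:c:]" using degree_eq_zeroE by metis
  then have c: "c \<noteq> 0" using 0 by simp
  have "sphere_const (inverse c) * (z ^ M * sphere_const c) \<in> I"
    using 0 mult by (simp only: p sphere_xy_def sphere_of_const)
  moreover have "sphere_const (inverse c) * sphere_const c = 1"
    using c by (simp only: sphere_const_hom(4)[symmetric]) simp
  ultimately have "z ^ M \<in> I"
    by (metis mult.assoc mult.commute mult_1_left)
  then show ?case by (rule z_power_imp_1)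
next
  case (Suc n)
  have "z ^ (M + 2) * sphere_xy [:pderiv p:] \<in> I"
    by (rule lower[OF Suc.prems(1) rot_sphere_xy_x]) simp
  moreover have "degree (pderiv p) = n" "pderiv p \<noteq> 0"
    using Suc.hyps(2) by (simp_all add: degree_pderiv pderiv_eq_0_iff) 
  ultimately show ?case using Suc.hyps(1)[of "pderiv p"] by blast
qed

text \<open>Here \<open>pderiv\<close> differentiates the outer variable y; once p is constant in y,
  \<open>x_poly_imp_1\<close> takes over.\<close>

lemma xy_poly_imp_1: "z ^ M * sphere_xy p \<in> I \<Longrightarrow> p \<noteq> 0 \<Longrightarrow> 1 \<in> I"
proof (induction "degree p" arbitrary: p M)
  case 0
  then obtain c where p: "p = [:c:]" using degree_eq_zeroE by metis
  show ?case using 0 x_poly_imp_1[of M c] by (simp add: p)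
next
  case (Suc n)
  have "z ^ (M + 2) * sphere_xy (pderiv p) \<in> I"
    by (rule lower[OF Suc.prems(1) rot_sphere_xy_y]) simp
  moreover have "degree (pderiv p) = n" "pderiv p \<noteq> 0"
    using Suc.hyps(2) by (simp_all add: degree_pderiv pderiv_eq_0_iff) 
  ultimately show ?case using Suc.hyps(1)[of "pderiv p"] by blast
qed

text \<open>The norm of \<open>a + b z\<close> over \<open>k[x, y]\<close> is \<open>a\<^sup>2 - b\<^sup>2 (1 - x\<^sup>2 - y\<^sup>2)\<close>.\<close>

lemma nonzero_imp_1:
  assumes f: "f \<in> I" "f \<noteq> 0"
  shows "1 \<in> I"
proof -
  obtain a b where ab: "f = sphere_xy a + sphere_xy b * z" using sphere_normal_form by blast
  define g where "g = a^2 - b^2 * radicand"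
  have "sphere_of sphere_poly = 0" by (simp only: sphere_of_eq_0_iff dvd_refl)
  moreover have "sphere_poly = coord_poly CZ * coord_poly CZ - [:radicand :: 'k poly poly:]"
    by (simp add: sphere_poly_radicand)
  ultimately have z2: "z * z = sphere_xy radicand"
    unfolding sphere_of_coord[symmetric] sphere_of_hom(3-)[symmetric] sphere_xy_def
    using eq_iff_diff_eq_0 sphere_of_hom(4,5) by metis
  have c: "sphere_xy a - sphere_xy b * z \<noteq> 0"
  proof
    assume "sphere_xy a - sphere_xy b * z = 0"
    then have "sphere_xy a + sphere_xy (0 - b) * z = 0"
      unfolding sphere_xy_hom(2) by (simp add: sphere_xy_def sphere_of_hom)
    then have "a = 0 \<and> b = 0" unfolding sphere_xy_linear_0 by simp
    then show False using f(2) ab sphere_xy_linear_0 by blast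
  qed
  have eq: "(sphere_xy a - sphere_xy b * z) * f = sphere_xy g"
    unfolding ab g_def sphere_xy_hom power2_eq_square z2[symmetric] by (simp add: algebra_simps)
  then have "sphere_xy g \<in> I" using mult[OF f(1)] by metis
  moreover have "g \<noteq> 0"
  proof
    assume "g = 0"
    then have "sphere_xy g = 0" by (simp add: sphere_xy_def sphere_of_hom)
    then show False using eq c f(2) by simp
  qed
  ultimately show ?thesis using xy_poly_imp_1[of 0 g] by simp
qed

end

section \<open>Charts\<close>

text \<open>The quotient rule, for whichever representation is chosen;
  \<open>fract_deriv_Fract\<close> shows that all of them give the same value.\<close>

definition fract_deriv :: "('r::idom \<Rightarrow> 'r) \<Rightarrow> 'r fract \<Rightarrow> 'r fract" where
  "fract_deriv D q =
    (SOME r. \<exists>a b. b \<noteq> 0 \<and> q = Fract a b \<and> r = Fract (D a * b - a * D b) (b * b))"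

lemma fract_deriv_Fract:
  assumes D: "leibniz D" and b: "b \<noteq> 0"
  shows "fract_deriv D (Fract a b) = Fract (D a * b - a * D b) (b * b)"
proof -
  have "r = Fract (D a * b - a * D b) (b * b)"
    if "b' \<noteq> 0" "Fract a b = Fract a' b'" "r = Fract (D a' * b' - a' * D b') (b' * b')" for r a' b'
  proof -
    have e: "a * b' = a' * b" using that b by (simp add: eq_fract)
    then have "D a * b' + a * D b' = D a' * b + a' * D b"
      using leibniz_mult[OF D, of a b'] leibniz_mult[OF D, of a' b] by simp
    then have d: "D a' * b = D a * b' + a * D b' - a' * D b" by simp
    have "(D a' * b' - a' * D b') * (b * b) = b * b' * (D a' * b) - b * D b' * (a' * b)"
      by (simp add: algebra_simps)
    also have "\<dots> = b * b' * b' * D a - (a' * b) * b' * D b"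
      unfolding d e[symmetric] using e by (simp add: algebra_simps)
    also have "\<dots> = (D a * b - a * D b) * (b' * b')"
      unfolding e[symmetric] by (simp add: algebra_simps)
    finally have "(D a' * b' - a' * D b') * (b * b) = (D a * b - a * D b) * (b' * b')" .
    then show ?thesis using that b by (simp add: eq_fract)
  qed
  then show ?thesis
    unfolding fract_deriv_def using b by (intro some_equality) blast+
qed

lemma leibniz_fract_deriv:
  assumes D: "leibniz (D :: 'a::idom \<Rightarrow> 'a)"
  shows "leibniz (fract_deriv D)"
  unfolding leibniz_def
proof (intro conjI allI)
  fix p q :: "'a fract"
  obtain a b where p: "p = Fract a b" "b \<noteq> 0" by (cases p)
  obtain c d where q: "q = Fract c d" "d \<noteq> 0" by (cases q)
  note simps = p q fract_deriv_Fract[OF D] leibniz_add[OF D] leibniz_mult[OF D]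
  show "fract_deriv D (p + q) = fract_deriv D p + fract_deriv D q"
    by (simp add: simps) (simp add: eq_fract p q algebra_simps)
  show "fract_deriv D (p * q) = fract_deriv D p * q + p * fract_deriv D q"
    by (simp add: simps) (simp add: eq_fract p q algebra_simps)
qed

lemma fract_deriv_to_fract: "leibniz D \<Longrightarrow> fract_deriv D (to_fract a) = to_fract (D a)"
  by (simp add: to_fract_def fract_deriv_Fract)

text \<open>The chart derivation on the whole field of fractions, explicit and total.
  \<open>chart_deriv\<close> is described only as the unique derivation of the localization with
  given values on the parameters; \<open>chart_deriv_eq\<close> identifies the two there.\<close>

definition pderiv_chart ::
  "coord \<Rightarrow> nat \<Rightarrow> 'k::field_char_0 sphere fract \<Rightarrow> 'k sphere fract" where
  "pderiv_chart h i q =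
    fract_deriv (rot (chart_coord h i) h) q / to_fract (sphere_coord h)"

lemma leibniz_pderiv_chart: "leibniz (pderiv_chart h i)"
  by (simp add: leibniz_def pderiv_chart_def leibniz_add[OF leibniz_fract_deriv[OF leibniz_rot]]
      leibniz_mult[OF leibniz_fract_deriv[OF leibniz_rot]] add_divide_distrib)

lemmas pderiv_chart_add = leibniz_add[OF leibniz_pderiv_chart]
  and pderiv_chart_mult = leibniz_mult[OF leibniz_pderiv_chart]
  and pderiv_chart_diff = leibniz_diff[OF leibniz_pderiv_chart]
  and pderiv_chart_0 [simp] = leibniz_0[OF leibniz_pderiv_chart]
  and pderiv_chart_1 [simp] = leibniz_1[OF leibniz_pderiv_chart]

lemma pderiv_chart_to_fract:
  "pderiv_chart h i (to_fract a) =
    to_fract (rot (chart_coord h i) h a) / to_fract (sphere_coord h)"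
  by (simp add: pderiv_chart_def fract_deriv_to_fract[OF leibniz_rot])

lemma pderiv_chart_const [simp]: "pderiv_chart h i (frac_const c) = 0"
  by (simp add: pderiv_chart_to_fract frac_const_def)

lemma less_2_nat: "i < 2 \<longleftrightarrow> i = 0 \<or> i = (1::nat)" by auto

lemma sum_lessThan_2: "(\<Sum>i<2. g i) = g 0 + g (1::nat)"
  by (simp add: numeral_2_eq_2)

lemma chart_coord_neq [simp]: "i < 2 \<Longrightarrow> chart_coord h i \<noteq> h" "i < 2 \<Longrightarrow> h \<noteq> chart_coord h i"
  by (cases h; auto simp: less_2_nat)+

lemma chart_coord_inj: "i < 2 \<Longrightarrow> j < 2 \<Longrightarrow> chart_coord h i = chart_coord h j \<longleftrightarrow> i = j"
  by (cases h; auto simp: less_2_nat)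

lemma coord_chart_cases: "c = h \<or> c = chart_coord h 0 \<or> c = chart_coord h 1"
  by (cases h; cases c) auto

lemma rot_chart_param:
  "i < 2 \<Longrightarrow> j < 2 \<Longrightarrow>
    rot (chart_coord h i) h (chart_param h j) = (if i = j then sphere_coord h else 0)"
  by (auto simp: rot_coord chart_coord_inj)

lemma pderiv_chart_param:
  "i < 2 \<Longrightarrow> j < 2 \<Longrightarrow>
    pderiv_chart h i (to_fract (chart_param h j)) = (if i = j then 1 else 0)"
  by (simp add: pderiv_chart_to_fract rot_chart_param)

lemma sphere_relation_chart:
  "chart_param h 0 ^ 2 + chart_param h 1 ^ 2 + sphere_coord h ^ 2 = 1"
  using sphere_relation by (cases h) (simp_all add: add.commute add.left_commute)

text \<open>Derivations that agree on constants and coordinates agree on A. On h itself this comes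
  from differentiating the sphere relation and dividing by 2 h. Values in the field of fractions
  admit both vector fields and the restriction to A of a derivation of a localization.\<close>

lemma deriv_chart_expand:
  fixes \<delta> :: "'k::field_char_0 sphere \<Rightarrow> 'k sphere fract"
  assumes add: "\<And>a b. \<delta> (a + b) = \<delta> a + \<delta> b"
    and mult: "\<And>a b. \<delta> (a * b) = \<delta> a * to_fract b + to_fract a * \<delta> b"
    and const: "\<And>c. \<delta> (sphere_const c) = 0"
  shows "\<delta> a = (\<Sum>i<2. \<delta> (chart_param h i) * pderiv_chart h i (to_fract a))"
proof -
  have h0: "to_fract (sphere_coord h) \<noteq> (0 :: 'k sphere fract)" by simp
  have rel: "2 * (to_fract (chart_param h 0) * \<delta> (chart_param h 0)
     + to_fract (chart_param h 1) * \<delta> (chart_param h 1) + to_fract (sphere_coord h) * \<delta> (sphere_coord h)) = 0"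
  proof -
    have "\<delta> (chart_param h 0 ^ 2 + chart_param h 1 ^ 2 + sphere_coord h ^ 2) = 0"
      using const[of 1] by (simp only: sphere_relation_chart sphere_const_hom)
    then show ?thesis by (simp add: add mult power2_eq_square algebra_simps)
  qed
  have two: "(2 :: 'k sphere fract) \<noteq> 0"
  proof -
    have "to_fract (sphere_const 2 :: 'k sphere) \<noteq> 0"
      using sphere_const_inj[of 2 0] by simp
    moreover have "(2 :: 'k) = 1 + 1" by simp
    ultimately show ?thesis by (simp only: sphere_const_hom to_fract_add to_fract_1) simp
  qed
  show ?thesis
  proof (induction a rule: sphere_induct)
    case (const c)
    then show ?case using \<open>\<And>c. \<delta> (sphere_const c) = 0\<close>
      by (simp add: frac_const_def[symmetric])
  next
    case (coord c)
    consider "c = h" | i where "i < 2" "c = chart_coord h i" using coord_chart_cases[of c h] by (metis less_2_nat)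
    then show ?case
    proof cases
      case 1
      have "to_fract (sphere_coord h) * \<delta> (sphere_coord h) =
          - (to_fract (chart_param h 0) * \<delta> (chart_param h 0) + to_fract (chart_param h 1) * \<delta> (chart_param h 1))"
        using rel two by (metis add.commute eq_neg_iff_add_eq_0 mult_eq_0_iff)
      then have "\<delta> (sphere_coord h) =
          - (to_fract (chart_param h 0) * \<delta> (chart_param h 0) + to_fract (chart_param h 1) * \<delta> (chart_param h 1))
            / to_fract (sphere_coord h)"
        using h0 by (simp add: eq_divide_eq mult.commute)
      also have "\<dots> = (\<Sum>i<2. \<delta> (chart_param h i) * pderiv_chart h i (to_fract (sphere_coord c)))"
        unfolding sum_lessThan_2 pderiv_chart_to_fract 1 rot_coord
        by (simp add: diff_divide_distrib mult.commute)
      finally show ?thesis by (simp add: 1)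
    next
      case 2
      then show ?thesis
        unfolding sum_lessThan_2 by (auto simp add: pderiv_chart_param less_2_nat)
    qed
  next
    case (add a b)
    then show ?case using \<open>\<And>a b. \<delta> (a + b) = \<delta> a + \<delta> b\<close>
      by (simp add: pderiv_chart_add sum.distrib distrib_left)
  next
    case (mult a b)
    show ?case
      by (subst \<open>\<And>a b. \<delta> (a * b) = \<delta> a * to_fract b + to_fract a * \<delta> b\<close>, subst mult(1), subst mult(2))
        (simp add: pderiv_chart_mult sum_lessThan_2 algebra_simps)
  qed
qed

lemma vector_field_chart:
  assumes \<eta>: "\<eta> \<in> vector_fields"
  shows "to_fract (\<eta> a) = (\<Sum>i<2. to_fract (\<eta> (chart_param h i)) * pderiv_chart h i (to_fract a))"
  by (rule deriv_chart_expand)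
    (simp_all add: leibniz_add[OF vector_fieldsD(1)[OF \<eta>]] leibniz_mult[OF vector_fieldsD(1)[OF \<eta>]]
      vector_fieldsD(2)[OF \<eta>])

lemma localization_to_fract: "to_fract a \<in> localization h"
  unfolding localization_def by (rule CollectI, rule exI[of _ a], rule exI[of _ 0]) simp

lemma localization_0 [simp]: "0 \<in> localization h"
  using localization_to_fract[of 0] by simp

lemma localization_frac_const: "frac_const c \<in> localization h"
  by (simp add: frac_const_def localization_to_fract)

lemma localization_add:
  assumes "p \<in> localization h" "q \<in> localization h"
  shows "p + q \<in> localization h"
proof -
  obtain a n b m where "p = to_fract a / to_fract (sphere_coord h) ^ n"
    "q = to_fract b / to_fract (sphere_coord h) ^ m" 
    using assms unfolding localization_def by blast
  moreover have pow: "to_fract (sphere_coord h) ^ k = to_fract (sphere_coord h ^ k)" for k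
    by (induction k) simp_all
  ultimately have "p + q = to_fract (a * sphere_coord h ^ m + b * sphere_coord h ^ n) /
      to_fract (sphere_coord h) ^ (n + m)"
    by (simp add: pow[symmetric] add_divide_distrib power_add)
  then show ?thesis unfolding localization_def by blast
qed

lemma localization_mult:
  assumes "p \<in> localization h" "q \<in> localization h"
  shows "p * q \<in> localization h"
proof -
  obtain a n b m where "p = to_fract a / to_fract (sphere_coord h) ^ n"
    "q = to_fract b / to_fract (sphere_coord h) ^ m" 
    using assms unfolding localization_def by blast
  then have "p * q = to_fract (a * b) / to_fract (sphere_coord h) ^ (n + m)"
    by (simp add: power_add)
  then show ?thesis unfolding localization_def by blast
qed

lemma localization_inverse_coord: "to_fract a / to_fract (sphere_coord h) \<in> localization h"
  unfolding localization_def by (rule CollectI, rule exI[of _ a], rule exI[of _ 1]) simp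

text \<open>The Leibniz rule is assumed on S only, as this is all that a derivation of a
  localization provides.\<close>

lemma leibniz_div_power:
  assumes L: "\<And>f g. f \<in> S \<Longrightarrow> g \<in> S \<Longrightarrow> D (f * g) = D f * g + f * (D g :: 'f::Fields.field)"
    and c: "c \<noteq> 0" and S: "c \<in> S" "\<And>n. a / c ^ n \<in> S"
  shows "D (a / c ^ n) = (D a - of_nat n * (a / c) * D c) / c ^ n"
proof (induction n)
  case (Suc n)
  have "D (a / c ^ n) = D (a / c ^ Suc n * c)" using c by simp
  also have "\<dots> = D (a / c ^ Suc n) * c + a / c ^ Suc n * D c" by (rule L[OF S(2) S(1)])
  finally have "D (a / c ^ Suc n) * c = (D a - of_nat n * (a / c) * D c) / c ^ n - a / c ^ Suc n * D c"
    using Suc by simp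
  also have "\<dots> = (D a - of_nat (Suc n) * (a / c) * D c) / c ^ Suc n * c"
    using c by (simp add: field_simps)
  finally show ?case by (rule mult_right_cancel[OF c, THEN iffD1])
qed simp

lemma to_fract_of_nat: "to_fract (of_nat n) = of_nat n"
  by (induction n) simp_all

lemma pderiv_chart_localization:
  assumes "q \<in> localization h"
  shows "pderiv_chart h i q \<in> localization h"
proof -
  obtain a n where q: "q = to_fract a / to_fract (sphere_coord h) ^ n"
    using assms unfolding localization_def by blast
  have "pderiv_chart h i q = (pderiv_chart h i (to_fract a) -
      of_nat n * (to_fract a / to_fract (sphere_coord h)) * pderiv_chart h i (to_fract (sphere_coord h)))
      / to_fract (sphere_coord h) ^ n"
    unfolding q by (rule leibniz_div_power[where S = UNIV]) (simp_all add: pderiv_chart_mult)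
  also have "\<dots> = (pderiv_chart h i (to_fract a) + to_fract (- of_nat n) *
       ((to_fract a / to_fract (sphere_coord h)) * pderiv_chart h i (to_fract (sphere_coord h))))
      * (to_fract 1 / to_fract (sphere_coord h) ^ n)"
    by (simp add: to_fract_of_nat)
  also have "\<dots> \<in> localization h"
    unfolding pderiv_chart_to_fract
    by (intro localization_mult localization_add localization_to_fract localization_inverse_coord)
      (unfold localization_def, blast)
  finally show ?thesis .
qed

text \<open>Uniqueness: \<open>deriv_chart_expand\<close> fixes a derivation on A by its values on
  the parameters, and \<open>leibniz_div_power\<close> then fixes it on fractions with denominator
  h^n.\<close>

lemma chart_deriv_eq:
  assumes i: "i < 2" and q: "q \<in> localization h"
  shows "chart_deriv h i q = pderiv_chart h i (q :: 'k::field_char_0 sphere fract)"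
proof -
  let ?L = "localization h :: 'k sphere fract set"
  let ?P = "\<lambda>D. D \<in> derivations frac_const ?L \<and>
     (\<forall>j<2. D (to_fract (chart_param h j)) = (if j = i then 1 else 0))"
  let ?D = "restrict (pderiv_chart h i) ?L"
  have "?P ?D"
    using i by (auto simp: derivations_def localization_add localization_mult localization_to_fract
        localization_frac_const pderiv_chart_localization pderiv_chart_add pderiv_chart_mult
        pderiv_chart_param)
  moreover have "D = ?D" if D: "?P D" for D
  proof
    fix q
    have ext: "D \<in> ?L \<rightarrow>\<^sub>E ?L" using D by (simp add: derivations_def)
    have add: "D (f + g) = D f + D g" and mult: "D (f * g) = D f * g + f * D g"
      if "f \<in> ?L" "g \<in> ?L" for f g
      using D that by (auto simp: derivations_def)
    have const: "D (frac_const c * f) = frac_const c * D f" if "f \<in> ?L" for f c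
      using D that by (auto simp: derivations_def)
    have D1: "D 1 = 0" using mult[of 1 1] localization_to_fract[of 1 h]
      by (metis add_cancel_right_right mult_1_left mult_1_right to_fract_1)
    have c0: "D (to_fract (sphere_const c)) = 0" for c
      using const[of 1 c] D1 localization_to_fract[of 1 h] by (simp add: frac_const_def)
    have to: "D (to_fract a) = pderiv_chart h i (to_fract a)" for a
    proof -
      have "D (to_fract a) = (\<Sum>j<2. D (to_fract (chart_param h j)) * pderiv_chart h j (to_fract a))"
        by (rule deriv_chart_expand) (simp_all add: add mult c0 localization_to_fract)
      also have "\<dots> = (\<Sum>j<2. (if j = i then 1 else 0) * pderiv_chart h j (to_fract a))"
        using D by (intro sum.cong) auto
      also have "\<dots> = pderiv_chart h i (to_fract a)"
        using i by (auto simp: sum_lessThan_2 less_2_nat)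
      finally show ?thesis .
    qed
    show "D q = ?D q"
    proof (cases "q \<in> ?L")
      case True
      then obtain a n where q: "q = to_fract a / to_fract (sphere_coord h) ^ n"
        unfolding localization_def by blast
      have "D q = (D (to_fract a) - of_nat n * (to_fract a / to_fract (sphere_coord h)) *
          D (to_fract (sphere_coord h))) / to_fract (sphere_coord h) ^ n"
        unfolding q by (rule leibniz_div_power[where S = ?L])
          (auto simp add: mult localization_to_fract, auto simp: localization_def)
      also have "\<dots> = pderiv_chart h i q"
        unfolding q to
        by (rule leibniz_div_power[where S = UNIV, symmetric]) (simp_all add: pderiv_chart_mult)
      finally show ?thesis using True by simp
    next
      case False
      then show ?thesis using ext by auto
    qed
  qed
  ultimately have "chart_deriv h i = ?D"
    unfolding chart_deriv_def by (intro the_equality) blast+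
  then show ?thesis using q by simp
qed

section \<open>Modules embedded in a chart\<close>

definition smul :: "'f::times \<Rightarrow> ('i \<Rightarrow> 'f) \<Rightarrow> 'i \<Rightarrow> 'f" where
  "smul c v = (\<lambda>i. c * v i)"

lemma smul_apply [simp]: "smul c v i = c * v i"
  by (simp add: smul_def)

lemma smul_simps:
  fixes c d :: "'f::comm_ring_1"
  shows "smul c (v + w) = smul c v + smul c w" "smul (c + d) v = smul c v + smul d v"
    "smul c (v - w) = smul c v - smul c w" "smul (c - d) v = smul c v - smul d v"
    "smul c (smul d v) = smul (c * d) v" "smul 1 v = v" "smul 0 v = 0" "smul c 0 = 0"
    "smul (- c) v = - smul c v"
  by (rule ext; simp add: algebra_simps)+

lemma smul_eq_0_iff: "smul (c::'f::idom) v = 0 \<longleftrightarrow> c = 0 \<or> v = 0"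
  by (auto simp: fun_eq_iff)

lemma smul_cancel: "c \<noteq> 0 \<Longrightarrow> smul (c::'f::idom) v = smul c w \<longleftrightarrow> v = w"
  by (auto simp: fun_eq_iff)

lemma smul_sum: "smul (c::'f::comm_ring_1) (sum g I) = (\<Sum>i\<in>I. smul c (g i))"
  by (induction I rule: infinite_finite_induct)
    (simp_all only: sum.infinite sum.empty sum.insert smul_simps simp_thms)

definition pd :: "coord \<Rightarrow> nat \<Rightarrow> ('i \<Rightarrow> 'k::field_char_0 sphere fract) \<Rightarrow> 'i \<Rightarrow> 'k sphere fract" where
  "pd h j v = (\<lambda>i. pderiv_chart h j (v i))"

lemma pd_apply [simp]: "pd h j v i = pderiv_chart h j (v i)"
  by (simp add: pd_def)

lemma pd_add: "pd h j (v + w) = pd h j v + pd h j w"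
  by (rule ext) (simp add: pderiv_chart_add)

lemma pd_smul: "pd h j (smul c v) = smul (pderiv_chart h j c) v + smul c (pd h j v)"
  by (rule ext) (simp add: pderiv_chart_mult)

lemma pd_0 [simp]: "pd h j 0 = 0"
  by (rule ext) simp

text \<open>What is kept of the gl_2-action after extension of scalars to K: linearity, and constant
  entries, expressed by commutation with the chart derivations. The index type is left open because
  the tensor product is indexed by pairs.\<close>

locale matrix_units =
  fixes e :: "nat \<Rightarrow> nat \<Rightarrow> ('i \<Rightarrow> 'k::field_char_0 sphere fract) \<Rightarrow> 'i \<Rightarrow> 'k sphere fract"
  assumes e_add: "e p i (v + w) = e p i v + e p i w"
    and e_smul: "e p i (smul c v) = smul c (e p i v)"
    and e_pd: "pd h j (e p i v) = e p i (pd h j v)"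
begin

lemma e_0 [simp]: "e p i 0 = 0"
  using e_smul[of p i 0 0] by (simp add: smul_simps)

lemma e_minus: "e p i (- v) = - e p i v"
  using e_smul[of p i "-1" v] by (simp only: smul_simps)

lemma e_diff: "e p i (v - w) = e p i v - e p i w"
  using e_add[of p i v "- w"] by (simp only: e_minus diff_conv_add_uminus)

lemma e_sum: "e p i (sum g I) = (\<Sum>j\<in>I. e p i (g j))"
  by (induction I rule: infinite_finite_induct)
    (simp_all only: sum.infinite sum.empty sum.insert e_add e_0 simp_thms)

definition chart_lie ::
  "coord \<Rightarrow> ('k sphere \<Rightarrow> 'k sphere) \<Rightarrow> ('i \<Rightarrow> 'k sphere fract) \<Rightarrow> 'i \<Rightarrow> 'k sphere fract" where
  "chart_lie h \<eta> v = (\<Sum>i<2. smul (field_coeff h \<eta> i) (pd h i v)) +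
    (\<Sum>p<2. \<Sum>i<2. smul (pderiv_chart h p (field_coeff h \<eta> i)) (e p i v))"

text \<open>The operator (f \<eta>) - f \<eta>, by \<open>chart_lie_mult_field\<close>. Its
  first-order part cancels, so it is K-linear in v.\<close>

definition symbol ::
  "coord \<Rightarrow> 'k sphere \<Rightarrow> ('k sphere \<Rightarrow> 'k sphere) \<Rightarrow> ('i \<Rightarrow> 'k sphere fract) \<Rightarrow> 'i \<Rightarrow> 'k sphere fract" where
  "symbol h f \<eta> v =
    (\<Sum>p<2. \<Sum>i<2. smul (pderiv_chart h p (to_fract f) * field_coeff h \<eta> i) (e p i v))"

lemma chart_lie_add: "chart_lie h \<eta> (v + w) = chart_lie h \<eta> v + chart_lie h \<eta> w"
  by (rule ext) (simp add: chart_lie_def sum_lessThan_2 pd_add e_add algebra_simps pderiv_chart_add)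

lemma chart_lie_smul:
  assumes \<eta>: "\<eta> \<in> vector_fields"
  shows "chart_lie h \<eta> (smul (to_fract f) v) = smul (to_fract (\<eta> f)) v + smul (to_fract f) (chart_lie h \<eta> v)"
  unfolding vector_field_chart[OF \<eta>, of f h]
  by (rule ext) (simp add: chart_lie_def sum_lessThan_2 pd_smul e_smul algebra_simps field_coeff_def
      pderiv_chart_mult)

lemma chart_lie_diff: "chart_lie h \<eta> (v - w) = chart_lie h \<eta> v - chart_lie h \<eta> w"
  by (rule ext) (simp add: chart_lie_def sum_lessThan_2 e_diff algebra_simps pderiv_chart_diff)

lemma chart_lie_mult_field:
  "chart_lie h (\<lambda>a. f * \<eta> a) v = smul (to_fract f) (chart_lie h \<eta> v) + symbol h f \<eta> v"
  by (rule ext) (simp add: chart_lie_def symbol_def field_coeff_def sum_lessThan_2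
      algebra_simps pderiv_chart_mult)

lemma chart_lie_diff_field:
  "chart_lie h (\<lambda>a. \<eta> a - \<mu> a) v = chart_lie h \<eta> v - chart_lie h \<mu> v"
  by (rule ext) (simp add: chart_lie_def field_coeff_def sum_lessThan_2
      algebra_simps pderiv_chart_diff)

lemma symbol_mult_field: "symbol h f (\<lambda>a. g * \<mu> a) v = smul (to_fract g) (symbol h f \<mu> v)"
  by (rule ext) (simp add: symbol_def field_coeff_def sum_lessThan_2 algebra_simps)

lemma symbol_add_field:
  "symbol h f (\<lambda>a. \<eta> a + \<mu> a) v = symbol h f \<eta> v + symbol h f \<mu> v"
  by (rule ext) (simp add: symbol_def field_coeff_def sum_lessThan_2 algebra_simps)

lemma symbol_mult:
  "symbol h (f * g) \<eta> v = smul (to_fract f) (symbol h g \<eta> v) + smul (to_fract g) (symbol h f \<eta> v)"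
  by (rule ext) (simp add: symbol_def field_coeff_def sum_lessThan_2 algebra_simps pderiv_chart_mult)

lemma diff_telescope: "a + b - (c + d) - (b - c) = a - (d :: 'a::ab_group_add)"
  by simp

text \<open>With f = t_p and \<eta> = h d/dt_i a single coefficient survives, so each matrix unit is
  obtained from the module action up to the factor h.\<close>

lemma symbol_param:
  assumes "p < 2" "i < 2"
  shows "symbol h (chart_param h p) (rot (chart_coord h i) h) v = smul (to_fract (sphere_coord h)) (e p i v)"
  using assms unfolding symbol_def field_coeff_def sum_lessThan_2
  by (auto simp: less_2_nat pderiv_chart_param rot_chart_param smul_simps fun_eq_iff)

text \<open>The bracket relations of the matrix units come from the Lie bracket of the module, so that
  the multiplicativity of the rational representation need not be differentiated.\<close>

lemma symbol_bracket:
  assumes \<eta>: "\<eta> \<in> vector_fields" and \<mu>: "\<mu> \<in> vector_fields"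
    and W: "\<And>\<eta> v. \<eta> \<in> vector_fields \<Longrightarrow> v \<in> W \<Longrightarrow> chart_lie h \<eta> v \<in> W"
    and bracket: "\<And>\<eta> \<mu> v. \<eta> \<in> vector_fields \<Longrightarrow> \<mu> \<in> vector_fields \<Longrightarrow> v \<in> W \<Longrightarrow>
      chart_lie h (\<lambda>a. \<eta> (\<mu> a) - \<mu> (\<eta> a)) v = chart_lie h \<eta> (chart_lie h \<mu> v) - chart_lie h \<mu> (chart_lie h \<eta> v)"
    and v: "v \<in> W"
  shows "symbol h f \<eta> (symbol h g \<mu> v) - symbol h g \<mu> (symbol h f \<eta> v) =
    smul (to_fract (\<eta> g)) (symbol h f \<mu> v) - smul (to_fract (\<mu> f)) (symbol h g \<eta> v)"
proof -
  have T: "symbol h f \<eta> v = chart_lie h (\<lambda>a. f * \<eta> a) v - smul (to_fract f) (chart_lie h \<eta> v)" for f \<eta> v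
    by (simp add: chart_lie_mult_field)
  \<comment> \<open>By [f \<eta>, \<nu>] = f [\<eta>, \<nu>] - \<nu>(f) \<eta>, the commutator of a
    symbol with a Lie operator is again a combination of symbols. It is used for \<nu> = g \<mu> and
    \<nu> = \<mu>, from which the second symbol is built.\<close>
  have comm: "symbol h f \<eta> (chart_lie h \<nu> v) - chart_lie h \<nu> (symbol h f \<eta> v) =
      symbol h f (\<lambda>a. \<eta> (\<nu> a) - \<nu> (\<eta> a)) v - symbol h (\<nu> f) \<eta> v"
    if \<nu>: "\<nu> \<in> vector_fields" for \<nu>
  proof -
    note f\<eta> = vector_fields_mult[OF \<eta>, of f]
    have "symbol h f \<eta> (chart_lie h \<nu> v) - chart_lie h \<nu> (symbol h f \<eta> v) =
       (chart_lie h (\<lambda>a. f * \<eta> a) (chart_lie h \<nu> v) - chart_lie h \<nu> (chart_lie h (\<lambda>a. f * \<eta> a) v))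
        - smul (to_fract f) (chart_lie h \<eta> (chart_lie h \<nu> v) - chart_lie h \<nu> (chart_lie h \<eta> v))
        + smul (to_fract (\<nu> f)) (chart_lie h \<eta> v)"
      unfolding T chart_lie_diff chart_lie_smul[OF \<nu>] smul_simps by (simp only: algebra_simps)
    also have "\<dots> = chart_lie h (\<lambda>a. f * \<eta> (\<nu> a) - \<nu> (f * \<eta> a)) v
        - smul (to_fract f) (chart_lie h (\<lambda>a. \<eta> (\<nu> a) - \<nu> (\<eta> a)) v)
        + smul (to_fract (\<nu> f)) (chart_lie h \<eta> v)"
      unfolding bracket[OF \<eta> \<nu> v] bracket[OF f\<eta> \<nu> v] ..
    also have "(\<lambda>a. f * \<eta> (\<nu> a) - \<nu> (f * \<eta> a)) = (\<lambda>a. f * (\<eta> (\<nu> a) - \<nu> (\<eta> a)) - \<nu> f * \<eta> a)"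
      by (rule ext) (simp add: leibniz_mult[OF vector_fieldsD(1)[OF \<nu>]] algebra_simps)
    finally show ?thesis
      unfolding chart_lie_diff_field T by (simp only: algebra_simps)
  qed
  note g\<mu> = vector_fields_mult[OF \<mu>, of g]
  have smT: "symbol h f \<eta> (smul c w) = smul c (symbol h f \<eta> w)" for c w
    by (rule ext) (simp add: symbol_def sum_lessThan_2 e_smul algebra_simps)
  have diffT: "symbol h f \<eta> (u - w) = symbol h f \<eta> u - symbol h f \<eta> w" for u w
    by (rule ext) (simp add: symbol_def sum_lessThan_2 e_diff algebra_simps)
  have "symbol h f \<eta> (symbol h g \<mu> v) - symbol h g \<mu> (symbol h f \<eta> v) =
     (symbol h f \<eta> (chart_lie h (\<lambda>a. g * \<mu> a) v) - chart_lie h (\<lambda>a. g * \<mu> a) (symbol h f \<eta> v))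
      - smul (to_fract g) (symbol h f \<eta> (chart_lie h \<mu> v) - chart_lie h \<mu> (symbol h f \<eta> v))"
    unfolding T[of g] diffT smT smul_simps by (simp only: algebra_simps)
  also have "\<dots> = symbol h f (\<lambda>a. \<eta> (g * \<mu> a) - g * \<mu> (\<eta> a)) v - symbol h (g * \<mu> f) \<eta> v
      - smul (to_fract g) (symbol h f (\<lambda>a. \<eta> (\<mu> a) - \<mu> (\<eta> a)) v - symbol h (\<mu> f) \<eta> v)"
    unfolding comm[OF g\<mu>] comm[OF \<mu>] ..
  also have "(\<lambda>a. \<eta> (g * \<mu> a) - g * \<mu> (\<eta> a)) = (\<lambda>a. \<eta> g * \<mu> a + g * (\<eta> (\<mu> a) - \<mu> (\<eta> a)))"
    by (rule ext) (simp add: leibniz_mult[OF vector_fieldsD(1)[OF \<eta>]] algebra_simps)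
  also have "symbol h f (\<lambda>a. \<eta> g * \<mu> a + g * (\<eta> (\<mu> a) - \<mu> (\<eta> a))) v =
      smul (to_fract (\<eta> g)) (symbol h f \<mu> v) + smul (to_fract g) (symbol h f (\<lambda>a. \<eta> (\<mu> a) - \<mu> (\<eta> a)) v)"
    by (simp add: symbol_add_field symbol_mult_field)
  also have "symbol h (g * \<mu> f) \<eta> v =
      smul (to_fract g) (symbol h (\<mu> f) \<eta> v) + smul (to_fract (\<mu> f)) (symbol h g \<eta> v)"
    by (rule symbol_mult)
  finally show ?thesis unfolding smul_simps(3) diff_telescope .
qed

text \<open>This is \<open>symbol_bracket\<close> for chart parameters and rotations, divided by
  h^2.\<close>

lemma matrix_unit_bracket:
  assumes W: "\<And>\<eta> v. \<eta> \<in> vector_fields \<Longrightarrow> v \<in> W \<Longrightarrow> chart_lie h \<eta> v \<in> W"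
    and bracket: "\<And>\<eta> \<mu> v. \<eta> \<in> vector_fields \<Longrightarrow> \<mu> \<in> vector_fields \<Longrightarrow> v \<in> W \<Longrightarrow>
      chart_lie h (\<lambda>a. \<eta> (\<mu> a) - \<mu> (\<eta> a)) v = chart_lie h \<eta> (chart_lie h \<mu> v) - chart_lie h \<mu> (chart_lie h \<eta> v)"
    and v: "v \<in> W" and i: "p < 2" "i < 2" "q < 2" "j < 2"
  shows "e p i (e q j v) - e q j (e p i v) =
    (if i = q then e p j v else 0) - (if j = p then e q i v else 0)"
proof -
  let ?h = "to_fract (sphere_coord h) :: 'k sphere fract"
  have "symbol h (chart_param h p) (rot (chart_coord h i) h) (symbol h (chart_param h q) (rot (chart_coord h j) h) v) -
      symbol h (chart_param h q) (rot (chart_coord h j) h) (symbol h (chart_param h p) (rot (chart_coord h i) h) v) =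
      smul (to_fract (rot (chart_coord h i) h (chart_param h q))) (symbol h (chart_param h p) (rot (chart_coord h j) h) v) -
      smul (to_fract (rot (chart_coord h j) h (chart_param h p))) (symbol h (chart_param h q) (rot (chart_coord h i) h) v)"
    by (rule symbol_bracket[OF rot_vector_field rot_vector_field W bracket v])
  then have "smul ?h (smul ?h (e p i (e q j v) - e q j (e p i v))) = smul ?h (smul ?h
    ((if i = q then e p j v else 0) - (if j = p then e q i v else 0)))"
    unfolding symbol_param[OF i(1,2)] symbol_param[OF i(3,4)] symbol_param[OF i(1,4)]
      symbol_param[OF i(3,2)] rot_chart_param[OF i(2,3)] rot_chart_param[OF i(4,1)] e_smul
    by (cases "i = q"; cases "j = p") (simp_all add: smul_simps, simp add: smul_def fun_eq_iff)
  then show ?thesis by (simp only: smul_cancel to_fract_eq_0_iff sphere_coord_nonzero simp_thms)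
qed

end

section \<open>Submodules and finite generation\<close>

lemma sphere_ring_simps [simp]:
  "carrier (sphere_ring :: 'k::field_char_0 sphere ring) = UNIV"
  "a \<otimes>\<^bsub>sphere_ring\<^esub> b = a * (b :: 'k sphere)"
  "\<one>\<^bsub>sphere_ring\<^esub> = (1 :: 'k sphere)"
  "\<zero>\<^bsub>sphere_ring\<^esub> = (0 :: 'k sphere)"
  "a \<oplus>\<^bsub>sphere_ring\<^esub> b = a + (b :: 'k sphere)"
  by (simp_all add: ring_of_type_algebra_def)

definition a_submodule :: "'m set \<Rightarrow> ('k::field_char_0 sphere, 'm) av_structure \<Rightarrow> bool" where
  "a_submodule S M \<longleftrightarrow> S \<subseteq> carrier M \<and> \<zero>\<^bsub>M\<^esub> \<in> S \<and> (\<forall>x\<in>S. \<forall>y\<in>S. x \<oplus>\<^bsub>M\<^esub> y \<in> S) \<and>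
    (\<forall>a. \<forall>x\<in>S. a \<odot>\<^bsub>M\<^esub> x \<in> S)"

lemma a_submoduleD:
  assumes "a_submodule S M"
  shows "x \<in> S \<Longrightarrow> x \<in> carrier M" "\<zero>\<^bsub>M\<^esub> \<in> S" "x \<in> S \<Longrightarrow> y \<in> S \<Longrightarrow> x \<oplus>\<^bsub>M\<^esub> y \<in> S"
    "x \<in> S \<Longrightarrow> a \<odot>\<^bsub>M\<^esub> x \<in> S"
  using assms by (auto simp: a_submodule_def)

locale sphere_module = module sphere_ring M
  for M :: "('k::field_char_0 sphere, 'm) av_structure" (structure)
begin

lemma smult_add: "x \<in> carrier M \<Longrightarrow> (a + b) \<odot>\<^bsub>M\<^esub> x = a \<odot>\<^bsub>M\<^esub> x \<oplus>\<^bsub>M\<^esub> b \<odot>\<^bsub>M\<^esub> x"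
  using smult_l_distr[of a b x] by simp

lemma smult_mult: "x \<in> carrier M \<Longrightarrow> (a * b) \<odot>\<^bsub>M\<^esub> x = a \<odot>\<^bsub>M\<^esub> (b \<odot>\<^bsub>M\<^esub> x)"
  using smult_assoc1[of a b x] by simp

lemma smult_1 [simp]: "x \<in> carrier M \<Longrightarrow> 1 \<odot>\<^bsub>M\<^esub> x = x"
  using smult_one[of x] by simp

lemma smult_0 [simp]: "x \<in> carrier M \<Longrightarrow> 0 \<odot>\<^bsub>M\<^esub> x = \<zero>\<^bsub>M\<^esub>"
  using smult_l_null[of x] by simp

lemma smult_zero [simp]: "a \<odot>\<^bsub>M\<^esub> \<zero>\<^bsub>M\<^esub> = \<zero>\<^bsub>M\<^esub>"
  using smult_r_null[of a] by simp

lemma smult_in [simp, intro]: "x \<in> carrier M \<Longrightarrow> a \<odot>\<^bsub>M\<^esub> x \<in> carrier M"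
  using smult_closed[of a x] by simp

lemma smult_distrib:
  "x \<in> carrier M \<Longrightarrow> y \<in> carrier M \<Longrightarrow> a \<odot>\<^bsub>M\<^esub> (x \<oplus>\<^bsub>M\<^esub> y) = a \<odot>\<^bsub>M\<^esub> x \<oplus>\<^bsub>M\<^esub> a \<odot>\<^bsub>M\<^esub> y"
  using smult_r_distr[of a x y] by simp

lemma inv_eq_smult: "x \<in> carrier M \<Longrightarrow> \<ominus>\<^bsub>M\<^esub> x = (-1) \<odot>\<^bsub>M\<^esub> x"
  using smult_add[of x "-1" 1] by (intro M.minus_equality) simp_all

lemma minus_eq_smult: "y \<in> carrier M \<Longrightarrow> x \<ominus>\<^bsub>M\<^esub> y = x \<oplus>\<^bsub>M\<^esub> (-1) \<odot>\<^bsub>M\<^esub> y"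
  by (simp add: a_minus_def inv_eq_smult)

lemma submodule_iff: "submodule S sphere_ring M \<longleftrightarrow> a_submodule S M"
proof
  assume S: "submodule S sphere_ring M"
  show "a_submodule S M"
    using submoduleE[OF S] submoduleE(4)[OF S, of 0]
    unfolding a_submodule_def by (auto simp: subset_iff)
next
  assume S: "a_submodule S M"
  show "submodule S sphere_ring M"
    using S by (intro submoduleI) (auto simp: a_submodule_def subset_iff inv_eq_smult)
qed

lemma finsum_in_submodule:
  assumes S: "a_submodule S M" and f: "\<And>i. i \<in> I \<Longrightarrow> f i \<in> S"
  shows "(\<Oplus>\<^bsub>M\<^esub>i\<in>I. f i) \<in> S"
  using f
proof (induction I rule: infinite_finite_induct)
  case (insert i I)
  then have "f \<in> I \<rightarrow> carrier M" "f i \<in> carrier M" using a_submoduleD(1)[OF S] by auto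
  then show ?case using insert a_submoduleD[OF S] by (simp add: insert.hyps)
qed (use a_submoduleD[OF S] in auto)

text \<open>Finite generation without finite sums: a property that defines a submodule has to be
  checked on generators only. \<open>finitely_generatedI\<close> is the converse.\<close>

lemma finitely_generatedD:
  assumes "finitely_generated_over_A M"
  obtains G where "G \<subseteq> carrier M" "finite G" "\<And>T. a_submodule T M \<Longrightarrow> G \<subseteq> T \<Longrightarrow> T = carrier M"
proof -
  obtain G where G: "G \<subseteq> carrier M" "finite G"
    "\<And>m. m \<in> carrier M \<Longrightarrow> \<exists>c. m = (\<Oplus>\<^bsub>M\<^esub>g\<in>G. c g \<odot>\<^bsub>M\<^esub> g)"
    using assms unfolding finitely_generated_over_A_def by blast
  have "T = carrier M" if T: "a_submodule T M" "G \<subseteq> T" for T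
  proof
    show "T \<subseteq> carrier M" using T by (simp add: a_submodule_def)
    show "carrier M \<subseteq> T"
    proof
      fix m assume "m \<in> carrier M"
      then obtain c where m: "m = (\<Oplus>\<^bsub>M\<^esub>g\<in>G. c g \<odot>\<^bsub>M\<^esub> g)" using G(3) by blast
      show "m \<in> T" unfolding m by (rule finsum_in_submodule[OF T(1)]) (use T a_submoduleD[OF T(1)] in blast)
    qed
  qed
  then show ?thesis using that G by blast
qed

lemma finitely_generatedI:
  assumes G: "G \<subseteq> carrier M" "finite G" and T: "\<And>T. a_submodule T M \<Longrightarrow> G \<subseteq> T \<Longrightarrow> T = carrier M"
  shows "finitely_generated_over_A M"
proof -
  let ?T = "{\<Oplus>\<^bsub>M\<^esub>g\<in>G. c g \<odot>\<^bsub>M\<^esub> g | c. True}"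
  have cl: "(\<lambda>g. c g \<odot>\<^bsub>M\<^esub> g) \<in> G \<rightarrow> carrier M" for c
    using G by auto
  have "a_submodule ?T M"
    unfolding a_submodule_def
  proof (intro conjI ballI allI)
    show "?T \<subseteq> carrier M" using finsum_closed[OF cl] by auto
    have "(\<Oplus>\<^bsub>M\<^esub>g\<in>G. 0 \<odot>\<^bsub>M\<^esub> g) = (\<Oplus>\<^bsub>M\<^esub>g\<in>G. \<zero>\<^bsub>M\<^esub>)"
      using G by (intro finsum_cong') auto
    then show "\<zero>\<^bsub>M\<^esub> \<in> ?T" by (auto intro!: exI[of _ "\<lambda>_. 0"])
    fix x assume "x \<in> ?T"
    then obtain c where x: "x = (\<Oplus>\<^bsub>M\<^esub>g\<in>G. c g \<odot>\<^bsub>M\<^esub> g)" by blast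
    { fix y assume "y \<in> ?T"
      then obtain d where y: "y = (\<Oplus>\<^bsub>M\<^esub>g\<in>G. d g \<odot>\<^bsub>M\<^esub> g)" by blast
      have "x \<oplus>\<^bsub>M\<^esub> y = (\<Oplus>\<^bsub>M\<^esub>g\<in>G. c g \<odot>\<^bsub>M\<^esub> g \<oplus>\<^bsub>M\<^esub> d g \<odot>\<^bsub>M\<^esub> g)"
        unfolding x y by (rule finsum_addf[OF cl cl, symmetric])
      also have "\<dots> = (\<Oplus>\<^bsub>M\<^esub>g\<in>G. (c g + d g) \<odot>\<^bsub>M\<^esub> g)"
        using G by (intro finsum_cong') (auto simp: smult_add subset_iff)
      finally show "x \<oplus>\<^bsub>M\<^esub> y \<in> ?T" by (auto intro!: exI[of _ "\<lambda>g. c g + d g"]) }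
    fix a
    have "a \<odot>\<^bsub>M\<^esub> x = (\<Oplus>\<^bsub>M\<^esub>g\<in>G. a \<odot>\<^bsub>M\<^esub> (c g \<odot>\<^bsub>M\<^esub> g))"
      unfolding x using finsum_smult_ldistr[OF G(2) _ cl, of a] by simp
    also have "\<dots> = (\<Oplus>\<^bsub>M\<^esub>g\<in>G. (a * c g) \<odot>\<^bsub>M\<^esub> g)"
      using G by (intro finsum_cong') (auto simp: smult_mult subset_iff)
    finally show "a \<odot>\<^bsub>M\<^esub> x \<in> ?T" by (auto intro!: exI[of _ "\<lambda>g. a * c g"])
  qed
  moreover have "G \<subseteq> ?T"
  proof
    fix g assume g: "g \<in> G"
    have "(\<lambda>j. j) \<in> G \<rightarrow> carrier M" using G by auto
    then have "g = (\<Oplus>\<^bsub>M\<^esub>j\<in>G. if g = j then j else \<zero>\<^bsub>M\<^esub>)"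
      by (rule finsum_singleton[OF g G(2), symmetric])
    also have "\<dots> = (\<Oplus>\<^bsub>M\<^esub>j\<in>G. (if g = j then 1 else 0) \<odot>\<^bsub>M\<^esub> j)"
      using G by (intro finsum_cong') (auto simp: subset_iff)
    finally show "g \<in> ?T" by (auto intro!: exI[of _ "\<lambda>j. if g = j then 1 else 0"])
  qed
  ultimately have "?T = carrier M" by (rule T)
  then show ?thesis
    unfolding finitely_generated_over_A_def using G by (intro exI[of _ G]) auto
qed

text \<open>Each generator has a multiplier of its own; the product of these works for every
  generator, hence for the whole module. It is nonzero because A is a domain.\<close>

lemma common_multiplier:
  assumes fg: "finitely_generated_over_A M" and S: "a_submodule S M"
    and mult: "\<And>x. x \<in> carrier M \<Longrightarrow> \<exists>a. a \<noteq> 0 \<and> a \<odot>\<^bsub>M\<^esub> x \<in> S"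
  shows "\<exists>a. a \<noteq> 0 \<and> (\<forall>x\<in>carrier M. a \<odot>\<^bsub>M\<^esub> x \<in> S)"
proof -
  obtain G where G: "G \<subseteq> carrier M" "finite G" "\<And>T. a_submodule T M \<Longrightarrow> G \<subseteq> T \<Longrightarrow> T = carrier M"
    using finitely_generatedD[OF fg] by metis
  obtain d where d: "\<And>x. x \<in> carrier M \<Longrightarrow> d x \<noteq> 0 \<and> d x \<odot>\<^bsub>M\<^esub> x \<in> S"
    using mult by metis
  let ?a = "\<Prod>g\<in>G. d g"
  let ?T = "{x \<in> carrier M. ?a \<odot>\<^bsub>M\<^esub> x \<in> S}"
  have "a_submodule ?T M"
    unfolding a_submodule_def
    by (auto simp: a_submoduleD[OF S] smult_distrib smult_mult[symmetric] mult.commute[of ?a])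
      (simp add: smult_mult a_submoduleD[OF S])
  moreover have "G \<subseteq> ?T"
  proof
    fix g assume g: "g \<in> G"
    then have "?a = (\<Prod>g\<in>G - {g}. d g) * d g" using G(2) by (simp add: prod.remove mult.commute)
    then have "?a \<odot>\<^bsub>M\<^esub> g = (\<Prod>g\<in>G - {g}. d g) \<odot>\<^bsub>M\<^esub> (d g \<odot>\<^bsub>M\<^esub> g)"
      using g G(1) smult_mult by auto
    then show "g \<in> ?T" using d g G(1) a_submoduleD(4)[OF S] by auto
  qed
  ultimately have "?T = carrier M" by (rule G(3))
  moreover have "?a \<noteq> 0" using d G by auto
  ultimately show ?thesis by blast
qed

end

lemma (in sphere_module) restrict_sphere_module:
  assumes "a_submodule S M"
  shows "sphere_module (M\<lparr>carrier := S\<rparr>)"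
  using assms submodule.submodule_is_module[of S sphere_ring M] module_axioms
  by (simp add: sphere_module_def submodule_iff)

sublocale av_module \<subseteq> sphere_module M ..

context av_module
begin

lemma av_submodule_iff:
  "av_submodule S M \<longleftrightarrow> a_submodule S M \<and> (\<forall>\<eta>\<in>vector_fields. \<forall>m\<in>S. lie_act M \<eta> m \<in> S)"
  by (simp add: av_submodule_def submodule_iff)

lemma av_submodule_carrier: "av_submodule (carrier M) M"
  by (auto simp: av_submodule_iff a_submodule_def lie_closed)

lemma lie_zero: "\<eta> \<in> vector_fields \<Longrightarrow> lie_act M \<eta> \<zero>\<^bsub>M\<^esub> = \<zero>\<^bsub>M\<^esub>"
  using lie_scale_right[of \<eta> "\<zero>\<^bsub>M\<^esub>" 0] lie_closed by simp

lemma lie_bracket':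
  "\<lbrakk>\<eta> \<in> vector_fields; \<mu> \<in> vector_fields; m \<in> carrier M\<rbrakk> \<Longrightarrow>
    lie_act M (\<lambda>a. \<eta> (\<mu> a) - \<mu> (\<eta> a)) m =
      lie_act M \<eta> (lie_act M \<mu> m) \<oplus>\<^bsub>M\<^esub> (-1) \<odot>\<^bsub>M\<^esub> lie_act M \<mu> (lie_act M \<eta> m)"
  using lie_bracket by (simp add: minus_eq_smult lie_closed)

lemma av_submoduleD:
  assumes "av_submodule S M"
  shows "a_submodule S M" "\<And>\<eta> x. \<eta> \<in> vector_fields \<Longrightarrow> x \<in> S \<Longrightarrow> lie_act M \<eta> x \<in> S"
  using assms by (auto simp: av_submodule_iff)

text \<open>The conductor of \<open>S'\<close> into \<open>S\<close> is an ideal stable under all vector fields.\<close>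

lemma conductor_trick:
  assumes S: "av_submodule S M" and S': "av_submodule S' M" and sub: "S \<subseteq> S'"
    and a: "a \<noteq> 0" "\<And>x. x \<in> S' \<Longrightarrow> a \<odot>\<^bsub>M\<^esub> x \<in> S"
  shows "S = S'"
proof -
  note S1 = a_submoduleD[OF av_submoduleD(1)[OF S]] and S2 = a_submoduleD[OF av_submoduleD(1)[OF S']]
  interpret I: stable_ideal "{a. \<forall>x\<in>S'. a \<odot>\<^bsub>M\<^esub> x \<in> S}"
  proof (unfold_locales; safe?)
    fix \<eta> :: "'k sphere \<Rightarrow> 'k sphere" and a x
    assume \<eta>: "\<eta> \<in> vector_fields" and a: "\<forall>x\<in>S'. a \<odot>\<^bsub>M\<^esub> x \<in> S" and x: "x \<in> S'"
    have x': "x \<in> carrier M" "\<eta> a \<odot>\<^bsub>M\<^esub> x \<in> carrier M" "a \<odot>\<^bsub>M\<^esub> lie_act M \<eta> x \<in> carrier M"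
      using S2(1)[OF x] \<eta> by (auto simp: lie_closed)
    \<comment> \<open>Leibniz rule: \<eta>(a) x is the difference of \<eta>(a x) and a \<eta>(x),
      and both lie in S.\<close>
    have "lie_act M \<eta> (a \<odot>\<^bsub>M\<^esub> x) \<oplus>\<^bsub>M\<^esub> (-1) \<odot>\<^bsub>M\<^esub> (a \<odot>\<^bsub>M\<^esub> lie_act M \<eta> x) \<in> S"
      by (rule S1(3)[OF av_submoduleD(2)[OF S \<eta>] S1(4)]) (use a x av_submoduleD(2)[OF S' \<eta>] in auto)
    also have "lie_act M \<eta> (a \<odot>\<^bsub>M\<^esub> x) \<oplus>\<^bsub>M\<^esub> (-1) \<odot>\<^bsub>M\<^esub> (a \<odot>\<^bsub>M\<^esub> lie_act M \<eta> x) = \<eta> a \<odot>\<^bsub>M\<^esub> x"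
      unfolding lie_leibniz[OF \<eta> x'(1)] inv_eq_smult[OF x'(3), symmetric]
      using x' by (simp add: M.a_assoc M.r_neg)
    finally show "\<eta> a \<odot>\<^bsub>M\<^esub> x \<in> S" .
  qed (auto simp: smult_add smult_mult S1 S2)
  have "1 \<in> {a. \<forall>x\<in>S'. a \<odot>\<^bsub>M\<^esub> x \<in> S}"
    using a by (intro I.nonzero_imp_1[of a]) auto
  then show ?thesis using sub S2(1) by auto
qed

lemma restrict_av_module:
  assumes "av_submodule S M"
  shows "av_module (M\<lparr>carrier := S\<rparr>)"
proof -
  note S = av_submoduleD[OF assms] and a = a_submoduleD[OF av_submoduleD(1)[OF assms]]
  interpret S: sphere_module "M\<lparr>carrier := S\<rparr>" by (rule restrict_sphere_module[OF S(1)])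
  have c: "carrier (M\<lparr>carrier := S\<rparr>) = S" "lie_act (M\<lparr>carrier := S\<rparr>) = lie_act M"
    "add (M\<lparr>carrier := S\<rparr>) = add M" "module.smult (M\<lparr>carrier := S\<rparr>) = module.smult M"
    by simp_all
  show ?thesis
  proof (unfold_locales, unfold c)
    fix \<eta> \<mu> :: "'k sphere \<Rightarrow> 'k sphere" and m n c b
    assume \<eta>: "\<eta> \<in> vector_fields" and m: "m \<in> S"
    note m' = a(1)[OF m]
    show "lie_act M \<eta> m \<in> S" by (rule S(2)[OF \<eta> m])
    show "lie_act M \<eta> (sphere_const c \<odot>\<^bsub>M\<^esub> m) = sphere_const c \<odot>\<^bsub>M\<^esub> lie_act M \<eta> m"
      by (rule lie_scale_right[OF \<eta> m'])
    show "lie_act M (\<lambda>a. sphere_const c * \<eta> a) m = sphere_const c \<odot>\<^bsub>M\<^esub> lie_act M \<eta> m"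
      by (rule lie_scale_left[OF \<eta> m'])
    show "lie_act M \<eta> (b \<odot>\<^bsub>M\<^esub> m) = \<eta> b \<odot>\<^bsub>M\<^esub> m \<oplus>\<^bsub>M\<^esub> b \<odot>\<^bsub>M\<^esub> lie_act M \<eta> m"
      by (rule lie_leibniz[OF \<eta> m'])
    { assume n: "n \<in> S"
      show "lie_act M \<eta> (m \<oplus>\<^bsub>M\<^esub> n) = lie_act M \<eta> m \<oplus>\<^bsub>M\<^esub> lie_act M \<eta> n"
        by (rule lie_add_right[OF \<eta> m' a(1)[OF n]]) }
    { assume \<mu>: "\<mu> \<in> vector_fields"
      show "lie_act M (\<lambda>a. \<eta> a + \<mu> a) m = lie_act M \<eta> m \<oplus>\<^bsub>M\<^esub> lie_act M \<mu> m"
        by (rule lie_add_left[OF \<eta> \<mu> m'])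
      have "lie_act M \<mu> (lie_act M \<eta> m) \<in> carrier (M\<lparr>carrier := S\<rparr>)"
        using S(2)[OF \<mu> S(2)[OF \<eta> m]] by simp
      from S.minus_eq_smult[OF this, of "lie_act M \<eta> (lie_act M \<mu> m)"]
      show "lie_act M (\<lambda>a. \<eta> (\<mu> a) - \<mu> (\<eta> a)) m =
        lie_act M \<eta> (lie_act M \<mu> m) \<ominus>\<^bsub>M\<lparr>carrier := S\<rparr>\<^esub> lie_act M \<mu> (lie_act M \<eta> m)"
        unfolding lie_bracket'[OF \<eta> \<mu> m'] by simp }
  qed
qed

lemma restrict_av_submodule:
  assumes S: "av_submodule S M"
  shows "av_submodule T (M\<lparr>carrier := S\<rparr>) \<longleftrightarrow> av_submodule T M \<and> T \<subseteq> S"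
proof -
  interpret S: av_module "M\<lparr>carrier := S\<rparr>" by (rule restrict_av_module[OF S])
  show ?thesis
    using a_submoduleD[OF av_submoduleD(1)[OF S]]
    by (auto simp: S.av_submodule_iff av_submodule_iff a_submodule_def subset_iff)
qed

end

section \<open>The span over the field of fractions\<close>

text \<open>Despite the name, \<phi> is not assumed injective here: the tensor product is shown to
  satisfy these conditions first, and the proof that its map is injective works inside this
  locale.\<close>

locale chart_embedding = av_module P + matrix_units e
  for P :: "('k::field_char_0 sphere, 'p) av_structure"
    and e :: "nat \<Rightarrow> nat \<Rightarrow> ('i \<Rightarrow> 'k sphere fract) \<Rightarrow> 'i \<Rightarrow> 'k sphere fract" +
  fixes h :: coord and \<phi> :: "'p \<Rightarrow> 'i \<Rightarrow> 'k sphere fract"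
  assumes phi_add: "x \<in> carrier P \<Longrightarrow> y \<in> carrier P \<Longrightarrow> \<phi> (x \<oplus>\<^bsub>P\<^esub> y) = \<phi> x + \<phi> y"
    and phi_smult: "x \<in> carrier P \<Longrightarrow> \<phi> (a \<odot>\<^bsub>P\<^esub> x) = smul (to_fract a) (\<phi> x)"
    and phi_lie: "\<eta> \<in> vector_fields \<Longrightarrow> x \<in> carrier P \<Longrightarrow> \<phi> (lie_act P \<eta> x) = chart_lie h \<eta> (\<phi> x)"
begin

text \<open>For an A-submodule S this is the K-span of its image, because finitely many fractions
  have a common denominator.\<close>

definition kspan :: "'p set \<Rightarrow> ('i \<Rightarrow> 'k sphere fract) set" where
  "kspan S = {v. \<exists>a s. a \<noteq> 0 \<and> s \<in> S \<and> smul (to_fract a) v = \<phi> s}"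

lemma phi_zero [simp]: "\<phi> \<zero>\<^bsub>P\<^esub> = 0"
  using phi_smult[of "\<zero>\<^bsub>P\<^esub>" 0] by (simp add: smul_simps)

lemma kspan_phi: "s \<in> S \<Longrightarrow> \<phi> s \<in> kspan S"
  unfolding kspan_def by (rule CollectI, rule exI[of _ 1], rule exI[of _ s]) (simp add: smul_simps)

lemma kspan_mono: "S \<subseteq> T \<Longrightarrow> kspan S \<subseteq> kspan T"
  unfolding kspan_def by blast

lemma kspan_smul:
  assumes S: "a_submodule S P" and v: "v \<in> kspan S"
  shows "smul q v \<in> kspan S"
proof -
  obtain a s where as: "a \<noteq> 0" "s \<in> S" "smul (to_fract a) v = \<phi> s" using v unfolding kspan_def by blast
  obtain c d where q: "q = Fract c d" "d \<noteq> 0" by (cases q)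
  have "smul (to_fract (d * a)) (smul q v) = smul (to_fract c) (smul (to_fract a) v)"
    by (simp add: smul_simps q Fract_conv_to_fract mult.commute)
  also have "\<dots> = \<phi> (c \<odot>\<^bsub>P\<^esub> s)"
    using as a_submoduleD[OF S] by (simp add: phi_smult)
  finally have "smul (to_fract (d * a)) (smul q v) = \<phi> (c \<odot>\<^bsub>P\<^esub> s)" .
  moreover have "d * a \<noteq> 0" "c \<odot>\<^bsub>P\<^esub> s \<in> S" using as q a_submoduleD[OF S] by auto
  ultimately show ?thesis unfolding kspan_def by blast
qed

lemma kspan_smul_cancel:
  "a_submodule S P \<Longrightarrow> q \<noteq> 0 \<Longrightarrow> smul q v \<in> kspan S \<Longrightarrow> v \<in> kspan S"
  using kspan_smul[of S "smul q v" "inverse q"] by (simp add: smul_simps)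

lemma kspan_add:
  assumes S: "a_submodule S P" and v: "v \<in> kspan S" and w: "w \<in> kspan S"
  shows "v + w \<in> kspan S"
proof -
  obtain a s where as: "a \<noteq> 0" "s \<in> S" "smul (to_fract a) v = \<phi> s" using v unfolding kspan_def by blast
  obtain b t where bt: "b \<noteq> 0" "t \<in> S" "smul (to_fract b) w = \<phi> t" using w unfolding kspan_def by blast
  have "smul (to_fract (a * b)) (v + w) =
      smul (to_fract b) (smul (to_fract a) v) + smul (to_fract a) (smul (to_fract b) w)"
    by (simp add: smul_simps mult.commute)
  also have "\<dots> = \<phi> (b \<odot>\<^bsub>P\<^esub> s \<oplus>\<^bsub>P\<^esub> a \<odot>\<^bsub>P\<^esub> t)"
    using as bt a_submoduleD[OF S] by (simp add: phi_smult phi_add)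
  finally have "smul (to_fract (a * b)) (v + w) = \<phi> (b \<odot>\<^bsub>P\<^esub> s \<oplus>\<^bsub>P\<^esub> a \<odot>\<^bsub>P\<^esub> t)" .
  moreover have "a * b \<noteq> 0" "b \<odot>\<^bsub>P\<^esub> s \<oplus>\<^bsub>P\<^esub> a \<odot>\<^bsub>P\<^esub> t \<in> S" using as bt a_submoduleD[OF S] by auto
  ultimately show ?thesis unfolding kspan_def by blast
qed

lemma kspan_0: "a_submodule S P \<Longrightarrow> 0 \<in> kspan S"
  using kspan_phi[of "\<zero>\<^bsub>P\<^esub>" S] a_submoduleD(2) by auto

lemma kspan_diff: "a_submodule S P \<Longrightarrow> v \<in> kspan S \<Longrightarrow> w \<in> kspan S \<Longrightarrow> v - w \<in> kspan S"
  using kspan_add[of S v "smul (-1) w"] kspan_smul[of S w "-1"] by (simp add: smul_simps)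

lemma kspan_sum: "a_submodule S P \<Longrightarrow> (\<And>j. j \<in> J \<Longrightarrow> g j \<in> kspan S) \<Longrightarrow> sum g J \<in> kspan S"
  by (induction J rule: infinite_finite_induct) (simp_all only: sum.infinite sum.empty sum.insert kspan_0
      kspan_add insert_iff simp_thms)

text \<open>The vector field t_p h d/dt_i applied to s, minus t_p times the result of h d/dt_i, is h
  times \<open>e p i\<close>; and h is invertible in K.\<close>

lemma kspan_e:
  assumes S: "av_submodule S P" and v: "v \<in> kspan S" and p: "p < 2" "i < 2"
  shows "e p i v \<in> kspan S"
proof -
  note A = av_submoduleD(1)[OF S]
  let ?R = "rot (chart_coord h i) h" and ?f = "chart_param h p"
  obtain a s where as: "a \<noteq> 0" "s \<in> S" "smul (to_fract a) v = \<phi> s" using v unfolding kspan_def by blast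
  have s: "s \<in> carrier P" using as a_submoduleD[OF A] by blast
  have "\<phi> (lie_act P (\<lambda>a. ?f * ?R a) s) - smul (to_fract ?f) (\<phi> (lie_act P ?R s)) =
      symbol h ?f ?R (\<phi> s)"
    using s by (simp add: phi_lie rot_vector_field vector_fields_mult chart_lie_mult_field)
  also have "\<dots> = smul (to_fract (sphere_coord h * a)) (e p i v)"
    by (simp add: symbol_param p as(3)[symmetric] e_smul smul_simps)
  finally have eq: "\<phi> (lie_act P (\<lambda>a. ?f * ?R a) s) - smul (to_fract ?f) (\<phi> (lie_act P ?R s)) = \<dots>" .
  have "\<phi> (lie_act P (\<lambda>a. ?f * ?R a) s) - smul (to_fract ?f) (\<phi> (lie_act P ?R s)) \<in> kspan S"
    by (intro kspan_diff kspan_smul kspan_phi A av_submoduleD(2)[OF S] rot_vector_field vector_fields_mult as(2))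
  then show ?thesis
    unfolding eq by (rule kspan_smul_cancel[OF A, rotated]) (simp add: as)
qed

text \<open>The rotation acts as h d/dt_i plus a combination of matrix units; the latter preserve
  the span by \<open>kspan_e\<close> and can be subtracted.\<close>

lemma kspan_pd:
  assumes S: "av_submodule S P" and v: "v \<in> kspan S" and i: "i < 2"
  shows "pd h i v \<in> kspan S"
proof -
  note A = av_submoduleD(1)[OF S]
  let ?R = "rot (chart_coord h i) h" and ?h = "to_fract (sphere_coord h) :: 'k sphere fract"
  obtain a s where as: "a \<noteq> 0" "s \<in> S" "smul (to_fract a) v = \<phi> s" using v unfolding kspan_def by blast
  have s: "s \<in> carrier P" using as a_submoduleD[OF A] by blast
  have "\<phi> (lie_act P ?R s) = smul ?h (pd h i (\<phi> s)) + (\<Sum>p<2. smul (pderiv_chart h p ?h) (e p i (\<phi> s)))"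
    unfolding phi_lie[OF rot_vector_field s] chart_lie_def field_coeff_def
    using i unfolding sum_lessThan_2 less_2_nat
    by (elim disjE) (simp_all add: rot_chart_param smul_simps)
  also have "pd h i (\<phi> s) = smul (pderiv_chart h i (to_fract a)) v + smul (to_fract a) (pd h i v)"
    by (simp add: as(3)[symmetric] pd_smul)
  finally have eq: "\<phi> (lie_act P ?R s) = smul ?h (smul (pderiv_chart h i (to_fract a)) v + smul (to_fract a) (pd h i v)) +
    (\<Sum>p<2. smul (pderiv_chart h p ?h) (e p i (\<phi> s)))" .
  have "smul (?h * to_fract a) (pd h i v) = \<phi> (lie_act P ?R s) -
      (\<Sum>p<2. smul (pderiv_chart h p ?h) (e p i (\<phi> s))) - smul (?h * pderiv_chart h i (to_fract a)) v"
    unfolding eq by (simp add: smul_simps)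
  also have "\<dots> \<in> kspan S"
    by (intro kspan_diff kspan_smul kspan_phi kspan_sum A v av_submoduleD(2)[OF S] rot_vector_field as(2) kspan_e[OF S])
      (simp_all add: i)
  finally show ?thesis
    by (rule kspan_smul_cancel[OF A, rotated]) (simp add: as)
qed

lemma kspan_bracket:
  assumes v: "v \<in> kspan (carrier P)" and i: "p < 2" "i < 2" "q < 2" "j < 2"
  shows "e p i (e q j v) - e q j (e p i v) =
    (if i = q then e p j v else 0) - (if j = p then e q i v else 0)"
proof -
  obtain a s where as: "a \<noteq> 0" "s \<in> carrier P" "smul (to_fract a) v = \<phi> s" using v unfolding kspan_def by blast
  let ?W = "\<phi> ` carrier P"
  have "e p i (e q j (\<phi> s)) - e q j (e p i (\<phi> s)) =
    (if i = q then e p j (\<phi> s) else 0) - (if j = p then e q i (\<phi> s) else 0)"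
  proof (rule matrix_unit_bracket[where W = ?W and h = h, OF _ _ _ i])
    show "\<phi> s \<in> ?W" using as by blast
    fix \<eta> :: "'k sphere \<Rightarrow> 'k sphere" and v assume \<eta>: "\<eta> \<in> vector_fields" and "v \<in> ?W"
    then obtain m where m: "m \<in> carrier P" "v = \<phi> m" by blast
    then show "chart_lie h \<eta> v \<in> ?W"
      using phi_lie[OF \<eta> m(1)] lie_closed[OF \<eta> m(1)] by (metis imageI)
    fix \<mu> :: "'k sphere \<Rightarrow> 'k sphere" assume \<mu>: "\<mu> \<in> vector_fields"
    note c = lie_closed[OF \<eta> m(1)] lie_closed[OF \<mu> m(1)]
    note c2 = lie_closed[OF \<mu> c(1)] lie_closed[OF \<eta> c(2)]
    have "chart_lie h (\<lambda>a. \<eta> (\<mu> a) - \<mu> (\<eta> a)) v = \<phi> (lie_act P (\<lambda>a. \<eta> (\<mu> a) - \<mu> (\<eta> a)) m)"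
      unfolding m(2) by (rule phi_lie[OF vector_fields_bracket[OF \<eta> \<mu>] m(1), symmetric])
    also have "\<dots> = \<phi> (lie_act P \<eta> (lie_act P \<mu> m)) + smul (-1) (\<phi> (lie_act P \<mu> (lie_act P \<eta> m)))"
      unfolding lie_bracket'[OF \<eta> \<mu> m(1)] phi_add[OF c2(2) smult_in[OF c2(1)]] phi_smult[OF c2(1)]
      by simp
    also have "\<dots> = chart_lie h \<eta> (chart_lie h \<mu> v) - chart_lie h \<mu> (chart_lie h \<eta> v)"
      unfolding phi_lie[OF \<eta> c(2)] phi_lie[OF \<mu> c(1)] phi_lie[OF \<eta> m(1)] phi_lie[OF \<mu> m(1)] m(2)
      by (simp add: smul_simps)
    finally show "chart_lie h (\<lambda>a. \<eta> (\<mu> a) - \<mu> (\<eta> a)) v =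
        chart_lie h \<eta> (chart_lie h \<mu> v) - chart_lie h \<mu> (chart_lie h \<eta> v)" .
  qed
  then have "smul (to_fract a) (e p i (e q j v) - e q j (e p i v)) =
    smul (to_fract a) ((if i = q then e p j v else 0) - (if j = p then e q i v else 0))"
    unfolding as(3)[symmetric] e_smul by (cases "i = q"; cases "j = p") (simp_all add: smul_simps,
      simp_all add: smul_def fun_eq_iff)
  then show ?thesis using as(1) by (simp only: smul_cancel to_fract_eq_0_iff simp_thms)
qed

definition stable_space :: "('i \<Rightarrow> 'k sphere fract) set \<Rightarrow> bool" where
  "stable_space Q \<longleftrightarrow> 0 \<in> Q \<and> (\<forall>v\<in>Q. \<forall>w\<in>Q. v + w \<in> Q) \<and> (\<forall>c. \<forall>v\<in>Q. smul c v \<in> Q) \<and>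
    (\<forall>i<2. \<forall>v\<in>Q. pd h i v \<in> Q) \<and> (\<forall>p<2. \<forall>i<2. \<forall>v\<in>Q. e p i v \<in> Q)"

definition preimage :: "('i \<Rightarrow> 'k sphere fract) set \<Rightarrow> 'p set" where
  "preimage Q = {x \<in> carrier P. \<phi> x \<in> Q}"

lemma stable_spaceD:
  assumes "stable_space Q"
  shows "0 \<in> Q" "v \<in> Q \<Longrightarrow> w \<in> Q \<Longrightarrow> v + w \<in> Q" "v \<in> Q \<Longrightarrow> smul c v \<in> Q"
    "v \<in> Q \<Longrightarrow> i < 2 \<Longrightarrow> pd h i v \<in> Q" "v \<in> Q \<Longrightarrow> p < 2 \<Longrightarrow> i < 2 \<Longrightarrow> e p i v \<in> Q"
  using assms by (auto simp: stable_space_def)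

lemma av_submodule_preimage:
  assumes Q: "stable_space Q"
  shows "av_submodule (preimage Q) P"
proof -
  have "chart_lie h \<eta> v \<in> Q" if "v \<in> Q" for \<eta> v
    unfolding chart_lie_def using that Q
    by (auto simp: stable_space_def sum_lessThan_2)
  then show ?thesis
    using Q unfolding av_submodule_iff a_submodule_def preimage_def
    by (auto simp: phi_add phi_smult phi_lie lie_closed stable_space_def)
qed

text \<open>Every stable subspace of the span is thus itself the span of a submodule, so submodules
  of P can be constructed by linear algebra over K.\<close>

lemma kspan_preimage:
  assumes Q: "stable_space Q" "Q \<subseteq> kspan (carrier P)"
  shows "kspan (preimage Q) = Q"
proof
  show "kspan (preimage Q) \<subseteq> Q"
  proof
    fix v assume "v \<in> kspan (preimage Q)"
    then obtain a s where "a \<noteq> 0" "\<phi> s \<in> Q" "smul (to_fract a) v = \<phi> s"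
      unfolding kspan_def preimage_def by blast
    then have "smul (inverse (to_fract a)) (smul (to_fract a) v) \<in> Q" "to_fract a \<noteq> 0"
      using Q(1) by (simp_all only: stable_space_def to_fract_eq_0_iff) simp
    then show "v \<in> Q" by (simp add: smul_simps)
  qed
  show "Q \<subseteq> kspan (preimage Q)"
  proof
    fix v assume v: "v \<in> Q"
    then obtain a s where as: "a \<noteq> 0" "s \<in> carrier P" "smul (to_fract a) v = \<phi> s"
      using Q(2) unfolding kspan_def by blast
    then have "s \<in> preimage Q" using v Q(1) unfolding preimage_def stable_space_def by (metis (mono_tags) mem_Collect_eq)
    then show "v \<in> kspan (preimage Q)" using as unfolding kspan_def by blast
  qed
qed

lemma stable_space_kspan: "av_submodule S P \<Longrightarrow> stable_space (kspan S)"
  unfolding stable_space_def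
  by (auto intro: kspan_0 kspan_add kspan_smul kspan_pd kspan_e simp: av_submoduleD(1))

end

locale chart_embedding_inj = chart_embedding +
  assumes phi_inj: "inj_on \<phi> (carrier P)"
begin

text \<open>The span condition gives every element of \<open>S'\<close> a nonzero multiple in
  \<open>S\<close>; finite generation makes the multiplier uniform, and
  \<open>conductor_trick\<close> makes it 1.\<close>

lemma submodule_eqI:
  assumes S: "av_submodule S P" and S': "av_submodule S' P" and sub: "S \<subseteq> S'"
    and fg: "finitely_generated_over_A (P\<lparr>carrier := S'\<rparr>)"
    and span: "\<phi> ` S' \<subseteq> kspan S"
  shows "S = S'"
proof -
  interpret S': av_module "P\<lparr>carrier := S'\<rparr>" by (rule restrict_av_module[OF S'])
  note A = a_submoduleD[OF av_submoduleD(1)[OF S]] and A' = a_submoduleD[OF av_submoduleD(1)[OF S']]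
  have "\<exists>a. a \<noteq> 0 \<and> (\<forall>x\<in>carrier (P\<lparr>carrier := S'\<rparr>). a \<odot>\<^bsub>P\<lparr>carrier := S'\<rparr>\<^esub> x \<in> S)"
  proof (rule S'.common_multiplier[OF fg])
    show "a_submodule S (P\<lparr>carrier := S'\<rparr>)"
      using av_submoduleD(1)[OF S] sub by (simp add: a_submodule_def)
    fix x assume "x \<in> carrier (P\<lparr>carrier := S'\<rparr>)"
    then have x: "x \<in> S'" by simp
    then obtain a s where "a \<noteq> 0" "s \<in> S" "smul (to_fract a) (\<phi> x) = \<phi> s"
      using span unfolding kspan_def by blast
    then have "\<phi> (a \<odot>\<^bsub>P\<^esub> x) = \<phi> s" using A'(1)[OF x] by (simp add: phi_smult)
    then have "a \<odot>\<^bsub>P\<^esub> x = s"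
      using phi_inj A'(1)[OF x] A(1)[OF \<open>s \<in> S\<close>] by (auto dest: inj_onD)
    then show "\<exists>a. a \<noteq> 0 \<and> a \<odot>\<^bsub>P\<lparr>carrier := S'\<rparr>\<^esub> x \<in> S" using \<open>a \<noteq> 0\<close> \<open>s \<in> S\<close> by auto
  qed
  then show ?thesis using conductor_trick[OF S S' sub] by auto
qed

lemma phi_eq_0: "x \<in> carrier P \<Longrightarrow> \<phi> x = 0 \<longleftrightarrow> x = \<zero>\<^bsub>P\<^esub>"
  using phi_inj phi_zero by (metis M.zero_closed inj_onD)

end

section \<open>Highest weight strings\<close>

declare One_nat_def [simp del]

lemmas pointwise = smul_apply pd_apply plus_fun_apply zero_fun_apply minus_apply uminus_apply

text \<open>As simplification rules, these would expand equations between functions.\<close>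

declare pointwise [simp del]

lemma smul_cong: "a = b \<Longrightarrow> smul a v = smul b v"
  by simp

lemma of_nat_sphere: "(of_nat n :: 'k::field_char_0 sphere) = sphere_const (of_nat n)"
  by (induction n) simp_all

instance sphere :: (field_char_0) ring_char_0
  by standard (auto simp: inj_on_def of_nat_sphere sphere_const_inj)

instance fract :: ("{idom, ring_char_0}") field_char_0
  by standard (auto simp: inj_on_def to_fract_of_nat[symmetric])

lemma pderiv_chart_of_nat [simp]: "pderiv_chart h i (of_nat n) = 0"
  by (simp add: to_fract_of_nat[symmetric] of_nat_sphere frac_const_def[symmetric])

definition lin_space :: "('i \<Rightarrow> 'f::comm_ring_1) set \<Rightarrow> bool" where
  "lin_space U \<longleftrightarrow> 0 \<in> U \<and> (\<forall>v\<in>U. \<forall>w\<in>U. v + w \<in> U) \<and> (\<forall>c. \<forall>v\<in>U. smul c v \<in> U)"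

lemma lin_spaceD:
  assumes "lin_space U"
  shows "0 \<in> U" "v \<in> U \<Longrightarrow> w \<in> U \<Longrightarrow> v + w \<in> U" "v \<in> U \<Longrightarrow> smul c v \<in> U"
    "v \<in> U \<Longrightarrow> w \<in> U \<Longrightarrow> v - w \<in> U"
proof -
  show "0 \<in> U" "v \<in> U \<Longrightarrow> w \<in> U \<Longrightarrow> v + w \<in> U" "v \<in> U \<Longrightarrow> smul c v \<in> U" for v w c
    using assms by (auto simp: lin_space_def)
  from this(2)[of v "smul (-1) w"] this(3)[of w "-1"]
  show "v \<in> U \<Longrightarrow> w \<in> U \<Longrightarrow> v - w \<in> U" by (simp add: smul_simps)
qed

lemma lin_space_sum: "lin_space U \<Longrightarrow> (\<And>j. j \<in> J \<Longrightarrow> g j \<in> U) \<Longrightarrow> sum g J \<in> U"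
  by (induction J rule: infinite_finite_induct)
    (simp_all only: lin_spaceD sum.infinite sum.empty sum.insert insert_iff simp_thms)

lemma pd_sum: "pd h i (sum g J) = (\<Sum>j\<in>J. pd h i (g j))"
  by (induction J rule: infinite_finite_induct)
    (simp_all only: pd_add pd_0 sum.infinite sum.empty sum.insert simp_thms)

text \<open>The factors T - c are applied to v one after another; the last vector before 0 is an
  eigenvector.\<close>

lemma exists_eigenvector:
  assumes U: "lin_space U" and T: "\<And>v. v \<in> U \<Longrightarrow> T v \<in> U"
    and v: "v \<in> U" "v \<noteq> 0" and cs: "foldr (\<lambda>c v. T v - smul c v) cs v = 0"
  shows "\<exists>c\<in>set cs. \<exists>u\<in>U. u \<noteq> 0 \<and> T u = smul c u"
  using cs
proof (induction cs)
  case Nil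
  then have "v = 0" by (simp only: foldr.simps id_apply)
  with v(2) show ?case by (rule notE)
next
  case (Cons c cs)
  let ?u = "foldr (\<lambda>c v. T v - smul c v) cs v"
  have "T v - smul c v \<in> U" if "v \<in> U" for v c
    by (intro lin_spaceD(3,4)[OF U] T that)
  then have "?u \<in> U"
    by (induction cs) (simp_all only: foldr.simps id_apply comp_apply v)
  moreover have "T ?u = smul c ?u" using Cons.prems by (simp only: foldr.simps comp_apply right_minus_eq)
  ultimately have "?u \<noteq> 0 \<Longrightarrow> ?case" by (metis list.set_intros(1))
  moreover have "?case" if "?u = 0"
    using Cons.IH[OF that] by (metis list.set_intros(2))
  ultimately show ?case by blast
qed

lemma foldr_eigenvector:
  assumes T0: "\<And>c v. T (smul c v) = smul c (T v)" and u: "T u = smul (c :: 'f::comm_ring_1) u"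
  shows "foldr (\<lambda>c v. T v - smul c v) cs u = smul (\<Prod>b\<leftarrow>cs. c - b) u"
proof (induction cs)
  case (Cons a cs)
  show ?case
    unfolding foldr.simps comp_apply Cons.IH T0 u smul_simps(5) smul_simps(4)[symmetric]
    by (rule smul_cong) (simp add: algebra_simps)
qed (simp add: smul_simps)

text \<open>An element of minimal support, normalized at one coordinate, is killed by all derivations.\<close>

lemma exists_flat:
  fixes U :: "('i \<Rightarrow> 'k::field_char_0 sphere fract) set"
  assumes U: "lin_space U" and pd: "\<And>i v. i < 2 \<Longrightarrow> v \<in> U \<Longrightarrow> pd h i v \<in> U"
    and I: "finite I" "\<And>v i. v \<in> U \<Longrightarrow> i \<notin> I \<Longrightarrow> v i = 0" and v: "v \<in> U" "v \<noteq> 0"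
  shows "\<exists>u\<in>U. u \<noteq> 0 \<and> (\<forall>i<2. pd h i u = 0)"
proof -
  define supp :: "('i \<Rightarrow> 'k sphere fract) \<Rightarrow> 'i set" where "supp v = {i. v i \<noteq> 0}" for v
  have fin: "finite (supp v)" if "v \<in> U" for v
    using I(2)[OF that] by (intro finite_subset[OF _ I(1)]) (auto simp: supp_def)
  obtain u where u: "u \<in> U" "u \<noteq> 0" and min: "\<And>v. v \<in> U \<Longrightarrow> v \<noteq> 0 \<Longrightarrow> card (supp u) \<le> card (supp v)"
    using ex_has_least_nat[of "\<lambda>v. v \<in> U \<and> v \<noteq> 0" v "\<lambda>v. card (supp v)"] v by blast
  obtain i0 where i0: "u i0 \<noteq> 0" using u(2) by (auto simp: fun_eq_iff pointwise)
  let ?u = "smul (inverse (u i0)) u"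
  have "pd h j ?u = 0" if "j < 2" for j
  proof (rule ccontr)
    assume n: "pd h j ?u \<noteq> 0"
    \<comment> \<open>Zero coordinates stay zero, and the coordinate \<open>i0\<close>, where
      \<open>?u\<close> is 1, is lost.\<close>
    have "supp (pd h j ?u) \<subseteq> supp u" by (auto simp: supp_def pointwise)
    moreover have "i0 \<in> supp u" "i0 \<notin> supp (pd h j ?u)" using i0 by (auto simp: supp_def pointwise)
    ultimately have "supp (pd h j ?u) \<subset> supp u" by blast
    then have "card (supp (pd h j ?u)) < card (supp u)" by (rule psubset_card_mono[OF fin[OF u(1)]])
    moreover have "pd h j ?u \<in> U" by (rule pd[OF that lin_spaceD(3)[OF U u(1)]])
    ultimately show False using min[OF _ n] by simp
  qed
  moreover have "?u \<in> U" "?u \<noteq> 0" using u i0 lin_spaceD(3)[OF U] by (auto simp: smul_eq_0_iff)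
  ultimately show ?thesis by blast
qed

lemma eigenvector_independent:
  assumes T: "\<And>v w. T (v + w) = T v + T w" "T 0 = 0" "\<And>a v. T (smul a v) = smul a (T v)"
    and R: "finite R" "inj_on \<kappa> R" and v: "\<And>r. r \<in> R \<Longrightarrow> T (v r) = smul (\<kappa> r :: 'f::idom) (v r)"
    and sum: "(\<Sum>r\<in>R. v r) = 0" and r: "r \<in> R"
  shows "v r = 0"
  using R v sum r
proof (induction R arbitrary: v r)
  case (insert q R)
  have Ts: "T (sum v F) = (\<Sum>r\<in>F. T (v r))" for F
    by (induction F rule: infinite_finite_induct)
      (simp_all only: T sum.infinite sum.empty sum.insert simp_thms)
  \<comment> \<open>Applying T - \<open>\<kappa> q\<close> to the relation removes the term of q and
    rescales the others by nonzero factors.\<close>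
  let ?v = "\<lambda>r. smul (\<kappa> r - \<kappa> q) (v r)"
  have vq: "v q = - sum v R"
    using insert.prems(3) unfolding sum.insert[OF insert.hyps] by (rule eq_neg_iff_add_eq_0[THEN iffD2])
  have "(\<Sum>r\<in>R. ?v r) = (\<Sum>r\<in>R. T (v r)) - (\<Sum>r\<in>R. smul (\<kappa> q) (v r))"
    unfolding sum_subtractf[symmetric] by (rule sum.cong) (simp_all only: insert.prems(2) insertI2 smul_simps)
  also have "\<dots> = T (sum v R) - smul (\<kappa> q) (sum v R)"
    by (simp only: Ts smul_sum)
  also have "\<dots> = (T (v q) + T (sum v R)) - smul (\<kappa> q) (v q + sum v R)"
    using insert.prems(2)[of q] by (simp add: smul_simps)
  also have "\<dots> = 0" unfolding T(1)[symmetric] vq by (simp add: T(2) smul_simps)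
  finally have s: "(\<Sum>r\<in>R. ?v r) = 0" .
  have z: "v r = 0" if "r \<in> R" for r
  proof -
    have "?v r = 0"
    proof (rule insert.IH[OF _ _ s that])
      show "inj_on \<kappa> R" using insert.prems(1) by simp
      fix s assume s: "s \<in> R"
      show "T (?v s) = smul (\<kappa> s) (?v s)"
        unfolding T(3) insert.prems(2)[OF insertI2[OF s]] smul_simps(5) by (simp add: mult.commute)
    qed
    moreover have "\<kappa> r \<noteq> \<kappa> q" using insert.prems(1) insert.hyps that by (auto simp: inj_on_def)
    ultimately show ?thesis by (simp add: smul_eq_0_iff)
  qed
  then have "v q = 0" using vq by simp
  then show ?case using z insert.prems(4) by auto
qed simp

section \<open>Weight vectors and strings in the span\<close>

context chart_embedding
begin

abbreviation "V \<equiv> kspan (carrier P)"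

abbreviation "raise \<equiv> e 0 1"
abbreviation "lower \<equiv> e 1 0"

lemma carrier_a_submodule: "a_submodule (carrier P) P"
  using av_submodule_carrier by (rule av_submoduleD(1))

lemma V_lin: "lin_space V"
  unfolding lin_space_def by (auto intro: kspan_0 kspan_add kspan_smul carrier_a_submodule)

lemma V_e: "v \<in> V \<Longrightarrow> p < 2 \<Longrightarrow> i < 2 \<Longrightarrow> e p i v \<in> V"
  by (rule kspan_e[OF av_submodule_carrier])

lemma V_pd: "v \<in> V \<Longrightarrow> i < 2 \<Longrightarrow> pd h i v \<in> V"
  by (rule kspan_pd[OF av_submodule_carrier])

lemma gl2_relations:
  assumes "v \<in> V"
  shows "raise (lower v) = lower (raise v) + (e 0 0 v - e 1 1 v)"
    "e 0 0 (raise v) = raise (e 0 0 v) + raise v" "e 1 1 (raise v) = raise (e 1 1 v) - raise v"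
    "e 0 0 (lower v) = lower (e 0 0 v) - lower v" "e 1 1 (lower v) = lower (e 1 1 v) + lower v"
    "e 0 0 (e 1 1 v) = e 1 1 (e 0 0 v)"
  using kspan_bracket[OF assms, of 0 1 1 0] kspan_bracket[OF assms, of 0 0 0 1]
    kspan_bracket[OF assms, of 1 1 0 1] kspan_bracket[OF assms, of 0 0 1 0]
    kspan_bracket[OF assms, of 1 1 1 0] kspan_bracket[OF assms, of 0 0 1 1]
  by (simp_all only: simp_thms if_True if_False one_less_numeral_iff zero_less_numeral semiring_norm
      zero_neq_one one_neq_zero diff_zero diff_0 diff_eq_eq diff_self add_0_left add_0_right
      add.commute uminus_add_conv_diff)

text \<open>Besides having highest weight, the vector is flat, i.e. killed by the chart derivations.
  This makes the K-space of its string stable under them.\<close>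

definition hw_vector where
  "hw_vector c d w \<longleftrightarrow> w \<in> V \<and> w \<noteq> 0 \<and> raise w = 0 \<and> e 0 0 w = smul c w \<and> e 1 1 w = smul d w \<and>
    (\<forall>i<2. pd h i w = 0)"

definition string_space where
  "string_space w N = {\<Sum>j\<le>N. smul (a j) ((lower ^^ j) w) | a. True}"

text \<open>Twice the Casimir element of \<open>sl\<^sub>2\<close>, as \<open>4 F E + H\<^sup>2 + 2 H\<close>.\<close>

definition casimir where
  "casimir v = smul 4 (lower (raise v)) + (e 0 0 (e 0 0 v - e 1 1 v) - e 1 1 (e 0 0 v - e 1 1 v)) +
    smul 2 (e 0 0 v - e 1 1 v)"

lemma casimir_add: "casimir (v + w) = casimir v + casimir w"
  unfolding casimir_def e_add e_diff smul_simps by (simp only: algebra_simps)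

lemma casimir_smul: "casimir (smul c v) = smul c (casimir v)"
  unfolding casimir_def e_smul e_diff smul_simps by (simp only: mult.commute)

end

locale hw_string = chart_embedding +
  fixes w c d N
  assumes hw: "hw_vector c d w" and top: "(lower ^^ Suc N) w = 0"
    and nonzero: "\<And>j. j \<le> N \<Longrightarrow> (lower ^^ j) w \<noteq> 0"
begin

abbreviation "b \<equiv> \<lambda>j. (lower ^^ j) w"

lemma b_V: "b j \<in> V"
  by (induction j) (use hw in \<open>auto simp: hw_vector_def intro: V_e\<close>)

lemma b_weight: "e 0 0 (b j) = smul (c - of_nat j) (b j)" "e 1 1 (b j) = smul (d + of_nat j) (b j)"
proof (induction j)
  case 0
  { case 1 then show ?case using hw by (simp add: hw_vector_def) }
  { case 2 then show ?case using hw by (simp add: hw_vector_def) }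
next
  case (Suc j)
  have s: "b (Suc j) = lower (b j)" by (simp only: funpow.simps comp_apply)
  { case 1 show ?case
      unfolding s gl2_relations(4)[OF b_V] Suc.IH e_smul by (rule ext) (simp add: pointwise algebra_simps) }
  { case 2 show ?case
      unfolding s gl2_relations(5)[OF b_V] Suc.IH e_smul by (rule ext) (simp add: pointwise algebra_simps) }
qed

text \<open>The sl_2 formula E F^(j+1) w = (j+1) (\<lambda> - j) F^j w with \<lambda> = c -
  d.\<close>

lemma b_raise: "raise (b (Suc j)) = smul (of_nat (Suc j) * (c - d - of_nat j)) (b j)"
proof (induction j)
  case 0
  have "raise w = 0" using hw by (simp add: hw_vector_def)
  then show ?case
    using gl2_relations(1)[OF b_V[of 0]] b_weight[of 0] by (simp add: smul_simps)
next
  case (Suc j)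
  have "raise (b (Suc (Suc j))) = lower (raise (b (Suc j))) + (e 0 0 (b (Suc j)) - e 1 1 (b (Suc j)))"
    using gl2_relations(1)[OF b_V[of "Suc j"]] by simp
  also have "\<dots> = smul (of_nat (Suc j) * (c - d - of_nat j)) (b (Suc j)) +
      (smul (c - of_nat (Suc j)) (b (Suc j)) - smul (d + of_nat (Suc j)) (b (Suc j)))"
    unfolding Suc.IH b_weight e_smul by simp
  also have "\<dots> = smul (of_nat (Suc (Suc j)) * (c - d - of_nat (Suc j))) (b (Suc j))"
    unfolding smul_simps(2,4)[symmetric] by (rule arg_cong[where f = "\<lambda>c. smul c _"]) (simp add: algebra_simps)
  finally show ?case .
qed

lemma b_pd: "i < 2 \<Longrightarrow> pd h i (b j) = 0"
  by (induction j) (use hw in \<open>auto simp: hw_vector_def e_pd\<close>)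

text \<open>Raising the vanishing vector F^(N+1) w gives (N+1) (c - d - N) F^N w = 0, where F^N w is
  nonzero.\<close>

lemma weight_diff: "c - d = of_nat N"
proof -
  have "smul (of_nat (Suc N) * (c - d - of_nat N)) (b N) = raise (b (Suc N))" by (rule b_raise[symmetric])
  also have "\<dots> = 0" by (simp only: top e_0)
  finally have "of_nat (Suc N) * (c - d - of_nat N) = 0"
    using nonzero[of N] by (simp only: smul_eq_0_iff order_refl simp_thms)
  then show ?thesis by (simp only: mult_eq_0_iff of_nat_eq_0_iff nat.distinct simp_thms right_minus_eq)
qed

lemma b_zero: "N < j \<Longrightarrow> b j = 0"
proof (induction j)
  case (Suc j)
  show ?case
  proof (cases "j = N")
    case True
    show ?thesis unfolding True by (rule top)
  next
    case False
    then have "N < j" using Suc.prems by simp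
    then have "b j = 0" by (rule Suc.IH)
    then show ?thesis by (simp only: funpow.simps comp_apply e_0)
  qed
qed simp

abbreviation "Q \<equiv> string_space w N"

lemma Q_lin: "lin_space Q"
  unfolding lin_space_def
proof (intro conjI ballI allI)
  have "0 = (\<Sum>j\<le>N. smul 0 (b j))" by (simp add: smul_simps)
  then show "0 \<in> Q" unfolding string_space_def by (intro CollectI exI[of _ "\<lambda>_. 0"]) simp
  fix v assume "v \<in> Q"
  then obtain a where v: "v = (\<Sum>j\<le>N. smul (a j) (b j))" unfolding string_space_def by blast
  { fix u assume "u \<in> Q"
    then obtain a' where u: "u = (\<Sum>j\<le>N. smul (a' j) (b j))" unfolding string_space_def by blast
    have "v + u = (\<Sum>j\<le>N. smul (a j + a' j) (b j))"
      unfolding v u smul_simps sum.distrib ..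
    then show "v + u \<in> Q" unfolding string_space_def by (intro CollectI exI[of _ "\<lambda>j. a j + a' j"]) simp }
  fix k
  have "smul k v = (\<Sum>j\<le>N. smul (k * a j) (b j))"
    unfolding v smul_sum smul_simps ..
  then show "smul k v \<in> Q" unfolding string_space_def by (intro CollectI exI[of _ "\<lambda>j. k * a j"]) simp
qed

lemma Q_b: "b j \<in> Q"
proof (cases "j \<le> N")
  case True
  have "(\<Sum>k\<le>N. smul (if k = j then 1 else 0) (b k)) = (\<Sum>k\<le>N. if k = j then b k else 0)"
    by (rule sum.cong) (simp_all add: smul_simps)
  also have "\<dots> = b j" using True by simp
  finally show ?thesis unfolding string_space_def by (intro CollectI exI[of _ "\<lambda>k. if k = j then 1 else 0"]) simp
next
  case False
  then show ?thesis using b_zero[of j] lin_spaceD(1)[OF Q_lin] by simp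
qed

lemma Q_subset: "lin_space T \<Longrightarrow> (\<And>j. b j \<in> T) \<Longrightarrow> Q \<subseteq> T"
  unfolding string_space_def by (auto intro!: lin_space_sum lin_spaceD(3))

lemma Q_V: "Q \<subseteq> V"
  by (rule Q_subset[OF V_lin b_V])

lemma e_b_Q: "p < 2 \<Longrightarrow> i < 2 \<Longrightarrow> e p i (b j) \<in> Q"
proof -
  have "raise (b j) \<in> Q"
  proof (cases j)
    case 0
    then show ?thesis using hw lin_spaceD(1)[OF Q_lin] by (simp add: hw_vector_def)
  next
    case (Suc i)
    show ?thesis unfolding Suc b_raise by (rule lin_spaceD(3)[OF Q_lin Q_b])
  qed
  moreover have "lower (b j) \<in> Q" using Q_b[of "Suc j"] by simp
  ultimately show "p < 2 \<Longrightarrow> i < 2 \<Longrightarrow> e p i (b j) \<in> Q"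
    by (auto simp only: less_2_nat b_weight intro!: lin_spaceD(3)[OF Q_lin] Q_b)
qed

lemma Q_stable: "stable_space Q"
  unfolding stable_space_def
proof (intro conjI allI impI ballI)
  show "0 \<in> Q" "v \<in> Q \<Longrightarrow> u \<in> Q \<Longrightarrow> v + u \<in> Q" "v \<in> Q \<Longrightarrow> smul k v \<in> Q" for v u k
    by (rule lin_spaceD[OF Q_lin]; assumption)+
  fix v assume "v \<in> Q"
  then obtain a where v: "v = (\<Sum>j\<le>N. smul (a j) (b j))" unfolding string_space_def by blast
  { fix i :: nat assume "i < 2"
    then have "pd h i (b j) \<in> Q" for j using b_pd lin_spaceD(1)[OF Q_lin] by simp
    then show "pd h i v \<in> Q" unfolding v pd_sum pd_smul
      by (intro lin_space_sum[OF Q_lin] lin_spaceD(2,3)[OF Q_lin] Q_b) }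
  fix p i :: nat assume "p < 2" "i < 2"
  then show "e p i v \<in> Q" unfolding v e_sum e_smul
    by (intro lin_space_sum[OF Q_lin] lin_spaceD(3)[OF Q_lin] e_b_Q)
qed

text \<open>Each raising step drops the lowest term and multiplies the top coefficient by some (j+1)
  (N-j) with j < N. So every nonzero vector of the string can be raised to a nonzero multiple of w,
  which yields both independence and irreducibility.\<close>

lemma raise_power_string:
  assumes "J \<le> N" "a J \<noteq> 0"
  shows "\<exists>k. k \<noteq> 0 \<and> (raise ^^ J) (\<Sum>j\<le>J. smul (a j) (b j)) = smul k w"
  using assms
proof (induction J arbitrary: a)
  case 0
  then show ?case by (intro exI[of _ "a 0"]) simp
next
  case (Suc J)
  have r0: "raise (b 0) = 0" using hw by (simp add: hw_vector_def)
  let ?a = "\<lambda>j. a (Suc j) * (of_nat (Suc j) * (c - d - of_nat j))"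
  have "raise (\<Sum>j\<le>Suc J. smul (a j) (b j)) = (\<Sum>j\<le>Suc J. smul (a j) (raise (b j)))"
    by (simp only: e_sum e_smul)
  also have "\<dots> = smul (a 0) (raise (b 0)) + (\<Sum>j\<le>J. smul (a (Suc j)) (raise (b (Suc j))))"
    by (rule sum.atMost_Suc_shift)
  also have "\<dots> = (\<Sum>j\<le>J. smul (?a j) (b j))"
    unfolding r0 b_raise smul_simps(5,8) by (rule add_0_left)
  finally have eq: "raise (\<Sum>j\<le>Suc J. smul (a j) (b j)) = \<dots>" .
  have NJ: "c - d - of_nat J = of_nat (N - J)"
    unfolding weight_diff using Suc.prems(1) by (simp only: of_nat_diff Suc_leD)
  have "?a J \<noteq> 0"
    unfolding NJ mult_eq_0_iff of_nat_eq_0_iff using Suc.prems by simp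
  from Suc.IH[of ?a, OF _ this] Suc.prems(1)
  show ?case unfolding funpow_Suc_right comp_apply eq by simp
qed

lemma leading_coefficient:
  assumes "\<not> (\<forall>j\<le>N. a j = 0)"
  obtains J where "J \<le> N" "a J \<noteq> 0" "(\<Sum>j\<le>N. smul (a j) (b j)) = (\<Sum>j\<le>J. smul (a j) (b j))"
proof -
  let ?S = "{j. j \<le> N \<and> a j \<noteq> 0}"
  have fin: "finite ?S" "?S \<noteq> {}" using assms by auto
  have J: "Max ?S \<in> ?S" by (rule Max_in[OF fin])
  have "(\<Sum>j\<le>N. smul (a j) (b j)) = (\<Sum>j\<le>Max ?S. smul (a j) (b j))"
  proof (rule sum.mono_neutral_right)
    show "\<forall>j\<in>{..N} - {..Max ?S}. smul (a j) (b j) = 0"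
    proof
      fix j assume j: "j \<in> {..N} - {..Max ?S}"
      then have "j \<notin> ?S" using Max_ge[OF fin(1), of j] by auto
      then show "smul (a j) (b j) = 0" using j by (auto simp: smul_simps)
    qed
  qed (use J in auto)
  then show ?thesis using that[of "Max ?S"] J by blast
qed

lemma b_independent:
  assumes "(\<Sum>j\<le>N. smul (a j) (b j)) = 0" "j \<le> N"
  shows "a j = 0"
proof (rule ccontr)
  assume "a j \<noteq> 0"
  then have "\<not> (\<forall>j\<le>N. a j = 0)" using assms(2) by blast
  then obtain J where J: "J \<le> N" "a J \<noteq> 0" "(\<Sum>j\<le>N. smul (a j) (b j)) = (\<Sum>j\<le>J. smul (a j) (b j))"
    by (rule leading_coefficient)
  obtain k where "k \<noteq> 0" "(raise ^^ J) (\<Sum>j\<le>J. smul (a j) (b j)) = smul k w"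
    using raise_power_string[where a = a, OF J(1,2)] by blast
  moreover have "(raise ^^ J) 0 = 0"
    by (induction J) (simp_all only: funpow.simps comp_apply id_apply e_0)
  ultimately have "smul k w = 0" using assms(1) J(3) by simp
  then show False using \<open>k \<noteq> 0\<close> hw by (simp add: smul_eq_0_iff hw_vector_def)
qed

lemma Q_irreducible:
  assumes T: "stable_space T" and v: "v \<in> T" "v \<in> Q" "v \<noteq> 0"
  shows "Q \<subseteq> T"
proof -
  have TL: "lin_space T" using T by (simp add: stable_space_def lin_space_def)
  obtain a where a: "v = (\<Sum>j\<le>N. smul (a j) (b j))" using v(2) unfolding string_space_def by blast
  have "\<not> (\<forall>j\<le>N. a j = 0)"
  proof
    assume "\<forall>j\<le>N. a j = 0"
    then have "v = (\<Sum>j\<le>N. 0)" unfolding a by (intro sum.cong) (auto simp: smul_simps)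
    then show False using v(3) by simp
  qed
  then obtain J where J: "J \<le> N" "a J \<noteq> 0" "(\<Sum>j\<le>N. smul (a j) (b j)) = (\<Sum>j\<le>J. smul (a j) (b j))"
    by (rule leading_coefficient)
  obtain k where k: "k \<noteq> 0" "(raise ^^ J) v = smul k w"
    using raise_power_string[where a = a, OF J(1,2)] unfolding a J(3) by blast
  have "(raise ^^ m) v \<in> T" for m
    by (induction m) (use v(1) stable_spaceD(5)[OF T] in auto)
  then have "smul (inverse k) (smul k w) \<in> T" using k(2) stable_spaceD(3)[OF T] by metis
  then have "w \<in> T" using k(1) by (simp add: smul_simps)
  then have "b j \<in> T" for j
    by (induction j) (use stable_spaceD(5)[OF T] in auto)
  then show ?thesis by (rule Q_subset[OF TL])
qed

text \<open>The eigenvalue N (N + 2) does not depend on j and determines N, so it separates strings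
  of different lengths.\<close>

lemma casimir_b: "casimir (b j) = smul (of_nat N ^ 2 + 2 * of_nat N) (b j)"
proof -
  have lr: "lower (raise (b j)) = smul (of_nat j * (c - d - of_nat j + 1)) (b j)"
  proof (cases j)
    case 0
    then show ?thesis using hw by (simp add: hw_vector_def smul_simps)
  next
    case (Suc i)
    show ?thesis unfolding Suc b_raise e_smul by (simp add: algebra_simps)
  qed
  have H: "e 0 0 (b j) - e 1 1 (b j) = smul (of_nat N - 2 * of_nat j) (b j)"
    unfolding b_weight weight_diff[symmetric] by (rule ext) (simp add: pointwise algebra_simps)
  show ?thesis
    unfolding casimir_def H lr unfolding e_smul b_weight unfolding weight_diff[symmetric]
    by (rule ext) (simp add: pointwise algebra_simps power2_eq_square)
qed

lemma casimir_Q: "v \<in> Q \<Longrightarrow> casimir v = smul (of_nat N ^ 2 + 2 * of_nat N) v"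
proof -
  have "lin_space {v. casimir v = smul (of_nat N ^ 2 + 2 * of_nat N) v}"
    unfolding lin_space_def
    by (auto simp: casimir_add casimir_smul smul_simps mult.commute) (simp add: casimir_def smul_simps)
  from Q_subset[OF this] casimir_b show "v \<in> Q \<Longrightarrow> ?thesis" by blast
qed

end

lemma smul_sum_left: "smul (sum f I) v = (\<Sum>i\<in>I. smul (f i :: 'f::comm_ring_1) v)"
  by (induction I rule: infinite_finite_induct)
    (simp_all only: sum.infinite sum.empty sum.insert smul_simps simp_thms)

section \<open>Existence of a string\<close>

context chart_embedding
begin

lemma hw_stringI:
  assumes hw: "hw_vector c d w" and nil: "(lower ^^ k) w = 0"
  shows "\<exists>N. hw_string P e h \<phi> w c d N"
proof -
  define K where "K = (LEAST k. (lower ^^ k) w = 0)"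
  have K: "(lower ^^ K) w = 0" unfolding K_def using nil by (rule LeastI[where P = "\<lambda>k. (lower ^^ k) w = 0"])
  have "K \<noteq> 0"
  proof
    assume "K = 0"
    then have "w = 0" using K by (simp only: funpow.simps id_apply)
    then show False using hw by (simp only: hw_vector_def simp_thms)
  qed
  then obtain N where N: "K = Suc N" using not0_implies_Suc by blast
  have "(lower ^^ j) w \<noteq> 0" if "j \<le> N" for j
    using not_less_Least[of j "\<lambda>k. (lower ^^ k) w = 0"] that N unfolding K_def by simp
  then have "hw_string P e h \<phi> w c d N"
    using hw K N by unfold_locales auto
  then show ?thesis by blast
qed

lemma eigenvalue_in_list:
  assumes "e p i u = smul c u" "u \<noteq> 0" "foldr (\<lambda>c v. e p i v - smul c v) cs u = 0"
  shows "c \<in> set cs"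
proof -
  have "smul (\<Prod>b\<leftarrow>cs. c - b) u = 0"
    using foldr_eigenvector[where T = "e p i" and c = c and u = u and cs = cs, OF e_smul assms(1)] assms(3) by (rule trans[OF sym])
  then have "0 \<in> set (map (\<lambda>b. c - b) cs)"
    using assms(2) by (simp only: smul_eq_0_iff simp_thms prod_list_zero_iff)
  then show ?thesis by auto
qed

text \<open>If no T^j v vanished, they would be eigenvectors for infinitely many distinct
  eigenvalues, while all eigenvalues of \<open>e p i\<close> on the span occur in the finite list
  \<open>cs\<close>.\<close>

lemma finite_eigenvalues:
  assumes T: "\<And>j. e p i ((T ^^ j) v) = smul (c + s * of_nat j) ((T ^^ j) v)" and s: "s \<noteq> 0"
    and V: "\<And>j. (T ^^ j) v \<in> V" and cs: "\<And>v. v \<in> V \<Longrightarrow> foldr (\<lambda>c v. e p i v - smul c v) cs v = 0"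
  shows "\<exists>j. (T ^^ j) v = 0"
proof (rule ccontr)
  assume n: "\<not> ?thesis"
  then have "c + s * of_nat j \<in> set cs" for j
    using eigenvalue_in_list[OF T _ cs[OF V]] by blast
  then have "range (\<lambda>j::nat. c + s * of_nat j) \<subseteq> set cs" by blast
  then have "finite (range (\<lambda>j::nat. c + s * of_nat j))" by (rule finite_subset) simp
  moreover have "inj (\<lambda>j::nat. c + s * of_nat j)" using s by (auto simp: inj_on_def)
  ultimately show False using finite_imageD by blast
qed

text \<open>A joint eigenvector of the two diagonal units is raised until it dies. In the weight
  reached last, the vectors killed by \<open>raise\<close> form a space stable under the chart
  derivations, because the weight is constant; there \<open>exists_flat\<close> applies.\<close>

lemma exists_hw_string:
  assumes I: "finite I" "\<And>x i. x \<in> carrier P \<Longrightarrow> i \<notin> I \<Longrightarrow> \<phi> x i = 0"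
    and cs: "\<And>v. v \<in> V \<Longrightarrow> foldr (\<lambda>c v. e 0 0 v - smul c v) (map frac_const cs) v = 0"
    and ds: "\<And>v. v \<in> V \<Longrightarrow> foldr (\<lambda>c v. e 1 1 v - smul c v) (map frac_const ds) v = 0"
    and nz: "x \<in> carrier P" "\<phi> x \<noteq> 0"
  shows "\<exists>w c d N. hw_string P e h \<phi> w c d N"
proof -
  obtain c0 v0 where c0: "c0 \<in> set (map frac_const cs)" and v0: "v0 \<in> V" "v0 \<noteq> 0" "e 0 0 v0 = smul c0 v0"
    using exists_eigenvector[where T = "e 0 0", OF V_lin V_e[OF _ pos2 pos2] kspan_phi[OF nz(1)] nz(2)
        cs[OF kspan_phi[OF nz(1)]]] by blast
  let ?U = "{v \<in> V. e 0 0 v = smul c0 v}"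
  have U: "lin_space ?U"
    unfolding lin_space_def using lin_spaceD[OF V_lin]
    by (auto simp: e_add e_smul smul_simps mult.commute)
  have UT: "e 1 1 v \<in> ?U" if "v \<in> ?U" for v
    using that by (auto simp: gl2_relations(6) e_smul intro: V_e)
  obtain d0 v1 where d0: "d0 \<in> set (map frac_const ds)" and v1: "v1 \<in> ?U" "v1 \<noteq> 0" "e 1 1 v1 = smul d0 v1"
    using exists_eigenvector[where T = "e 1 1", OF U UT _ v0(2) ds[OF v0(1)]] v0(1,3) by blast
  \<comment> \<open>The factor 1 is the \<open>s\<close> of \<open>finite_eigenvalues\<close>; the
    lowering below has -1 in its place.\<close>
  have raised: "(raise ^^ j) v1 \<in> V \<and> e 0 0 ((raise ^^ j) v1) = smul (c0 + 1 * of_nat j) ((raise ^^ j) v1) \<and>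
      e 1 1 ((raise ^^ j) v1) = smul (d0 - of_nat j) ((raise ^^ j) v1)" for j
  proof (induction j)
    case 0
    then show ?case using v1 by simp
  next
    case (Suc j)
    have s: "(raise ^^ Suc j) v1 = raise ((raise ^^ j) v1)" by simp
    from Suc have IH: "(raise ^^ j) v1 \<in> V" "e 0 0 ((raise ^^ j) v1) = smul (c0 + 1 * of_nat j) ((raise ^^ j) v1)"
      "e 1 1 ((raise ^^ j) v1) = smul (d0 - of_nat j) ((raise ^^ j) v1)" by blast+
    show ?case
      unfolding s gl2_relations(2,3)[OF IH(1)] IH(2,3) e_smul
      using V_e[OF IH(1), of 0 1] by (auto simp: fun_eq_iff pointwise algebra_simps)
  qed
  define J where "J = (LEAST j. (raise ^^ j) v1 = 0)"
  have "\<exists>j. (raise ^^ j) v1 = 0"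
    by (rule finite_eigenvalues[where p = 0 and i = 0 and c = c0 and s = 1 and cs = "map frac_const cs"])
      (use raised cs in auto)
  then have J: "(raise ^^ J) v1 = 0" unfolding J_def by (rule LeastI_ex)
  have "J \<noteq> 0" using J v1(2) by (metis funpow_0)
  then obtain J' where J': "J = Suc J'" using not0_implies_Suc by blast
  let ?v = "(raise ^^ J') v1" and ?c = "c0 + 1 * of_nat J'" and ?d = "d0 - of_nat J'"
  have v: "?v \<in> V" "?v \<noteq> 0" "raise ?v = 0" "e 0 0 ?v = smul ?c ?v" "e 1 1 ?v = smul ?d ?v"
    using raised[of J'] J not_less_Least[of J' "\<lambda>j. (raise ^^ j) v1 = 0"] J' unfolding J_def[symmetric] by auto
  let ?U' = "{v \<in> V. raise v = 0 \<and> e 0 0 v = smul ?c v \<and> e 1 1 v = smul ?d v}"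
  \<comment> \<open>The starting weights come from the lists \<open>cs\<close> and
    \<open>ds\<close>, hence from k, and raising shifts them by integers.\<close>
  have const: "pderiv_chart h i ?c = 0" "pderiv_chart h i ?d = 0" for i
    using c0 d0 by (auto simp: pderiv_chart_add pderiv_chart_diff)
  have "\<exists>u\<in>?U'. u \<noteq> 0 \<and> (\<forall>i<2. pd h i u = 0)"
  proof (rule exists_flat[OF _ _ I(1)])
    show "lin_space ?U'"
      unfolding lin_space_def using lin_spaceD[OF V_lin]
      by (auto simp: e_add e_smul smul_simps mult.commute)
    show "pd h i v \<in> ?U'" if "i < 2" "v \<in> ?U'" for i v
    proof -
      from that(2) have *: "v \<in> V" "raise v = 0" "e 0 0 v = smul ?c v" "e 1 1 v = smul ?d v" by blast+
      show ?thesis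
        using V_pd[OF *(1) that(1)]
        by (simp only: mem_Collect_eq e_pd[symmetric] * pd_0 pd_smul const smul_simps(7) add_0_left simp_thms)
    qed
    show "v i = 0" if v: "v \<in> ?U'" and i: "i \<notin> I" for v i
    proof -
      from v obtain a s where as: "a \<noteq> 0" "s \<in> carrier P" "smul (to_fract a) v = \<phi> s"
        unfolding kspan_def by blast
      then have "to_fract a * v i = 0" using I(2)[OF as(2) i] by (metis smul_apply)
      then show ?thesis using as(1) by simp
    qed
    show "?v \<in> ?U'" "?v \<noteq> 0" using v by blast+
  qed
  then obtain w where w: "w \<in> V" "raise w = 0" "e 0 0 w = smul ?c w" "e 1 1 w = smul ?d w" "w \<noteq> 0"
    "\<forall>i<2. pd h i w = 0" by blast
  then have hw: "hw_vector ?c ?d w" unfolding hw_vector_def by blast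
  have lowered: "(lower ^^ j) w \<in> V \<and> e 0 0 ((lower ^^ j) w) = smul (?c + (-1) * of_nat j) ((lower ^^ j) w)" for j
  proof (induction j)
    case 0
    then show ?case using w by simp
  next
    case (Suc j)
    have s: "(lower ^^ Suc j) w = lower ((lower ^^ j) w)" by simp
    from Suc have IH: "(lower ^^ j) w \<in> V" "e 0 0 ((lower ^^ j) w) = smul (?c + (-1) * of_nat j) ((lower ^^ j) w)" by blast+
    show ?case
      unfolding s gl2_relations(4)[OF IH(1)] IH(2) e_smul
      using V_e[OF IH(1), of 1 0] by (auto simp: fun_eq_iff pointwise algebra_simps)
  qed
  have "\<exists>j. (lower ^^ j) w = 0"
    by (rule finite_eigenvalues[where p = 0 and i = 0 and c = ?c and s = "-1" and cs = "map frac_const cs"])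
      (use lowered cs in auto)
  then show ?thesis using hw_stringI[OF hw] by blast
qed

end

text \<open>The submodule cut out by the string has an element mapped to a nonzero multiple of w; so
  it is nonzero, and by simplicity it is everything.\<close>

lemma (in chart_embedding_inj) simple_imp_string:
  assumes "av_simple P" "hw_string P e h \<phi> w c d N"
  shows "kspan (carrier P) = string_space w N"
proof -
  interpret hw_string P e h \<phi> w c d N by fact
  have S: "kspan (preimage Q) = Q" by (rule kspan_preimage[OF Q_stable Q_V])
  have "preimage Q \<noteq> {\<zero>\<^bsub>P\<^esub>}"
  proof
    assume "preimage Q = {\<zero>\<^bsub>P\<^esub>}"
    then have "w \<in> kspan {\<zero>\<^bsub>P\<^esub>}" using S Q_b[of 0] by simp
    then obtain a where "a \<noteq> 0" "smul (to_fract a) w = 0" unfolding kspan_def by auto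
    then have "w = 0" by (simp only: smul_eq_0_iff to_fract_eq_0_iff simp_thms)
    then show False using hw by (simp only: hw_vector_def simp_thms)
  qed
  then have "preimage Q = carrier P"
    using assms(1) av_submodule_preimage[OF Q_stable] unfolding av_simple_def by blast
  then show ?thesis using S by simp
qed

section \<open>The Clebsch-Gordan decomposition\<close>

text \<open>Solution of the recursion which says that the raising operator kills the alternating sum.\<close>

definition cg_coeff :: "nat \<Rightarrow> nat \<Rightarrow> nat \<Rightarrow> nat \<Rightarrow> nat" where
  "cg_coeff n m r i = (r choose i) * fact (m - r + i) * fact (n - i)"

lemma cg_coeff_pos: "i \<le> r \<Longrightarrow> cg_coeff n m r i > 0"
  by (simp add: cg_coeff_def)

lemma cg_coeff_rec:
  assumes "i < r" "r \<le> n" "r \<le> m"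
  shows "cg_coeff n m r (Suc i) * (Suc i * (n - i)) = cg_coeff n m r i * ((r - i) * (m - r + i + 1))"
proof -
  have "Suc i * (r choose Suc i) = (r - i) * (r choose i)"
    by (rule binomial_absorption[THEN trans]) (simp add: binomial_absorb_comp)
  note b = this
  have "n - i = Suc (n - Suc i)" using assms by simp
  then have f: "fact (n - i) = (n - i) * (fact (n - Suc i) :: nat)" by (metis fact_Suc of_nat_id)
  have f': "(fact (m - r + Suc i) :: nat) = (m - r + i + 1) * fact (m - r + i)"
    by (simp add: algebra_simps)
  have "cg_coeff n m r (Suc i) * (Suc i * (n - i)) =
      (Suc i * (r choose Suc i)) * fact (m - r + Suc i) * ((n - i) * fact (n - Suc i))"
    unfolding cg_coeff_def by (simp only: ac_simps)
  also have "\<dots> = cg_coeff n m r i * ((r - i) * (m - r + i + 1))"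
    unfolding b f' f[symmetric] cg_coeff_def by (simp only: ac_simps)
  finally show ?thesis .
qed

text \<open>Here \<open>x i j\<close> stands for F^i w \<otimes> F^j w', with strings of n + 1 and m
  + 1 vectors. The assumptions list the action on these vectors, so the decomposition is carried out
  without mention of tensor products.\<close>

locale clebsch_gordan = chart_embedding P e h \<phi>
  for P :: "('k::field_char_0 sphere, 'p) av_structure"
    and e :: "nat \<Rightarrow> nat \<Rightarrow> ('i \<Rightarrow> 'k sphere fract) \<Rightarrow> 'i \<Rightarrow> 'k sphere fract" and h \<phi> +
  fixes n m :: nat and x :: "nat \<Rightarrow> nat \<Rightarrow> 'i \<Rightarrow> 'k sphere fract" and c d :: "'k sphere fract"
  assumes x_V: "x i j \<in> kspan (carrier P)"
    and x_zero: "n < i \<or> m < j \<Longrightarrow> x i j = 0"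
    and x_pd: "k < 2 \<Longrightarrow> pd h k (x i j) = 0"
    and x_00: "e 0 0 (x i j) = smul (c - of_nat (i + j)) (x i j)"
    and x_11: "e 1 1 (x i j) = smul (d + of_nat (i + j)) (x i j)"
    and x_raise: "e 0 1 (x i j) = smul (of_nat i * (of_nat n - of_nat i + 1)) (x (i - 1) j) +
      smul (of_nat j * (of_nat m - of_nat j + 1)) (x i (j - 1))"
    and x_lower: "e 1 0 (x i j) = x (Suc i) j + x i (Suc j)"
    and x_independent: "(\<Sum>i\<le>r. smul (a i) (x i (r - i))) = 0 \<Longrightarrow> r \<le> min n m \<Longrightarrow> i \<le> r \<Longrightarrow> a i = 0"
    and x_span: "lin_space T \<Longrightarrow> (\<And>i j. x i j \<in> T) \<Longrightarrow> kspan (carrier P) \<subseteq> T"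
    and top_weight: "c - d = of_nat (n + m)"
begin

text \<open>Signs and positive integers are kept apart in the coefficients; the positivity is what
  \<open>V_subset\<close> relies on.\<close>

definition u :: "nat \<Rightarrow> 'i \<Rightarrow> 'k sphere fract" where
  "u r = (\<Sum>i\<le>r. smul ((-1) ^ i * of_nat (cg_coeff n m r i)) (x i (r - i)))"

lemma u_raise:
  assumes r: "r \<le> min n m"
  shows "raise (u r) = 0"
proof (cases r)
  case 0
  show ?thesis unfolding 0 u_def by (simp add: e_smul x_raise smul_simps)
next
  case (Suc s)
  let ?g = "\<lambda>i. (-1) ^ i * of_nat (cg_coeff n m r i) :: 'k sphere fract"
  have "raise (u r) = (\<Sum>i\<le>r. smul (?g i * (of_nat i * (of_nat n - of_nat i + 1))) (x (i - 1) (r - i))) +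
      (\<Sum>i\<le>r. smul (?g i * (of_nat (r - i) * (of_nat m - of_nat (r - i) + 1))) (x i (r - i - 1)))"
    unfolding u_def e_sum e_smul x_raise smul_simps sum.distrib ..
  \<comment> \<open>The term i = 0 vanishes and the sum is shifted; in the next sum the term i = r
    vanishes. Then both run over \<open>x i (s - i)\<close> with s = r - 1, and
    \<open>cg_coeff_rec\<close> cancels them term by term, the signs being opposite.\<close>
  also have "(\<Sum>i\<le>r. smul (?g i * (of_nat i * (of_nat n - of_nat i + 1))) (x (i - 1) (r - i))) =
     (\<Sum>i\<le>s. smul (?g (Suc i) * (of_nat (Suc i) * (of_nat n - of_nat (Suc i) + 1))) (x i (s - i)))"
    unfolding Suc sum.atMost_Suc_shift by (simp add: smul_simps)
  also have "(\<Sum>i\<le>r. smul (?g i * (of_nat (r - i) * (of_nat m - of_nat (r - i) + 1))) (x i (r - i - 1))) =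
     (\<Sum>i\<le>s. smul (?g i * (of_nat (r - i) * (of_nat m - of_nat (r - i) + 1))) (x i (s - i)))"
    unfolding Suc sum.atMost_Suc by (simp add: smul_simps Suc_diff_le)
  also have "(\<Sum>i\<le>s. smul (?g (Suc i) * (of_nat (Suc i) * (of_nat n - of_nat (Suc i) + 1))) (x i (s - i))) +
     (\<Sum>i\<le>s. smul (?g i * (of_nat (r - i) * (of_nat m - of_nat (r - i) + 1))) (x i (s - i))) = 0"
    unfolding sum.distrib[symmetric] smul_simps(2)[symmetric]
  proof (rule sum.neutral, rule ballI)
    fix i assume "i \<in> {..s}"
    then have i: "i < r" using Suc by simp
    have "of_nat n - of_nat (Suc i) + 1 = (of_nat (n - i) :: 'k sphere fract)"
      using i r by (simp add: of_nat_diff)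
    moreover have "of_nat m - of_nat (r - i) + 1 = (of_nat (m - r + i + 1) :: 'k sphere fract)"
      using i r by (simp add: of_nat_diff)
    moreover have "of_nat (cg_coeff n m r (Suc i)) * (of_nat (Suc i) * of_nat (n - i)) =
        (of_nat (cg_coeff n m r i) * (of_nat (r - i) * of_nat (m - r + i + 1)) :: 'k sphere fract)"
      unfolding of_nat_mult[symmetric] using cg_coeff_rec[OF i, of n m] r by simp
    ultimately have "?g (Suc i) * (of_nat (Suc i) * (of_nat n - of_nat (Suc i) + 1)) +
        ?g i * (of_nat (r - i) * (of_nat m - of_nat (r - i) + 1)) = 0"
      by (simp only: power_Suc mult.assoc) simp
    then show "smul (?g (Suc i) * (of_nat (Suc i) * (of_nat n - of_nat (Suc i) + 1)) +
        ?g i * (of_nat (r - i) * (of_nat m - of_nat (r - i) + 1))) (x i (s - i)) = 0"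
      by (simp only: smul_simps)
  qed
  finally show ?thesis .
qed

lemma u_nonzero:
  assumes r: "r \<le> min n m"
  shows "u r \<noteq> 0"
proof
  assume "u r = 0"
  then have "(-1) ^ 0 * of_nat (cg_coeff n m r 0) = (0 :: 'k sphere fract)"
    unfolding u_def by (rule x_independent[OF _ r]) simp
  then show False using cg_coeff_pos[of 0 r n m] by simp
qed

lemma pderiv_chart_coeff [simp]: "pderiv_chart h k ((-1) ^ i * of_nat j :: 'k sphere fract) = 0"
proof -
  have "(-1) ^ i * of_nat j = (frac_const ((-1) ^ i * of_nat j) :: 'k sphere fract)"
    by (cases "even i") (simp_all add: frac_const_def of_nat_sphere[symmetric] to_fract_of_nat)
  then show ?thesis by (simp only: pderiv_chart_const)
qed

lemma u_hw:
  assumes r: "r \<le> min n m"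
  shows "hw_vector (c - of_nat r) (d + of_nat r) (u r)"
  unfolding hw_vector_def
proof (intro conjI allI impI)
  show "u r \<in> V" unfolding u_def
    by (intro lin_space_sum[OF V_lin] lin_spaceD(3)[OF V_lin] x_V)
  show "u r \<noteq> 0" "raise (u r) = 0" using u_nonzero u_raise r by blast+
  show "e 0 0 (u r) = smul (c - of_nat r) (u r)"
    unfolding u_def e_sum e_smul x_00 smul_sum smul_simps(5) by (rule sum.cong) (auto simp: mult.commute)
  show "e 1 1 (u r) = smul (d + of_nat r) (u r)"
    unfolding u_def e_sum e_smul x_11 smul_sum smul_simps(5) by (rule sum.cong) (auto simp: mult.commute)
  show "pd h k (u r) = 0" if "k < 2" for k
    unfolding u_def pd_sum pd_smul x_pd[OF that] by (simp add: smul_simps)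
qed

lemma lower_level:
  assumes "v \<in> {\<Sum>i\<le>s. smul (a i) (x i (s - i)) | a. True}"
  shows "lower v \<in> {\<Sum>i\<le>Suc s. smul (a i) (x i (Suc s - i)) | a. True}"
proof -
  obtain a where v: "v = (\<Sum>i\<le>s. smul (a i) (x i (s - i)))" using assms by blast
  let ?a = "\<lambda>i. (if i = 0 then 0 else a (i - 1)) + (if i \<le> s then a i else 0)"
  have "lower v = (\<Sum>i\<le>s. smul (a i) (x (Suc i) (s - i))) + (\<Sum>i\<le>s. smul (a i) (x i (Suc (s - i))))"
    unfolding v e_sum e_smul x_lower smul_simps sum.distrib ..
  also have "(\<Sum>i\<le>s. smul (a i) (x (Suc i) (s - i))) =
      (\<Sum>i\<le>Suc s. smul (if i = 0 then 0 else a (i - 1)) (x i (Suc s - i)))"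
    unfolding sum.atMost_Suc_shift by (simp add: smul_simps)
  also have "(\<Sum>i\<le>s. smul (a i) (x i (Suc (s - i)))) =
      (\<Sum>i\<le>Suc s. smul (if i \<le> s then a i else 0) (x i (Suc s - i)))"
    unfolding sum.atMost_Suc by (auto simp add: smul_simps Suc_diff_le intro!: sum.cong)
  finally have "lower v = (\<Sum>i\<le>Suc s. smul (?a i) (x i (Suc s - i)))"
    unfolding sum.distrib[symmetric] smul_simps(2)[symmetric] .
  then show ?thesis by (intro CollectI exI[of _ ?a]) simp
qed

text \<open>Lowering increases the level i + j by one, and \<open>x i j\<close> vanishes on all
  levels above n + m.\<close>

lemma u_lower_nilpotent: "(lower ^^ Suc (n + m)) (u r) = 0"
proof -
  have "(lower ^^ k) (u r) \<in> {\<Sum>i\<le>r + k. smul (a i) (x i (r + k - i)) | a. True}" for k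
  proof (induction k)
    case 0
    show ?case unfolding u_def by auto
  next
    case (Suc k)
    from lower_level[OF Suc] show ?case by simp
  qed
  then obtain a where a: "(lower ^^ Suc (n + m)) (u r) = (\<Sum>i\<le>r + Suc (n + m). smul (a i) (x i (r + Suc (n + m) - i)))"
    by blast
  have "x i (r + Suc (n + m) - i) = 0" for i by (rule x_zero) arith
  then show ?thesis unfolding a by (simp add: smul_simps)
qed

text \<open>The length is read off the weights: (c - r) - (d + r) = n + m - 2 r.\<close>

lemma u_string:
  assumes r: "r \<le> min n m"
  shows "hw_string P e h \<phi> (u r) (c - of_nat r) (d + of_nat r) (n + m - 2 * r)"
proof -
  obtain N where N: "hw_string P e h \<phi> (u r) (c - of_nat r) (d + of_nat r) N"
    using hw_stringI[OF u_hw[OF r] u_lower_nilpotent] by blast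
  interpret hw_string P e h \<phi> "u r" "c - of_nat r" "d + of_nat r" N by fact
  have "of_nat N = (c - d) - 2 * of_nat r" using weight_diff by (simp add: algebra_simps)
  also have "\<dots> = of_nat (n + m - 2 * r)" unfolding top_weight using r by (simp add: of_nat_diff)
  finally have "N = n + m - 2 * r" by (simp only: of_nat_eq_iff)
  then show ?thesis using N by simp
qed

text \<open>Modulo a lower-stable space that contains all lower levels, neighbouring vectors of a level
  differ by a sign; so a single vector, or an alternating sum with positive coefficients, yields
  the whole level.\<close>

lemma V_subset:
  assumes T: "lin_space T" and low: "\<And>v. v \<in> T \<Longrightarrow> lower v \<in> T"
    and uT: "\<And>r. r \<le> min n m \<Longrightarrow> u r \<in> T"
  shows "V \<subseteq> T"
proof (rule x_span[OF T])
  have level: "\<forall>i\<le>s. x i (s - i) \<in> T" for s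
  proof (induction s)
    case 0
    have "u 0 = smul (of_nat (cg_coeff n m 0 0)) (x 0 0)" by (simp add: u_def)
    then have "smul (inverse (of_nat (cg_coeff n m 0 0))) (smul (of_nat (cg_coeff n m 0 0)) (x 0 0)) \<in> T"
      using lin_spaceD(3)[OF T uT[of 0]] by simp
    then show ?case using cg_coeff_pos[of 0 0 n m] by (simp add: smul_simps)
  next
    case (Suc s)
    let ?y = "\<lambda>i. x i (Suc s - i)"
    have nb: "?y (Suc i) + ?y i \<in> T" if "i \<le> s" for i
      using low[of "x i (s - i)"] Suc.IH that by (simp add: x_lower Suc_diff_le)
    have up: "?y (Suc i) \<in> T \<longleftrightarrow> ?y i \<in> T" if "i \<le> s" for i
      using lin_spaceD(4)[OF T nb[OF that], of "?y (Suc i)"] lin_spaceD(4)[OF T nb[OF that], of "?y i"] by auto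
    have iff: "?y i \<in> T \<longleftrightarrow> ?y 0 \<in> T" if "i \<le> Suc s" for i
      using that by (induction i) (use up in auto)
    have "?y 0 \<in> T"
    proof (cases "Suc s \<le> min n m")
      case False
      \<comment> \<open>Above level min n m, one end of the level lies outside the rectangle i \<le>
        n, j \<le> m.\<close>
      then have "?y (Suc s) = 0 \<or> ?y 0 = 0" using x_zero by auto
      then show ?thesis using iff[of "Suc s"] lin_spaceD(1)[OF T] by auto
    next
      case True
      let ?g = "\<lambda>i. cg_coeff n m (Suc s) i"
      have alt: "?y i - smul ((-1) ^ i) (?y 0) \<in> T" if "i \<le> Suc s" for i
        using that
      proof (induction i)
        case 0
        then show ?case using lin_spaceD(1)[OF T] by (simp add: smul_simps)
      next
        case (Suc i)
        have "(?y (Suc i) + ?y i) - (?y i - smul ((-1) ^ i) (?y 0)) \<in> T"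
          using Suc by (intro lin_spaceD(4)[OF T nb Suc.IH]) auto
        then show ?case by (simp add: smul_simps)
      qed
      \<comment> \<open>The signs of \<open>u\<close> cancel those of \<open>alt\<close>, so
        \<open>?y 0\<close> occurs with the sum of the positive numbers \<open>?g i\<close> as
        coefficient.\<close>
      have "(\<Sum>i\<le>Suc s. smul ((-1) ^ i * of_nat (?g i)) (?y i - smul ((-1) ^ i) (?y 0))) \<in> T"
        by (intro lin_space_sum[OF T] lin_spaceD(3)[OF T] alt) simp
      also have "(\<Sum>i\<le>Suc s. smul ((-1) ^ i * of_nat (?g i)) (?y i - smul ((-1) ^ i) (?y 0))) =
          u (Suc s) - (\<Sum>i\<le>Suc s. smul (of_nat (?g i)) (?y 0))"
      proof -
        have g: "(-1) ^ i * of_nat (?g i) * (-1) ^ i = (of_nat (?g i) :: 'k sphere fract)" for i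
          by (simp add: power_mult_distrib[symmetric] mult.commute mult.left_commute)
        show ?thesis unfolding u_def smul_simps(3,5) sum_subtractf g ..
      qed
      also have "(\<Sum>i\<le>Suc s. smul (of_nat (?g i)) (?y 0)) = smul (of_nat (\<Sum>i\<le>Suc s. ?g i)) (?y 0)"
        unfolding of_nat_sum by (rule smul_sum_left[symmetric])
      finally have "u (Suc s) - smul (of_nat (\<Sum>i\<le>Suc s. ?g i)) (?y 0) \<in> T" .
      from lin_spaceD(4)[OF T uT[OF True] this]
      have "smul (of_nat (\<Sum>i\<le>Suc s. ?g i)) (?y 0) \<in> T" by simp
      from lin_spaceD(3)[OF T this, of "inverse (of_nat (\<Sum>i\<le>Suc s. ?g i))"]
      have "smul (inverse (of_nat (\<Sum>i\<le>Suc s. ?g i)) * of_nat (\<Sum>i\<le>Suc s. ?g i)) (?y 0) \<in> T"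
        unfolding smul_simps(5) .
      moreover have "(\<Sum>i\<le>Suc s. ?g i) \<noteq> 0" using cg_coeff_pos[of 0 "Suc s" n m] by auto
      then have "inverse (of_nat (\<Sum>i\<le>Suc s. ?g i)) * of_nat (\<Sum>i\<le>Suc s. ?g i) = (1 :: 'k sphere fract)"
        by (intro left_inverse) (simp only: of_nat_eq_0_iff not_False_eq_True)
      ultimately show ?thesis by (simp only: smul_simps)
    qed
    then show ?case using iff by auto
  qed
  show "x i j \<in> T" for i j
    using level[of "i + j"] by (metis diff_add_inverse le_add1)
qed

end

section \<open>From the decomposition over K to a decomposition over A\<close>

lemma square_plus_double_inj:
  fixes a b :: nat
  assumes "a^2 + 2 * a = b^2 + 2 * b"
  shows "a = b"
proof -
  have "(a + 1)^2 = (b + 1)^2" using assms by (simp add: power2_eq_square algebra_simps)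
  then show ?thesis by simp
qed

lemma (in chart_embedding) phi_finsum:
  "f \<in> I \<rightarrow> carrier P \<Longrightarrow> \<phi> (\<Oplus>\<^bsub>P\<^esub>i\<in>I. f i) = (\<Sum>i\<in>I. \<phi> (f i))"
proof (induction I rule: infinite_finite_induct)
  case (insert i I)
  then have "f \<in> I \<rightarrow> carrier P" "f i \<in> carrier P" by auto
  then show ?case
    using insert by (simp add: M.finsum_insert phi_add)
qed simp_all

lemma (in chart_embedding) preimage_phi: "x \<in> preimage Q \<Longrightarrow> \<phi> x \<in> Q"
  by (simp add: preimage_def)

locale clebsch_gordan_inj = clebsch_gordan P e h \<phi> n m x c d + chart_embedding_inj P e h \<phi>
  for P :: "('k::field_char_0 sphere, 'p) av_structure" and e h and \<phi> :: "'p \<Rightarrow> 'i \<Rightarrow> 'k sphere fract"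
    and n m x c d +
  assumes fg: "finitely_generated_over_A P"
begin

definition R where "R = {..min n m}"

definition component_space where "component_space r = string_space (u r) (n + m - 2 * r)"

definition component where "component r = preimage (component_space r)"

lemma string: "r \<in> R \<Longrightarrow> hw_string P e h \<phi> (u r) (c - of_nat r) (d + of_nat r) (n + m - 2 * r)"
  by (rule u_string) (simp add: R_def)

lemma component_space:
  assumes "r \<in> R"
  shows "stable_space (component_space r)" "component_space r \<subseteq> V" "u r \<in> component_space r"
    "v \<in> component_space r \<Longrightarrow> casimir v = smul (of_nat ((n + m - 2 * r)^2 + 2 * (n + m - 2 * r))) v"
    "stable_space T \<Longrightarrow> v \<in> T \<Longrightarrow> v \<in> component_space r \<Longrightarrow> v \<noteq> 0 \<Longrightarrow> component_space r \<subseteq> T"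
proof -
  interpret hw_string P e h \<phi> "u r" "c - of_nat r" "d + of_nat r" "n + m - 2 * r"
    by (rule string[OF assms])
  show "stable_space (component_space r)" "component_space r \<subseteq> V" "u r \<in> component_space r"
    "v \<in> component_space r \<Longrightarrow> casimir v = smul (of_nat ((n + m - 2 * r)^2 + 2 * (n + m - 2 * r))) v"
    "stable_space T \<Longrightarrow> v \<in> T \<Longrightarrow> v \<in> component_space r \<Longrightarrow> v \<noteq> 0 \<Longrightarrow> component_space r \<subseteq> T"
    using Q_stable Q_V Q_b[of 0] casimir_Q[of v] Q_irreducible[of T v]
    unfolding component_space_def by simp_all
qed

lemma component_space_0: "r \<in> R \<Longrightarrow> 0 \<in> component_space r"
  using component_space(1) by (auto dest: stable_spaceD)

lemma component_independent:
  assumes v: "\<And>r. r \<in> R \<Longrightarrow> v r \<in> component_space r" and sum: "(\<Sum>r\<in>R. v r) = 0" and r: "r \<in> R"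
  shows "v r = 0"
proof (rule eigenvector_independent[where T = casimir and v = v, OF casimir_add _ casimir_smul _ _ _ sum r])
  show "finite R" by (simp add: R_def)
  show "casimir 0 = 0" using casimir_smul[of 0 0] by (simp add: smul_simps)
  \<comment> \<open>On \<open>R\<close> the truncated subtraction n + m - 2 r is exact, so distinct
    r give distinct lengths.\<close>
  show "inj_on (\<lambda>r. of_nat ((n + m - 2 * r)^2 + 2 * (n + m - 2 * r)) :: 'k sphere fract) R"
  proof (rule inj_onI)
    fix r s assume rs: "r \<in> R" "s \<in> R"
      "of_nat ((n + m - 2 * r)^2 + 2 * (n + m - 2 * r)) = (of_nat ((n + m - 2 * s)^2 + 2 * (n + m - 2 * s)) :: 'k sphere fract)"
    then have "(n + m - 2 * r)^2 + 2 * (n + m - 2 * r) = (n + m - 2 * s)^2 + 2 * (n + m - 2 * s)"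
      by (simp only: of_nat_eq_iff)
    then have "n + m - 2 * r = n + m - 2 * s" by (rule square_plus_double_inj)
    then show "r = s" using rs(1,2) by (auto simp: R_def)
  qed
  show "casimir (v r) = smul (of_nat ((n + m - 2 * r)^2 + 2 * (n + m - 2 * r))) (v r)" if "r \<in> R" for r
    by (rule component_space(4)[OF that v[OF that]])
qed

lemma component_av_submodule: "r \<in> R \<Longrightarrow> av_submodule (component r) P"
  unfolding component_def by (rule av_submodule_preimage[OF component_space(1)])

lemmas component_a_submodule = a_submoduleD[OF av_submoduleD(1)[OF component_av_submodule]]

lemma kspan_component: "r \<in> R \<Longrightarrow> kspan (component r) = component_space r"
  unfolding component_def by (rule kspan_preimage[OF component_space(1,2)])

lemma component_phi: "p \<in> component r \<Longrightarrow> \<phi> p \<in> component_space r"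
  unfolding component_def by (rule preimage_phi)

text \<open>The sum is formed after \<phi>, in a space of functions; injectivity of \<phi>
  translates it to a sum in P (\<open>finsum_eq_iff_decomposes\<close>).\<close>

definition decomposes where
  "decomposes p g \<longleftrightarrow> (\<forall>r\<in>R. g r \<in> component r) \<and> \<phi> p = (\<Sum>r\<in>R. \<phi> (g r))"

lemma decomposes_unique:
  assumes g: "decomposes p g" "decomposes p g'" and r: "r \<in> R"
  shows "g r = g' r"
proof -
  have "\<phi> (g r) - \<phi> (g' r) = 0"
  proof (rule component_independent[where v = "\<lambda>r. \<phi> (g r) - \<phi> (g' r)", OF _ _ r])
    show "\<phi> (g s) - \<phi> (g' s) \<in> component_space s" if s: "s \<in> R" for s
    proof -
      have "lin_space (component_space s)"
        using component_space(1)[OF s] by (simp add: lin_space_def stable_space_def)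
      then show ?thesis
        using g s component_phi by (intro lin_spaceD(4)) (auto simp: decomposes_def)
    qed
    show "(\<Sum>r\<in>R. \<phi> (g r) - \<phi> (g' r)) = 0"
      using g unfolding sum_subtractf decomposes_def by simp
  qed
  then have "\<phi> (g r) = \<phi> (g' r)" by simp
  moreover have "g r \<in> carrier P" "g' r \<in> carrier P"
    using g r component_a_submodule(1)[OF r] by (auto simp: decomposes_def)
  ultimately show ?thesis using phi_inj by (auto dest: inj_onD)
qed

lemma decomposes_add:
  assumes "decomposes p g" "decomposes p' g'" "p \<in> carrier P" "p' \<in> carrier P"
  shows "decomposes (p \<oplus>\<^bsub>P\<^esub> p') (\<lambda>r. g r \<oplus>\<^bsub>P\<^esub> g' r)"
proof -
  have "\<phi> (g r \<oplus>\<^bsub>P\<^esub> g' r) = \<phi> (g r) + \<phi> (g' r)" if "r \<in> R" for r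
    using assms that component_a_submodule(1)[OF that] by (auto simp: decomposes_def intro!: phi_add)
  then show ?thesis
    using assms by (auto simp: decomposes_def phi_add sum.distrib component_a_submodule(3))
qed

lemma decomposes_smult:
  assumes "decomposes p g" "p \<in> carrier P"
  shows "decomposes (a \<odot>\<^bsub>P\<^esub> p) (\<lambda>r. a \<odot>\<^bsub>P\<^esub> g r)"
proof -
  have "\<phi> (a \<odot>\<^bsub>P\<^esub> g r) = smul (to_fract a) (\<phi> (g r))" if "r \<in> R" for r
    using assms that component_a_submodule(1)[OF that] by (auto simp: decomposes_def intro!: phi_smult)
  then show ?thesis
    using assms by (auto simp: decomposes_def phi_smult smul_sum component_a_submodule(4))
qed

lemma decomposes_lie:
  assumes "decomposes p g" "p \<in> carrier P" "\<eta> \<in> vector_fields"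
  shows "decomposes (lie_act P \<eta> p) (\<lambda>r. lie_act P \<eta> (g r))"
proof -
  have lie0: "chart_lie h \<eta> 0 = 0" using chart_lie_diff[of h \<eta> 0 0] by simp
  have lie_sum: "chart_lie h \<eta> (sum f I) = (\<Sum>i\<in>I. chart_lie h \<eta> (f i))" for f and I :: "nat set"
    by (induction I rule: infinite_finite_induct)
      (simp_all only: lie0 chart_lie_add sum.infinite sum.empty sum.insert simp_thms)
  have "\<phi> (lie_act P \<eta> (g r)) = chart_lie h \<eta> (\<phi> (g r))" if "r \<in> R" for r
    using assms that component_a_submodule(1)[OF that] by (auto simp: decomposes_def intro!: phi_lie)
  then show ?thesis
    using assms by (auto simp: decomposes_def phi_lie lie_sum
        intro: av_submoduleD(2)[OF component_av_submodule])
qed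

lemma decomposes_component:
  assumes r: "r \<in> R" and p: "p \<in> component r"
  shows "decomposes p (\<lambda>s. if s = r then p else \<zero>\<^bsub>P\<^esub>)"
proof -
  have "(\<Sum>s\<in>R. \<phi> (if s = r then p else \<zero>\<^bsub>P\<^esub>)) = (\<Sum>s\<in>R. if s = r then \<phi> p else 0)"
    by (rule sum.cong) auto
  also have "\<dots> = \<phi> p" using r by (simp add: R_def)
  finally show ?thesis using p component_a_submodule(2) by (auto simp: decomposes_def)
qed

lemma V_sum_components: "V \<subseteq> {\<Sum>r\<in>R. f r | f. \<forall>r\<in>R. f r \<in> component_space r}" (is "_ \<subseteq> ?T")
proof (rule V_subset)
  show "lin_space ?T"
    unfolding lin_space_def
  proof (intro conjI ballI allI)
    show "0 \<in> ?T" by (intro CollectI exI[of _ "\<lambda>_. 0"]) (simp add: component_space_0)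
    fix v assume "v \<in> ?T"
    then obtain f where v: "v = (\<Sum>r\<in>R. f r)" "\<forall>r\<in>R. f r \<in> component_space r" by blast
    { fix w assume "w \<in> ?T"
      then obtain g where "w = (\<Sum>r\<in>R. g r)" "\<forall>r\<in>R. g r \<in> component_space r" by blast
      then show "v + w \<in> ?T" using v stable_spaceD(2)[OF component_space(1)]
        by (intro CollectI exI[of _ "\<lambda>r. f r + g r"]) (simp add: sum.distrib) }
    show "smul a v \<in> ?T" for a using v stable_spaceD(3)[OF component_space(1)]
      by (intro CollectI exI[of _ "\<lambda>r. smul a (f r)"]) (simp add: smul_sum)
  qed
  show "lower v \<in> ?T" if v: "v \<in> ?T" for v
  proof -
    obtain f where v: "v = (\<Sum>r\<in>R. f r)" "\<forall>r\<in>R. f r \<in> component_space r" using v by blast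
    then show ?thesis using stable_spaceD(5)[OF component_space(1)]
      by (intro CollectI exI[of _ "\<lambda>r. lower (f r)"]) (simp add: e_sum)
  qed
  show "u r \<in> ?T" if "r \<le> min n m" for r
  proof -
    have r: "r \<in> R" using that by (simp add: R_def)
    have "(\<Sum>s\<in>R. if s = r then u r else 0) = u r" using r by (simp add: R_def)
    then show ?thesis
      by (intro CollectI exI[of _ "\<lambda>s. if s = r then u r else 0"])
        (auto simp: component_space_0 component_space(3))
  qed
qed

text \<open>The elements with a decomposition form a submodule whose span is everything by
  \<open>V_sum_components\<close>, so \<open>submodule_eqI\<close> removes the denominators.\<close>

lemma exists_decomposition:
  assumes "p \<in> carrier P"
  shows "\<exists>g. decomposes p g"
proof -
  let ?S = "{p \<in> carrier P. \<exists>g. decomposes p g}"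
  have S: "av_submodule ?S P"
    unfolding av_submodule_iff a_submodule_def
  proof (intro conjI ballI allI)
    have "decomposes \<zero>\<^bsub>P\<^esub> (\<lambda>_. \<zero>\<^bsub>P\<^esub>)"
      by (auto simp: decomposes_def component_a_submodule(2))
    then show "\<zero>\<^bsub>P\<^esub> \<in> ?S" by auto
  qed (auto intro: decomposes_add decomposes_smult decomposes_lie simp: lie_closed)
  have comp: "component r \<subseteq> ?S" if "r \<in> R" for r
    using decomposes_component[OF that] component_a_submodule(1)[OF that] by blast
  have "?S = carrier P"
  proof (rule submodule_eqI[OF S av_submodule_carrier])
    have "V \<subseteq> kspan ?S"
    proof
      fix v assume "v \<in> V"
      then obtain f where v: "v = (\<Sum>r\<in>R. f r)" and f: "\<forall>r\<in>R. f r \<in> component_space r"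
        using V_sum_components by blast
      show "v \<in> kspan ?S" unfolding v
      proof (rule kspan_sum[OF av_submoduleD(1)[OF S]])
        fix r assume r: "r \<in> R"
        then show "f r \<in> kspan ?S" using f kspan_component kspan_mono[OF comp[OF r]] by blast
      qed
    qed
    then show "\<phi> ` carrier P \<subseteq> kspan ?S" using kspan_phi by blast
  qed (use fg in auto)
  then show ?thesis using assms by blast
qed

definition comp where "comp p = (SOME g. decomposes p g)"

lemma comp: "p \<in> carrier P \<Longrightarrow> decomposes p (comp p)"
  unfolding comp_def by (rule someI_ex[OF exists_decomposition])

text \<open>The component is the image of P under the A-linear projection \<open>comp p r\<close>,
  so the projections of generators generate it.\<close>

lemma component_fg:
  assumes r: "r \<in> R"
  shows "finitely_generated_over_A (P\<lparr>carrier := component r\<rparr>)"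
proof -
  interpret C: av_module "P\<lparr>carrier := component r\<rparr>"
    by (rule restrict_av_module[OF component_av_submodule[OF r]])
  obtain G where G: "G \<subseteq> carrier P" "finite G" "\<And>T. a_submodule T P \<Longrightarrow> G \<subseteq> T \<Longrightarrow> T = carrier P"
    using finitely_generatedD[OF fg] by metis
  have comp_in: "comp p r \<in> component r" if "p \<in> carrier P" for p
    using comp[OF that] r by (simp add: decomposes_def)
  show ?thesis
  proof (rule C.finitely_generatedI)
    show "(\<lambda>p. comp p r) ` G \<subseteq> carrier (P\<lparr>carrier := component r\<rparr>)" using G(1) comp_in by auto
    show "finite ((\<lambda>p. comp p r) ` G)" using G(2) by simp
    fix T assume T: "a_submodule T (P\<lparr>carrier := component r\<rparr>)" "(\<lambda>p. comp p r) ` G \<subseteq> T"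
    note T1 = a_submoduleD[OF T(1), simplified]
    let ?T = "{p \<in> carrier P. comp p r \<in> T}"
    have "a_submodule ?T P"
      unfolding a_submodule_def
    proof (intro conjI ballI allI)
      have "comp \<zero>\<^bsub>P\<^esub> r = \<zero>\<^bsub>P\<^esub>"
        by (rule decomposes_unique[OF comp _ r]) (auto simp: decomposes_def component_a_submodule(2))
      then show "\<zero>\<^bsub>P\<^esub> \<in> ?T" using T1(2) by simp
      fix p assume p: "p \<in> ?T"
      { fix q assume q: "q \<in> ?T"
        have "comp (p \<oplus>\<^bsub>P\<^esub> q) r = comp p r \<oplus>\<^bsub>P\<^esub> comp q r"
          using p q by (intro decomposes_unique[OF comp decomposes_add[OF comp comp] r]) auto
        then show "p \<oplus>\<^bsub>P\<^esub> q \<in> ?T" using p q T1(3) by auto }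
      fix a
      have "comp (a \<odot>\<^bsub>P\<^esub> p) r = a \<odot>\<^bsub>P\<^esub> comp p r"
        using p by (intro decomposes_unique[OF comp decomposes_smult[OF comp] r]) auto
      then show "a \<odot>\<^bsub>P\<^esub> p \<in> ?T" using p T1(4) by auto
    qed auto
    moreover have "G \<subseteq> ?T" using G(1) T(2) by auto
    ultimately have full: "?T = carrier P" by (rule G(3))
    have "component r \<subseteq> T"
    proof
      fix x assume x: "x \<in> component r"
      then have "x \<in> carrier P" by (rule component_a_submodule(1)[OF r])
      then have "comp x r \<in> T" "comp x r = (if r = r then x else \<zero>\<^bsub>P\<^esub>)"
        using full decomposes_unique[OF comp decomposes_component[OF r x] r] by blast+
      then show "x \<in> T" by simp
    qed
    then show "T = carrier (P\<lparr>carrier := component r\<rparr>)" using T(1) by (auto simp: a_submodule_def)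
  qed
qed

text \<open>A nonzero submodule spans a nonzero stable subspace of an irreducible string, hence all
  of it; \<open>submodule_eqI\<close> then gives equality over A.\<close>

lemma component_simple:
  assumes r: "r \<in> R"
  shows "av_simple (P\<lparr>carrier := component r\<rparr>)"
  unfolding av_simple_def
proof (intro conjI allI impI)
  note C = component_av_submodule[OF r]
  show "av_module (P\<lparr>carrier := component r\<rparr>)" by (rule restrict_av_module[OF C])
  have "component r \<noteq> {\<zero>\<^bsub>P\<^esub>}"
  proof
    assume "component r = {\<zero>\<^bsub>P\<^esub>}"
    then have "u r \<in> kspan {\<zero>\<^bsub>P\<^esub>}" using kspan_component[OF r] component_space(3)[OF r] by simp
    then obtain a where "a \<noteq> 0" "smul (to_fract a) (u r) = 0" unfolding kspan_def by auto
    then have "u r = 0" by (simp only: smul_eq_0_iff to_fract_eq_0_iff simp_thms)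
    then show False using u_nonzero[of r] r by (simp add: R_def)
  qed
  then show "carrier (P\<lparr>carrier := component r\<rparr>) \<noteq> {\<zero>\<^bsub>P\<lparr>carrier := component r\<rparr>\<^esub>}" by simp
  fix S assume "av_submodule S (P\<lparr>carrier := component r\<rparr>)"
  then have S: "av_submodule S P" "S \<subseteq> component r" using restrict_av_submodule[OF C] by blast+
  note S1 = a_submoduleD[OF av_submoduleD(1)[OF S(1)]]
  have "S = component r" if ne: "S \<noteq> {\<zero>\<^bsub>P\<^esub>}"
  proof (rule submodule_eqI[OF S(1) C S(2) component_fg[OF r]])
    obtain s where s: "s \<in> S" "s \<noteq> \<zero>\<^bsub>P\<^esub>" using ne S1(2) by auto
    have "component_space r \<subseteq> kspan S"
    proof (rule component_space(5)[OF r stable_space_kspan[OF S(1)] kspan_phi[OF s(1)]])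
      show "\<phi> s \<in> component_space r" using s S(2) component_phi by blast
      show "\<phi> s \<noteq> 0" using s S1(1) phi_eq_0 by blast
    qed
    then show "\<phi> ` component r \<subseteq> kspan S" using component_phi by blast
  qed
  then show "S = {\<zero>\<^bsub>P\<lparr>carrier := component r\<rparr>\<^esub>} \<or> S = carrier (P\<lparr>carrier := component r\<rparr>)" by auto
qed

text \<open>\<open>is_direct_sum\<close> is indexed by the set of summands, so two indices with the
  same component would be merged. For such indices, \<open>u r\<close> in one component and its
  negative in the other would be a nontrivial relation.\<close>

lemma component_inj: "inj_on component R"
proof (rule inj_onI)
  fix r s assume rs: "r \<in> R" "s \<in> R" "component r = component s"
  show "r = s"
  proof (rule ccontr)
    assume ne: "r \<noteq> s"
    have us: "u r \<in> component_space s"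
      using rs kspan_component component_space(3)[OF rs(1)] by metis
    let ?v = "\<lambda>q. if q = r then u r else if q = s then smul (-1) (u r) else 0"
    have "?v r = 0"
    proof (rule component_independent[where v = ?v, OF _ _ rs(1)])
      show "?v q \<in> component_space q" if "q \<in> R" for q
        using that us component_space(3) component_space_0 stable_spaceD(3)[OF component_space(1)] by auto
      have "(\<Sum>q\<in>R. ?v q) = (\<Sum>q\<in>R. (if q = r then u r else 0) + (if q = s then smul (-1) (u r) else 0))"
        using ne by (intro sum.cong) auto
      also have "\<dots> = u r + smul (-1) (u r)"
        using rs unfolding sum.distrib by (simp add: R_def)
      also have "\<dots> = 0" by (simp add: smul_simps)
      finally show "(\<Sum>q\<in>R. ?v q) = 0" .
    qed
    then show False using u_nonzero[of r] rs(1) by (simp add: R_def)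
  qed
qed

lemma finsum_eq_iff_decomposes:
  assumes f: "f \<in> (\<Pi>\<^sub>E S\<in>component ` R. S)" and p: "p \<in> carrier P"
  shows "p = (\<Oplus>\<^bsub>P\<^esub>S\<in>{S \<in> component ` R. f S \<noteq> \<zero>\<^bsub>P\<^esub>}. f S) \<longleftrightarrow> decomposes p (\<lambda>r. f (component r))"
proof -
  let ?I = "{S \<in> component ` R. f S \<noteq> \<zero>\<^bsub>P\<^esub>}"
  have fR: "f (component r) \<in> component r" if "r \<in> R" for r using f that by auto
  have fI: "f \<in> ?I \<rightarrow> carrier P"
    using fR component_a_submodule(1) by auto
  have "\<phi> (\<Oplus>\<^bsub>P\<^esub>S\<in>?I. f S) = (\<Sum>S\<in>?I. \<phi> (f S))" by (rule phi_finsum[OF fI])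
  also have "\<dots> = (\<Sum>S\<in>component ` R. \<phi> (f S))"
    by (rule sum.mono_neutral_left) (auto simp: R_def)
  also have "\<dots> = (\<Sum>r\<in>R. \<phi> (f (component r)))"
    unfolding sum.reindex[OF component_inj] by simp
  finally have eq: "\<phi> (\<Oplus>\<^bsub>P\<^esub>S\<in>?I. f S) = (\<Sum>r\<in>R. \<phi> (f (component r)))" .
  have cl: "(\<Oplus>\<^bsub>P\<^esub>S\<in>?I. f S) \<in> carrier P" by (rule M.finsum_closed[OF fI])
  have "p = (\<Oplus>\<^bsub>P\<^esub>S\<in>?I. f S) \<longleftrightarrow> \<phi> p = \<phi> (\<Oplus>\<^bsub>P\<^esub>S\<in>?I. f S)"
    using phi_inj p cl by (auto dest: inj_onD)
  then show ?thesis using fR by (simp add: eq decomposes_def)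
qed

lemma direct_sum_components: "is_direct_sum P (component ` R)"
  unfolding is_direct_sum_def
proof (intro conjI ballI)
  fix S assume "S \<in> component ` R"
  then show "av_submodule S P" using component_av_submodule by auto
next
  fix p assume p: "p \<in> carrier P"
  let ?P = "\<lambda>f. f \<in> (\<Pi>\<^sub>E S\<in>component ` R. S) \<and> finite {S \<in> component ` R. f S \<noteq> \<zero>\<^bsub>P\<^esub>} \<and>
      p = (\<Oplus>\<^bsub>P\<^esub>S\<in>{S \<in> component ` R. f S \<noteq> \<zero>\<^bsub>P\<^esub>}. f S)"
  define f where "f = restrict (\<lambda>S. comp p (inv_into R component S)) (component ` R)"
  have fc: "f (component r) = comp p r" if "r \<in> R" for r
    using that by (simp add: f_def inv_into_f_f[OF component_inj])
  have fE: "f \<in> (\<Pi>\<^sub>E S\<in>component ` R. S)"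
    using fc comp[OF p] by (auto simp: f_def PiE_def extensional_def decomposes_def)
  have "decomposes p (\<lambda>r. f (component r))"
    using comp[OF p] fc by (simp add: decomposes_def)
  then have "?P f" using fE finsum_eq_iff_decomposes[OF fE p] by (simp add: R_def)
  moreover have "g = f" if "?P g" for g
  proof (rule PiE_ext[of g _ "\<lambda>S. S" f])
    show "g \<in> (\<Pi>\<^sub>E S\<in>component ` R. S)" using that by blast
    have dg: "decomposes p (\<lambda>r. g (component r))"
      using finsum_eq_iff_decomposes[of g p] that p by blast
    fix S assume "S \<in> component ` R"
    then obtain r where r: "r \<in> R" "S = component r" by blast
    then show "g S = f S"
      using decomposes_unique[OF dg \<open>decomposes p (\<lambda>r. f (component r))\<close> r(1)] by simp
  qed (rule fE)
  ultimately show "\<exists>!f. ?P f" by (rule ex1I)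
qed

end

section \<open>Tensor products are modules over functions and vector fields\<close>

locale av_pair = M: av_module M + N: av_module N
  for M :: "('k::field_char_0 sphere, 'm) av_structure" and N :: "('k sphere, 'n) av_structure"
begin

abbreviation "P \<equiv> av_tensor M N"
abbreviation "Rel \<equiv> tensor_relations M N"
abbreviation "C \<equiv> carrier M \<times> carrier N"

definition equiv_frag :: "('m \<times> 'n \<Rightarrow>\<^sub>0 int) \<Rightarrow> ('m \<times> 'n \<Rightarrow>\<^sub>0 int) \<Rightarrow> bool" (infix \<open>\<approx>\<close> 50) where
  "u \<approx> v \<longleftrightarrow> u - v \<in> Rel"

lemma Rel_minus: "u \<in> Rel \<Longrightarrow> - u \<in> Rel"
  using tensor_relations.diff[OF tensor_relations.zero] by fastforce

lemma Rel_add: "u \<in> Rel \<Longrightarrow> v \<in> Rel \<Longrightarrow> u + v \<in> Rel"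
  using tensor_relations.diff[OF _ Rel_minus] by fastforce

lemma equiv_refl [simp]: "u \<approx> u"
  by (simp add: equiv_frag_def tensor_relations.zero)

lemma equiv_sym: "u \<approx> v \<Longrightarrow> v \<approx> u"
  unfolding equiv_frag_def using Rel_minus[of "u - v"] by simp

lemma equiv_trans [trans]: "u \<approx> v \<Longrightarrow> v \<approx> w \<Longrightarrow> u \<approx> w"
  unfolding equiv_frag_def using Rel_add[of "u - v" "v - w"] by simp

lemma equiv_add: "u \<approx> v \<Longrightarrow> u' \<approx> v' \<Longrightarrow> u + u' \<approx> v + v'"
  unfolding equiv_frag_def using Rel_add[of "u - v" "u' - v'"] by (simp add: algebra_simps)

lemma equiv_diff: "u \<approx> v \<Longrightarrow> u' \<approx> v' \<Longrightarrow> u - u' \<approx> v - v'"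
  unfolding equiv_frag_def using tensor_relations.diff[of "u - v" M N "u' - v'"] by (simp add: algebra_simps)

lemma equiv_add_left:
  "m \<in> carrier M \<Longrightarrow> m' \<in> carrier M \<Longrightarrow> n \<in> carrier N \<Longrightarrow>
    frag_of (m \<oplus>\<^bsub>M\<^esub> m', n) \<approx> frag_of (m, n) + frag_of (m', n)"
  using tensor_relations.add_left[of m M m' n N] by (simp add: equiv_frag_def algebra_simps)

lemma equiv_add_right:
  "m \<in> carrier M \<Longrightarrow> n \<in> carrier N \<Longrightarrow> n' \<in> carrier N \<Longrightarrow>
    frag_of (m, n \<oplus>\<^bsub>N\<^esub> n') \<approx> frag_of (m, n) + frag_of (m, n')"
  using tensor_relations.add_right[of m M n N n'] by (simp add: equiv_frag_def algebra_simps)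

lemma equiv_balanced:
  "m \<in> carrier M \<Longrightarrow> n \<in> carrier N \<Longrightarrow> frag_of (a \<odot>\<^bsub>M\<^esub> m, n) \<approx> frag_of (m, a \<odot>\<^bsub>N\<^esub> n)"
  using tensor_relations.balanced[of m M n N a] by (simp add: equiv_frag_def)

lemma equiv_diff_left:
  assumes "m \<in> carrier M" "m' \<in> carrier M" "n \<in> carrier N"
  shows "frag_of (m \<ominus>\<^bsub>M\<^esub> m', n) \<approx> frag_of (m, n) - frag_of (m', n)"
proof -
  have "m = (m \<ominus>\<^bsub>M\<^esub> m') \<oplus>\<^bsub>M\<^esub> m'" using assms by (simp add: M.M.minus_eq M.M.a_assoc M.M.l_neg)
  then have "frag_of (m, n) \<approx> frag_of (m \<ominus>\<^bsub>M\<^esub> m', n) + frag_of (m', n)"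
    using equiv_add_left[of "m \<ominus>\<^bsub>M\<^esub> m'" m' n] assms by simp
  from equiv_diff[OF this, of "frag_of (m', n)" "frag_of (m', n)"] show ?thesis
    by (simp add: equiv_sym)
qed

lemma equiv_diff_right:
  assumes "m \<in> carrier M" "n \<in> carrier N" "n' \<in> carrier N"
  shows "frag_of (m, n \<ominus>\<^bsub>N\<^esub> n') \<approx> frag_of (m, n) - frag_of (m, n')"
proof -
  have "n = (n \<ominus>\<^bsub>N\<^esub> n') \<oplus>\<^bsub>N\<^esub> n'" using assms by (simp add: N.M.minus_eq N.M.a_assoc N.M.l_neg)
  then have "frag_of (m, n) \<approx> frag_of (m, n \<ominus>\<^bsub>N\<^esub> n') + frag_of (m, n')"
    using equiv_add_right[of m "n \<ominus>\<^bsub>N\<^esub> n'" n'] assms by simp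
  from equiv_diff[OF this, of "frag_of (m, n')" "frag_of (m, n')"] show ?thesis
    by (simp add: equiv_sym)
qed

abbreviation cls :: "('m \<times> 'n \<Rightarrow>\<^sub>0 int) \<Rightarrow> ('m \<times> 'n \<Rightarrow>\<^sub>0 int) set" where
  "cls \<equiv> tensor_class M N"

lemma mem_cls: "v \<in> cls u \<longleftrightarrow> v \<approx> u"
  unfolding tensor_class_def equiv_frag_def
  by (auto intro!: exI[of _ "v - u"])

lemma cls_eq_iff: "cls u = cls v \<longleftrightarrow> u \<approx> v"
  using mem_cls equiv_refl equiv_sym equiv_trans by (metis subsetI subset_antisym)

definition act_frag where
  "act_frag a = frag_extend (\<lambda>(m, n). frag_of (a \<odot>\<^bsub>M\<^esub> m, n))"

definition lie_frag where
  "lie_frag \<eta> = frag_extend (\<lambda>(m, n). frag_of (lie_act M \<eta> m, n) + frag_of (m, lie_act N \<eta> n))"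

lemma act_frag_simps [simp]:
  "act_frag a 0 = 0" "act_frag a (u - v) = act_frag a u - act_frag a v"
  "act_frag a (u + v) = act_frag a u + act_frag a v" "act_frag a (frag_of (m, n)) = frag_of (a \<odot>\<^bsub>M\<^esub> m, n)"
  by (simp_all add: act_frag_def frag_extend_diff frag_extend_add)

lemma lie_frag_simps [simp]:
  "lie_frag \<eta> 0 = 0" "lie_frag \<eta> (u - v) = lie_frag \<eta> u - lie_frag \<eta> v"
  "lie_frag \<eta> (u + v) = lie_frag \<eta> u + lie_frag \<eta> v"
  "lie_frag \<eta> (frag_of (m, n)) = frag_of (lie_act M \<eta> m, n) + frag_of (m, lie_act N \<eta> n)"
  by (simp_all add: lie_frag_def frag_extend_diff frag_extend_add)

text \<open>The module axioms for the tensor product are congruences between additive maps on the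
  free group; this leaves them to be checked on pure tensors.\<close>

lemma equiv_induct:
  assumes u: "Poly_Mapping.keys u \<subseteq> C"
    and F: "F 0 = 0" "\<And>u v. F (u - v) = F u - F v" and G: "G 0 = 0" "\<And>u v. G (u - v) = G u - G v"
    and gen: "\<And>m n. m \<in> carrier M \<Longrightarrow> n \<in> carrier N \<Longrightarrow> F (frag_of (m, n)) \<approx> G (frag_of (m, n))"
  shows "F u \<approx> G u"
  using u
  by (induction rule: frag_induction) (auto simp: F G gen intro: equiv_diff)

lemma act_frag_Rel: "u \<in> Rel \<Longrightarrow> act_frag a u \<in> Rel"
proof (induction rule: tensor_relations.induct)
  case (diff u v)
  then show ?case by (simp add: tensor_relations.diff)
next
  case (add_left m m' n)
  then show ?case
    using tensor_relations.add_left[of "a \<odot>\<^bsub>M\<^esub> m" M "a \<odot>\<^bsub>M\<^esub> m'" n N] by (simp add: M.smult_distrib)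
next
  case (add_right m n n')
  then show ?case
    using tensor_relations.add_right[of "a \<odot>\<^bsub>M\<^esub> m" M n N n'] by simp
next
  case (balanced m n b)
  then show ?case
    using tensor_relations.balanced[of "a \<odot>\<^bsub>M\<^esub> m" M n N b]
    by (simp add: M.smult_mult[symmetric] mult.commute)
qed (simp add: tensor_relations.zero)

lemma lie_frag_Rel:
  assumes \<eta>: "\<eta> \<in> vector_fields"
  shows "u \<in> Rel \<Longrightarrow> lie_frag \<eta> u \<in> Rel"
proof (induction rule: tensor_relations.induct)
  case (diff u v)
  then show ?case by (simp add: tensor_relations.diff)
next
  case (add_left m m' n)
  note c = M.lie_closed[OF \<eta> add_left(1)] M.lie_closed[OF \<eta> add_left(2)] N.lie_closed[OF \<eta> add_left(3)]
  show ?case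
    using Rel_add[OF tensor_relations.add_left[OF c(1,2) add_left(3)] tensor_relations.add_left[OF add_left(1,2) c(3)]]
    by (simp add: M.lie_add_right[OF \<eta> add_left(1,2)] algebra_simps)
next
  case (add_right m n n')
  note c = M.lie_closed[OF \<eta> add_right(1)] N.lie_closed[OF \<eta> add_right(2)] N.lie_closed[OF \<eta> add_right(3)]
  show ?case
    using Rel_add[OF tensor_relations.add_right[OF c(1) add_right(2,3)] tensor_relations.add_right[OF add_right(1) c(2,3)]]
    by (simp add: N.lie_add_right[OF \<eta> add_right(2,3)] algebra_simps)
next
  case (balanced m n a)
  note c = M.lie_closed[OF \<eta> balanced(1)] N.lie_closed[OF \<eta> balanced(2)]
  \<comment> \<open>Leibniz rule in M, then all scalars moved across the tensor sign, then the
    Leibniz rule in N.\<close>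
  have "lie_frag \<eta> (frag_of (a \<odot>\<^bsub>M\<^esub> m, n)) \<approx>
      (frag_of (\<eta> a \<odot>\<^bsub>M\<^esub> m, n) + frag_of (a \<odot>\<^bsub>M\<^esub> lie_act M \<eta> m, n)) + frag_of (a \<odot>\<^bsub>M\<^esub> m, lie_act N \<eta> n)"
    using balanced c by (auto simp: M.lie_leibniz[OF \<eta>] intro!: equiv_add equiv_add_left)
  also have "\<dots> \<approx> (frag_of (m, \<eta> a \<odot>\<^bsub>N\<^esub> n) + frag_of (lie_act M \<eta> m, a \<odot>\<^bsub>N\<^esub> n)) + frag_of (m, a \<odot>\<^bsub>N\<^esub> lie_act N \<eta> n)"
    using balanced c by (intro equiv_add equiv_balanced)
  also have "\<dots> = frag_of (lie_act M \<eta> m, a \<odot>\<^bsub>N\<^esub> n) + (frag_of (m, \<eta> a \<odot>\<^bsub>N\<^esub> n) + frag_of (m, a \<odot>\<^bsub>N\<^esub> lie_act N \<eta> n))"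
    by (simp add: algebra_simps)
  also have "\<dots> \<approx> lie_frag \<eta> (frag_of (m, a \<odot>\<^bsub>N\<^esub> n))"
    using balanced c by (auto simp: N.lie_leibniz[OF \<eta>] intro!: equiv_add equiv_sym[OF equiv_add_right])
  finally show ?case by (simp only: equiv_frag_def lie_frag_simps(2))
qed (simp add: tensor_relations.zero)

lemma UN_cls:
  assumes "\<And>v. v \<approx> u \<Longrightarrow> F v \<approx> F u"
  shows "(\<Union>v\<in>cls u. cls (F v)) = cls (F u)"
proof -
  have "cls (F v) = cls (F u)" if "v \<in> cls u" for v
    using that assms by (simp add: mem_cls cls_eq_iff)
  moreover have "u \<in> cls u" by (simp add: mem_cls)
  ultimately show ?thesis by blast
qed

lemma tensor_simps:
  "carrier P = {cls u | u. Poly_Mapping.keys u \<subseteq> C}" "\<zero>\<^bsub>P\<^esub> = cls 0"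
  "cls u \<oplus>\<^bsub>P\<^esub> cls v = cls (u + v)" "a \<odot>\<^bsub>P\<^esub> cls u = cls (act_frag a u)"
  "\<eta> \<in> vector_fields \<Longrightarrow> lie_act P \<eta> (cls u) = cls (lie_frag \<eta> u)"
proof -
  show "carrier P = {cls u | u. Poly_Mapping.keys u \<subseteq> C}" "\<zero>\<^bsub>P\<^esub> = cls 0" by (simp_all add: av_tensor_def)
  have "cls u \<oplus>\<^bsub>P\<^esub> cls v = (\<Union>u'\<in>cls u. \<Union>v'\<in>cls v. cls (u' + v'))" by (simp add: av_tensor_def)
  also have "\<dots> = (\<Union>u'\<in>cls u. cls (u' + v))"
    by (intro SUP_cong refl UN_cls equiv_add) simp_all
  also have "\<dots> = cls (u + v)" by (intro UN_cls equiv_add) simp_all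
  finally show "cls u \<oplus>\<^bsub>P\<^esub> cls v = cls (u + v)" .
  have "a \<odot>\<^bsub>P\<^esub> cls u = (\<Union>u'\<in>cls u. cls (act_frag a u'))" by (simp add: av_tensor_def act_frag_def)
  also have "\<dots> = cls (act_frag a u)"
    by (rule UN_cls) (use act_frag_Rel in \<open>fastforce simp: equiv_frag_def\<close>)
  finally show "a \<odot>\<^bsub>P\<^esub> cls u = cls (act_frag a u)" .
  assume \<eta>: "\<eta> \<in> vector_fields"
  have "lie_act P \<eta> (cls u) = (\<Union>u'\<in>cls u. cls (lie_frag \<eta> u'))" by (simp add: av_tensor_def lie_frag_def)
  also have "\<dots> = cls (lie_frag \<eta> u)"
    by (rule UN_cls) (use lie_frag_Rel[OF \<eta>] in \<open>fastforce simp: equiv_frag_def\<close>)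
  finally show "lie_act P \<eta> (cls u) = cls (lie_frag \<eta> u)" .
qed

lemma act_frag_keys:
  "Poly_Mapping.keys u \<subseteq> C \<Longrightarrow> Poly_Mapping.keys (act_frag a u) \<subseteq> C"
  unfolding act_frag_def using keys_frag_extend[of "\<lambda>(m, n). frag_of (a \<odot>\<^bsub>M\<^esub> m, n)" u]
  by (fastforce simp: keys_frag_of)

lemma lie_frag_keys:
  assumes \<eta>: "\<eta> \<in> vector_fields" and u: "Poly_Mapping.keys u \<subseteq> C"
  shows "Poly_Mapping.keys (lie_frag \<eta> u) \<subseteq> C"
proof -
  have keys: "Poly_Mapping.keys (frag_of (lie_act M \<eta> m, n) + frag_of (m, lie_act N \<eta> n)) \<subseteq> C"
    if "(m, n) \<in> C" for m n
    using that keys_add[of "frag_of (lie_act M \<eta> m, n)" "frag_of (m, lie_act N \<eta> n)"]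
    by (auto simp: keys_frag_of M.lie_closed[OF \<eta>] N.lie_closed[OF \<eta>])
  show ?thesis
    unfolding lie_frag_def
  proof (rule order_trans[OF keys_frag_extend UN_least])
    fix p assume "p \<in> Poly_Mapping.keys u"
    then have "(fst p, snd p) \<in> C" using u by auto
    from keys[OF this]
    show "Poly_Mapping.keys (case p of (m, n) \<Rightarrow> frag_of (lie_act M \<eta> m, n) + frag_of (m, lie_act N \<eta> n)) \<subseteq> C"
      by (simp add: case_prod_beta)
  qed
qed

lemma carrierE:
  assumes "x \<in> carrier P"
  obtains u where "x = cls u" "Poly_Mapping.keys u \<subseteq> C"
  using assms unfolding tensor_simps(1) by blast

lemma cls_carrier: "Poly_Mapping.keys u \<subseteq> C \<Longrightarrow> cls u \<in> carrier P"
  unfolding tensor_simps(1) by blast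

lemma keys_add_C: "Poly_Mapping.keys u \<subseteq> C \<Longrightarrow> Poly_Mapping.keys v \<subseteq> C \<Longrightarrow> Poly_Mapping.keys (u + v) \<subseteq> C"
  using keys_add[of u v] by blast

lemma tensor_abelian_group: "abelian_group P"
proof (rule abelian_groupI)
  show "\<zero>\<^bsub>P\<^esub> \<in> carrier P" unfolding tensor_simps(2) by (rule cls_carrier) simp
  fix x assume "x \<in> carrier P"
  then obtain u where u: "x = cls u" "Poly_Mapping.keys u \<subseteq> C" by (rule carrierE)
  show "\<zero>\<^bsub>P\<^esub> \<oplus>\<^bsub>P\<^esub> x = x" unfolding u(1) tensor_simps by simp
  show "\<exists>y\<in>carrier P. y \<oplus>\<^bsub>P\<^esub> x = \<zero>\<^bsub>P\<^esub>"
    by (rule bexI[of _ "cls (- u)"]) (simp_all add: u tensor_simps(2,3) cls_carrier)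
  fix y assume "y \<in> carrier P"
  then obtain v where v: "y = cls v" "Poly_Mapping.keys v \<subseteq> C" by (rule carrierE)
  show "x \<oplus>\<^bsub>P\<^esub> y \<in> carrier P" unfolding u(1) v(1) tensor_simps(3)
    by (intro cls_carrier keys_add_C u v)
  show "x \<oplus>\<^bsub>P\<^esub> y = y \<oplus>\<^bsub>P\<^esub> x" unfolding u(1) v(1) tensor_simps(3) by (simp add: add.commute)
  fix z assume "z \<in> carrier P"
  then obtain w where w: "z = cls w" "Poly_Mapping.keys w \<subseteq> C" by (rule carrierE)
  show "x \<oplus>\<^bsub>P\<^esub> y \<oplus>\<^bsub>P\<^esub> z = x \<oplus>\<^bsub>P\<^esub> (y \<oplus>\<^bsub>P\<^esub> z)"
    unfolding u(1) v(1) w(1) tensor_simps(3) by (simp add: add.assoc)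
qed

lemma tensor_module: "module sphere_ring P"
proof (rule moduleI[OF cring_from_type_algebra tensor_abelian_group])
  fix a b :: "'k sphere" and x assume "x \<in> carrier P"
  then obtain u where u: "x = cls u" "Poly_Mapping.keys u \<subseteq> C" by (rule carrierE)
  show "a \<odot>\<^bsub>P\<^esub> x \<in> carrier P" unfolding u(1) tensor_simps(4) by (intro cls_carrier act_frag_keys u)
  have "act_frag (a + b) u \<approx> act_frag a u + act_frag b u"
    by (rule equiv_induct[OF u(2)]) (auto simp: M.smult_add intro: equiv_add_left)
  then show "(a \<oplus>\<^bsub>sphere_ring\<^esub> b) \<odot>\<^bsub>P\<^esub> x = a \<odot>\<^bsub>P\<^esub> x \<oplus>\<^bsub>P\<^esub> b \<odot>\<^bsub>P\<^esub> x"
    unfolding u(1) tensor_simps(3,4) cls_eq_iff by simp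
  have "act_frag (a * b) u \<approx> act_frag a (act_frag b u)"
    by (rule equiv_induct[OF u(2)]) (auto simp: M.smult_mult)
  then show "(a \<otimes>\<^bsub>sphere_ring\<^esub> b) \<odot>\<^bsub>P\<^esub> x = a \<odot>\<^bsub>P\<^esub> (b \<odot>\<^bsub>P\<^esub> x)"
    unfolding u(1) tensor_simps(4) cls_eq_iff by simp
  have "act_frag 1 u \<approx> u"
    by (rule equiv_induct[OF u(2)]) auto
  then show "\<one>\<^bsub>sphere_ring\<^esub> \<odot>\<^bsub>P\<^esub> x = x"
    unfolding u(1) tensor_simps(4) cls_eq_iff by simp
  fix y assume "y \<in> carrier P"
  then obtain v where v: "y = cls v" "Poly_Mapping.keys v \<subseteq> C" by (rule carrierE)
  show "a \<odot>\<^bsub>P\<^esub> (x \<oplus>\<^bsub>P\<^esub> y) = a \<odot>\<^bsub>P\<^esub> x \<oplus>\<^bsub>P\<^esub> a \<odot>\<^bsub>P\<^esub> y"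
    unfolding u(1) v(1) tensor_simps(3,4) by simp
qed

lemma tensor_av_module: "av_module P"
proof -
  interpret P: module sphere_ring P by (rule tensor_module)
  interpret P: sphere_module P ..
  have minus: "cls u \<ominus>\<^bsub>P\<^esub> cls v = cls (u - v)" if "Poly_Mapping.keys v \<subseteq> C" for u v
  proof -
    have "\<ominus>\<^bsub>P\<^esub> cls v = cls (- v)"
      by (rule P.M.minus_equality) (use that in \<open>simp_all add: tensor_simps(2,3) cls_carrier\<close>)
    then show ?thesis unfolding a_minus_def by (simp add: tensor_simps(3))
  qed
  show ?thesis
  proof unfold_locales
    fix \<eta> :: "'k sphere \<Rightarrow> 'k sphere" and x c a
    assume \<eta>: "\<eta> \<in> vector_fields" and "x \<in> carrier P"
    then obtain u where u: "x = cls u" "Poly_Mapping.keys u \<subseteq> C" by (elim carrierE)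
    note t = tensor_simps(3,4) tensor_simps(5)[OF \<eta>]
    show "lie_act P \<eta> x \<in> carrier P" unfolding u(1) t by (intro cls_carrier lie_frag_keys \<eta> u)
    have "lie_frag \<eta> (act_frag (sphere_const c) u) \<approx> act_frag (sphere_const c) (lie_frag \<eta> u)"
      by (rule equiv_induct[OF u(2)]) (auto simp: M.lie_scale_right[OF \<eta>])
    then show "lie_act P \<eta> (sphere_const c \<odot>\<^bsub>P\<^esub> x) = sphere_const c \<odot>\<^bsub>P\<^esub> lie_act P \<eta> x"
      unfolding u(1) t cls_eq_iff .
    have c\<eta>: "(\<lambda>a. sphere_const c * \<eta> a) \<in> vector_fields" by (rule vector_fields_mult[OF \<eta>])
    have "lie_frag (\<lambda>a. sphere_const c * \<eta> a) u \<approx> act_frag (sphere_const c) (lie_frag \<eta> u)"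
    proof (rule equiv_induct[OF u(2)])
      fix m n assume mn: "m \<in> carrier M" "n \<in> carrier N"
      show "lie_frag (\<lambda>a. sphere_const c * \<eta> a) (frag_of (m, n)) \<approx>
          act_frag (sphere_const c) (lie_frag \<eta> (frag_of (m, n)))"
        unfolding lie_frag_simps act_frag_simps M.lie_scale_left[OF \<eta> mn(1)] N.lie_scale_left[OF \<eta> mn(2)]
        by (intro equiv_add equiv_refl equiv_sym[OF equiv_balanced] mn N.lie_closed \<eta>)
    qed simp_all
    then show "lie_act P (\<lambda>a. sphere_const c * \<eta> a) x = sphere_const c \<odot>\<^bsub>P\<^esub> lie_act P \<eta> x"
      unfolding u(1) t tensor_simps(5)[OF c\<eta>] cls_eq_iff .
    have "lie_frag \<eta> (act_frag a u) \<approx> act_frag (\<eta> a) u + act_frag a (lie_frag \<eta> u)"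
    proof (rule equiv_induct[OF u(2)])
      fix m n assume mn: "m \<in> carrier M" "n \<in> carrier N"
      show "lie_frag \<eta> (act_frag a (frag_of (m, n))) \<approx>
          act_frag (\<eta> a) (frag_of (m, n)) + act_frag a (lie_frag \<eta> (frag_of (m, n)))"
        unfolding lie_frag_simps act_frag_simps M.lie_leibniz[OF \<eta> mn(1)] add.assoc[symmetric]
        by (intro equiv_add equiv_refl equiv_add_left mn M.smult_in M.lie_closed \<eta>)
    qed (simp_all add: algebra_simps)
    then show "lie_act P \<eta> (a \<odot>\<^bsub>P\<^esub> x) = \<eta> a \<odot>\<^bsub>P\<^esub> x \<oplus>\<^bsub>P\<^esub> a \<odot>\<^bsub>P\<^esub> lie_act P \<eta> x"
      unfolding u(1) t cls_eq_iff .
    { fix y assume "y \<in> carrier P"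
      then obtain v where v: "y = cls v" "Poly_Mapping.keys v \<subseteq> C" by (rule carrierE)
      show "lie_act P \<eta> (x \<oplus>\<^bsub>P\<^esub> y) = lie_act P \<eta> x \<oplus>\<^bsub>P\<^esub> lie_act P \<eta> y"
        unfolding u(1) v(1) t by simp }
    fix \<mu> :: "'k sphere \<Rightarrow> 'k sphere" assume \<mu>: "\<mu> \<in> vector_fields"
    note t' = t tensor_simps(5)[OF \<mu>]
    have "lie_frag (\<lambda>a. \<eta> a + \<mu> a) u \<approx> lie_frag \<eta> u + lie_frag \<mu> u"
    proof (rule equiv_induct[OF u(2)])
      fix m n assume mn: "m \<in> carrier M" "n \<in> carrier N"
      have "lie_frag (\<lambda>a. \<eta> a + \<mu> a) (frag_of (m, n)) \<approx>
          (frag_of (lie_act M \<eta> m, n) + frag_of (lie_act M \<mu> m, n)) +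
          (frag_of (m, lie_act N \<eta> n) + frag_of (m, lie_act N \<mu> n))"
        unfolding lie_frag_simps M.lie_add_left[OF \<eta> \<mu> mn(1)] N.lie_add_left[OF \<eta> \<mu> mn(2)]
        by (intro equiv_add equiv_add_left equiv_add_right mn M.lie_closed N.lie_closed \<eta> \<mu>)
      then show "lie_frag (\<lambda>a. \<eta> a + \<mu> a) (frag_of (m, n)) \<approx>
          lie_frag \<eta> (frag_of (m, n)) + lie_frag \<mu> (frag_of (m, n))"
        by (simp add: algebra_simps)
    qed simp_all
    then show "lie_act P (\<lambda>a. \<eta> a + \<mu> a) x = lie_act P \<eta> x \<oplus>\<^bsub>P\<^esub> lie_act P \<mu> x"
      unfolding u(1) t' tensor_simps(5)[OF vector_fields_add[OF \<eta> \<mu>]] cls_eq_iff .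
    have "lie_frag (\<lambda>a. \<eta> (\<mu> a) - \<mu> (\<eta> a)) u \<approx> lie_frag \<eta> (lie_frag \<mu> u) - lie_frag \<mu> (lie_frag \<eta> u)"
    proof (rule equiv_induct[OF u(2)])
      fix m n assume mn: "m \<in> carrier M" "n \<in> carrier N"
      note cM = M.lie_closed[OF \<eta> mn(1)] M.lie_closed[OF \<mu> mn(1)]
      note cN = N.lie_closed[OF \<eta> mn(2)] N.lie_closed[OF \<mu> mn(2)]
      have "lie_frag (\<lambda>a. \<eta> (\<mu> a) - \<mu> (\<eta> a)) (frag_of (m, n)) \<approx>
          (frag_of (lie_act M \<eta> (lie_act M \<mu> m), n) - frag_of (lie_act M \<mu> (lie_act M \<eta> m), n)) +
          (frag_of (m, lie_act N \<eta> (lie_act N \<mu> n)) - frag_of (m, lie_act N \<mu> (lie_act N \<eta> n)))"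
        unfolding lie_frag_simps M.lie_bracket[OF \<eta> \<mu> mn(1)] N.lie_bracket[OF \<eta> \<mu> mn(2)]
        by (intro equiv_add equiv_diff_left equiv_diff_right mn M.lie_closed N.lie_closed \<eta> \<mu>)
      then show "lie_frag (\<lambda>a. \<eta> (\<mu> a) - \<mu> (\<eta> a)) (frag_of (m, n)) \<approx>
          lie_frag \<eta> (lie_frag \<mu> (frag_of (m, n))) - lie_frag \<mu> (lie_frag \<eta> (frag_of (m, n)))"
        by (simp add: algebra_simps)
    qed simp_all
    then show "lie_act P (\<lambda>a. \<eta> (\<mu> a) - \<mu> (\<eta> a)) x =
        lie_act P \<eta> (lie_act P \<mu> x) \<ominus>\<^bsub>P\<^esub> lie_act P \<mu> (lie_act P \<eta> x)"
      unfolding u(1) t' tensor_simps(5)[OF vector_fields_bracket[OF \<eta> \<mu>]]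
        minus[OF lie_frag_keys[OF \<mu> lie_frag_keys[OF \<eta> u(2)]]] cls_eq_iff .
  qed
qed

end

section \<open>Matrix operators with constant entries\<close>

definition mat_op :: "nat \<Rightarrow> (nat \<Rightarrow> nat \<Rightarrow> 'f::comm_ring_1) \<Rightarrow> (nat \<Rightarrow> 'f) \<Rightarrow> nat \<Rightarrow> 'f" where
  "mat_op n E v = (\<lambda>k. if k < n then \<Sum>l<n. E k l * v l else 0)"

lemma mat_op_add: "mat_op n E (v + w) = mat_op n E v + mat_op n E w"
  by (rule ext) (simp add: mat_op_def pointwise distrib_left sum.distrib)

lemma mat_op_smul: "mat_op n E (smul c v) = smul c (mat_op n E v)"
  by (rule ext) (simp add: mat_op_def pointwise sum_distrib_left mult.left_commute)

lemma mat_op_0: "mat_op n E 0 = 0"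
  by (rule ext) (simp add: mat_op_def pointwise)

lemma mat_op_sum: "mat_op n E (sum g J) = (\<Sum>j\<in>J. mat_op n E (g j))"
  by (induction J rule: infinite_finite_induct)
    (simp_all only: mat_op_add mat_op_0 sum.infinite sum.empty sum.insert simp_thms)

lemma sum_fun_apply: "(sum g J) k = (\<Sum>j\<in>J. g j k)"
  by (induction J rule: infinite_finite_induct)
    (simp_all only: plus_fun_apply zero_fun_apply sum.infinite sum.empty sum.insert simp_thms)

text \<open>The vector q(T) v, with the coefficients of q transported along \<iota>.\<close>

definition poly_act ::
  "('r::comm_ring_1 \<Rightarrow> 'f::comm_ring_1) \<Rightarrow> (('i \<Rightarrow> 'f) \<Rightarrow> 'i \<Rightarrow> 'f) \<Rightarrow> 'r poly \<Rightarrow> ('i \<Rightarrow> 'f) \<Rightarrow> 'i \<Rightarrow> 'f" where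
  "poly_act \<iota> T q v = (\<Sum>j\<le>degree q. smul (\<iota> (coeff q j)) ((T ^^ j) v))"

lemma poly_act_altdef:
  assumes "\<iota> 0 = 0" "degree q \<le> N"
  shows "poly_act \<iota> T q v = (\<Sum>j\<le>N. smul (\<iota> (coeff q j)) ((T ^^ j) v))"
  unfolding poly_act_def
  by (rule sum.mono_neutral_left) (use assms in \<open>auto simp: coeff_eq_0 smul_simps\<close>)

lemma poly_act_root:
  assumes \<iota>: "\<iota> 0 = 0" "\<And>a b. \<iota> (a - b) = \<iota> a - \<iota> b" "\<And>a b. \<iota> (a * b) = \<iota> a * \<iota> b"
    and T: "\<And>v w. T (v + w) = T v + T w" "\<And>c v. T (smul c v) = smul c (T v)" "T 0 = 0"
  shows "poly_act \<iota> T ([:-c, 1:] * q) v = T (poly_act \<iota> T q v) - smul (\<iota> c) (poly_act \<iota> T q v)"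
proof -
  define N where "N = Suc (degree q)"
  have Ts: "T (sum g J) = (\<Sum>j\<in>J. T (g j))" for g and J :: "nat set"
    by (induction J rule: infinite_finite_induct)
      (simp_all only: T sum.infinite sum.empty sum.insert simp_thms)
  have eq: "[:-c, 1:] * q = pCons 0 q - smult c q" by (simp add: algebra_simps)
  have "degree (pCons 0 q - smult c q) \<le> N"
    unfolding N_def by (intro degree_diff_le degree_pCons_le order_trans[OF degree_smult_le]) simp
  then have "poly_act \<iota> T ([:-c, 1:] * q) v = (\<Sum>j\<le>N. smul (\<iota> (coeff (pCons 0 q - smult c q) j)) ((T ^^ j) v))"
    unfolding eq by (rule poly_act_altdef[where \<iota> = \<iota>, OF \<iota>(1)])
  also have "\<dots> = (\<Sum>j\<le>N. smul (\<iota> (coeff (pCons 0 q) j)) ((T ^^ j) v)) -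
      (\<Sum>j\<le>N. smul (\<iota> c) (smul (\<iota> (coeff q j)) ((T ^^ j) v)))"
    unfolding sum_subtractf[symmetric] by (simp only: coeff_diff coeff_smult \<iota> smul_simps)
  also have "(\<Sum>j\<le>N. smul (\<iota> (coeff (pCons 0 q) j)) ((T ^^ j) v)) =
      (\<Sum>j\<le>degree q. smul (\<iota> (coeff q j)) ((T ^^ Suc j) v))"
    unfolding N_def sum.atMost_Suc_shift by (simp only: coeff_pCons_0 coeff_pCons_Suc \<iota>(1) smul_simps add_0_left)
  also have "\<dots> = T (poly_act \<iota> T q v)"
    unfolding poly_act_def Ts T(2) by (simp only: funpow.simps comp_apply)
  also have "(\<Sum>j\<le>N. smul (\<iota> c) (smul (\<iota> (coeff q j)) ((T ^^ j) v))) = smul (\<iota> c) (poly_act \<iota> T q v)"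
    unfolding smul_sum[symmetric] by (subst poly_act_altdef[where \<iota> = \<iota> and q = q and N = N, OF \<iota>(1)]) (simp_all add: N_def)
  finally show ?thesis .
qed

lemma poly_act_roots:
  assumes \<iota>: "\<iota> 0 = 0" "\<And>a b. \<iota> (a - b) = \<iota> a - \<iota> b" "\<And>a b. \<iota> (a * b) = \<iota> a * \<iota> b" "\<iota> 1 = 1"
    and T: "\<And>v w. T (v + w) = T v + T w" "\<And>c v. T (smul c v) = smul c (T v)" "T 0 = 0"
  shows "poly_act \<iota> T (\<Prod>c\<leftarrow>cs. [:-c, 1:]) v = foldr (\<lambda>c v. T v - smul c v) (map \<iota> cs) v"
proof (induction cs)
  case Nil
  then show ?case by (simp add: poly_act_def smul_simps \<iota>(4))
next
  case (Cons c cs)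
  then show ?case
    by (simp only: list.map prod_list.Cons foldr.simps comp_apply poly_act_root[OF \<iota>(1-3) T])
qed

text \<open>The powers of the matrix with exponents 0 to n^2 satisfy a linear relation: these are
  n^2 homogeneous equations in n^2 + 1 unknowns. A zero row makes the system square with determinant
  0.\<close>

lemma exists_annihilating_poly:
  fixes E :: "nat \<Rightarrow> nat \<Rightarrow> 'f::Fields.field"
  shows "\<exists>p. p \<noteq> 0 \<and> (\<forall>l<n. \<forall>k<n. (\<Sum>j\<le>degree p. coeff p j * (mat_op n E ^^ j) (\<lambda>i. if i = l then 1 else 0) k) = 0)"
proof -
  define \<delta> :: "nat \<Rightarrow> nat \<Rightarrow> 'f" where "\<delta> l = (\<lambda>i. if i = l then 1 else 0)" for l
  let ?N = "Suc (n * n)"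
  \<comment> \<open>Row k n + l is the equation for the matrix entry (k, l).\<close>
  let ?f = "\<lambda>i. vec ?N (\<lambda>j. (mat_op n E ^^ j) (\<delta> (i mod n)) (i div n))"
  let ?A = "mat\<^sub>r ?N ?N (\<lambda>i. if i = n * n then 0\<^sub>v ?N else ?f i)"
  have A: "?A \<in> carrier_mat ?N ?N" by simp
  have "det ?A = 0" by (rule det_row_0) auto
  then obtain c where c: "c \<in> carrier_vec ?N" "c \<noteq> 0\<^sub>v ?N" "?A *\<^sub>v c = 0\<^sub>v ?N"
    using det_0_iff_vec_prod_zero_field[OF A] by blast
  define p where "p = Poly (list_of_vec c)"
  have coeff: "coeff p j = (if j < ?N then c $ j else 0)" for j
    using c(1) unfolding p_def coeff_Poly_eq nth_default_def by (auto simp: list_of_vec_index)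
  obtain j where "j < ?N" "c $ j \<noteq> 0" using c(1,2) by (metis carrier_vecD eq_vecI index_zero_vec)
  then have "p \<noteq> 0" using coeff[of j] by auto
  have deg: "degree p \<le> n * n"
    by (rule degree_le) (auto simp: coeff)
  moreover have "(\<Sum>j\<le>degree p. coeff p j * (mat_op n E ^^ j) (\<delta> l) k) = 0" if lk: "l < n" "k < n" for l k
  proof -
    let ?i = "k * n + l"
    have "?i < Suc k * n" using lk by simp
    also have "\<dots> \<le> n * n" using lk by (intro mult_le_mono1) simp
    finally have i: "?i < n * n" .
    have "(?A *\<^sub>v c) $ ?i = 0" using i unfolding c(3) by simp
    then have "(\<Sum>j<?N. (mat_op n E ^^ j) (\<delta> l) k * c $ j) = 0"
      using i lk c(1) by (simp add: scalar_prod_def row_def lessThan_atLeast0)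
    also have "(\<Sum>j<?N. (mat_op n E ^^ j) (\<delta> l) k * c $ j) = (\<Sum>j<?N. coeff p j * (mat_op n E ^^ j) (\<delta> l) k)"
      by (rule sum.cong) (simp_all add: coeff)
    also have "\<dots> = (\<Sum>j\<le>degree p. coeff p j * (mat_op n E ^^ j) (\<delta> l) k)"
      by (rule sum.mono_neutral_right) (use deg in \<open>auto simp: coeff_eq_0\<close>)
    finally show ?thesis .
  qed
  ultimately show ?thesis using \<open>p \<noteq> 0\<close> unfolding \<delta>_def by blast
qed

lemma frac_const_hom [simp]:
  "frac_const 0 = 0" "frac_const 1 = 1" "frac_const (a + b) = frac_const a + frac_const b"
  "frac_const (a - b) = frac_const a - frac_const b" "frac_const (a * b) = frac_const a * frac_const b"
  "frac_const (- a) = - frac_const a"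
  by (simp_all add: frac_const_def)

lemma frac_const_sum: "frac_const (sum f A) = (\<Sum>i\<in>A. frac_const (f i))"
  by (induction A rule: infinite_finite_induct) simp_all

text \<open>The polynomial is found and split over k, and only then carried to K. So the roots are
  constants; this is where k has to be algebraically closed.\<close>

lemma exists_annihilating_list:
  fixes E :: "nat \<Rightarrow> nat \<Rightarrow> 'k::{alg_closed_field, field_char_0}"
  shows "\<exists>cs. \<forall>v. (\<forall>i\<ge>n. v i = 0) \<longrightarrow>
    foldr (\<lambda>c v. mat_op n (\<lambda>k l. frac_const (E k l)) v - smul c v) (map frac_const cs) v = 0"
proof -
  let ?T = "mat_op n (\<lambda>k l. frac_const (E k l))" and ?S = "mat_op n E"
  define \<delta> :: "nat \<Rightarrow> nat \<Rightarrow> 'k sphere fract" where "\<delta> l = (\<lambda>i. if i = l then 1 else 0)" for l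
  define \<delta>0 :: "nat \<Rightarrow> nat \<Rightarrow> 'k" where "\<delta>0 l = (\<lambda>i. if i = l then 1 else 0)" for l
  obtain p where p: "p \<noteq> 0" "\<And>l k. l < n \<Longrightarrow> k < n \<Longrightarrow> (\<Sum>j\<le>degree p. coeff p j * (?S ^^ j) (\<delta>0 l) k) = 0"
    using exists_annihilating_poly[of n E] unfolding \<delta>0_def by blast
  obtain A where "size A = degree p" "p = smult (lead_coeff p) (\<Prod>x\<in>#A. [:-x, 1:])"
    using alg_closed_imp_factorization[OF p(1)] by blast
  moreover obtain cs where "mset cs = A" using ex_mset by blast
  ultimately have cs: "p = smult (lead_coeff p) (\<Prod>c\<leftarrow>cs. [:-c, 1:])"
    by (metis mset_map prod_mset_prod_list)
  define q where "q = (\<Prod>c\<leftarrow>cs. [:-c, 1:])"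
  have pow: "(?T ^^ j) (\<delta> l) k = frac_const ((?S ^^ j) (\<delta>0 l) k)" for j l k
    by (induction j arbitrary: k) (simp_all add: mat_op_def frac_const_sum \<delta>_def \<delta>0_def)
  have zero: "(?T ^^ j) (\<delta> l) k = 0" if "k \<ge> n" "l < n" for j l k
    using that by (cases j) (simp_all add: mat_op_def \<delta>_def)
  have act: "poly_act frac_const ?T q (\<delta> l) = 0" if l: "l < n" for l
  proof (rule ext)
    fix k
    have "frac_const (lead_coeff p) * poly_act frac_const ?T q (\<delta> l) k =
        (\<Sum>j\<le>degree q. frac_const (lead_coeff p * coeff q j) * (?T ^^ j) (\<delta> l) k)"
      unfolding poly_act_def sum_fun_apply by (simp add: smul_apply sum_distrib_left mult.assoc)
    also have "\<dots> = (\<Sum>j\<le>degree p. frac_const (coeff p j) * (?T ^^ j) (\<delta> l) k)"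
    proof -
      have d: "degree p = degree q" and cf: "coeff p j = lead_coeff p * coeff q j" for j
        using cs p(1) unfolding q_def[symmetric] by (metis degree_smult_eq leading_coeff_0_iff, metis coeff_smult)
      show ?thesis by (rule sum.cong, simp only: d, simp only: cf[symmetric])
    qed
    also have "\<dots> = 0"
    proof (cases "k < n")
      case True
      have "(\<Sum>j\<le>degree p. frac_const (coeff p j) * (?T ^^ j) (\<delta> l) k) =
          frac_const (\<Sum>j\<le>degree p. coeff p j * (?S ^^ j) (\<delta>0 l) k)"
        unfolding pow frac_const_sum by simp
      then show ?thesis using p(2)[OF l True] by simp
    next
      case False
      then show ?thesis using zero[of k l] l by simp
    qed
    finally have "frac_const (lead_coeff p) * poly_act frac_const ?T q (\<delta> l) k = 0" .
    moreover have "frac_const (lead_coeff p) \<noteq> 0"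
      using p(1) sphere_const_inj[of "lead_coeff p" 0] by (simp add: frac_const_def)
    ultimately show "poly_act frac_const ?T q (\<delta> l) k = 0 k" by (simp add: pointwise)
  qed
  have "foldr (\<lambda>c v. ?T v - smul c v) (map frac_const cs) v = 0" if v: "\<forall>i\<ge>n. v i = 0" for v
  proof -
    have "v = (\<Sum>l<n. smul (v l) (\<delta> l))"
      using v by (intro ext) (auto simp: sum_fun_apply pointwise \<delta>_def if_distrib cong: if_cong)
    then have "poly_act frac_const ?T q v = poly_act frac_const ?T q (\<Sum>l<n. smul (v l) (\<delta> l))"
      by (rule arg_cong)
    also have "\<dots> = (\<Sum>l<n. smul (v l) (poly_act frac_const ?T q (\<delta> l)))"
    proof -
      have "(?T ^^ j) (\<Sum>l<n. smul (v l) (\<delta> l)) = (\<Sum>l<n. smul (v l) ((?T ^^ j) (\<delta> l)))" for j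
        by (induction j) (simp_all only: funpow.simps id_apply comp_apply mat_op_sum mat_op_smul)
      then show ?thesis
        unfolding poly_act_def smul_sum by (subst sum.swap) (simp add: smul_sum smul_simps mult.commute)
    qed
    also have "\<dots> = 0" using act by (simp add: smul_simps)
    finally have "poly_act frac_const ?T q v = 0" .
    then show ?thesis
      unfolding q_def by (subst (asm) poly_act_roots) (simp_all add: mat_op_add mat_op_smul mat_op_0)
  qed
  then show ?thesis by blast
qed

section \<open>Tensor products of rational representations\<close>

definition ring_map :: "('a::comm_ring_1 \<Rightarrow> 'b::comm_ring_1) \<Rightarrow> bool" where
  "ring_map f \<longleftrightarrow> f 0 = 0 \<and> f 1 = 1 \<and> (\<forall>x y. f (x + y) = f x + f y) \<and> (\<forall>x y. f (x * y) = f x * f y)"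

lemma ring_mapD:
  assumes "ring_map f"
  shows "f 0 = 0" "f 1 = 1" "f (x + y) = f x + f y" "f (x * y) = f x * f y"
  using assms by (auto simp: ring_map_def)

lemma ring_map_poly_eval:
  assumes f: "ring_map f"
  shows "ring_map (\<lambda>P. poly (map_poly f P) x)"
proof -
  note F = ring_mapD[OF f]
  have add: "map_poly f (p + q) = map_poly f p + map_poly f q" for p q
    by (rule map_poly_plus) (simp_all add: F)
  have sm: "map_poly f (smult a q) = smult (f a) (map_poly f q)" for a q
    by (rule poly_eqI) (simp add: coeff_map_poly F)
  have "poly (map_poly f (p * q)) x = poly (map_poly f p) x * poly (map_poly f q) x" for p q
    by (induction p) (simp_all add: add sm map_poly_pCons F algebra_simps)
  then show ?thesis by (simp add: ring_map_def F add map_poly_1')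
qed

lemma ring_map_eval_entries: "ring_map \<iota> \<Longrightarrow> ring_map (eval_entries \<iota> g)"
  unfolding eval_entries_def by (intro ring_map_poly_eval)

lemma ring_map_poly_natural:
  assumes \<psi>: "ring_map \<psi>" and f: "f 0 = 0"
  shows "\<psi> (poly (map_poly f p) x) = poly (map_poly (\<lambda>a. \<psi> (f a)) p) (\<psi> x)"
  by (induction p) (simp_all add: map_poly_pCons f ring_mapD[OF \<psi>])

lemma eval_entries_natural:
  assumes \<psi>: "ring_map \<psi>" and \<iota>: "\<iota> 0 = 0" and g: "g \<in> carrier_mat 2 2"
  shows "\<psi> (eval_entries \<iota> g P) = eval_entries (\<lambda>c. \<psi> (\<iota> c)) (map_mat \<psi> g) P"
  unfolding eval_entries_def using g
  by (simp add: ring_map_poly_natural[OF \<psi>] \<iota>)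

text \<open>The Kronecker product, where the pair (i, j) of basis indices has the number
  \<open>i * rep_dim \<sigma> + j\<close>. The powers of det in the denominators multiply.\<close>

definition tensor_rep :: "'k::comm_ring_1 gl2_matrix \<Rightarrow> 'k gl2_matrix \<Rightarrow> 'k gl2_matrix" where
  "tensor_rep \<rho> \<sigma> = (mat (rep_dim \<rho> * rep_dim \<sigma>) (rep_dim \<rho> * rep_dim \<sigma>) (\<lambda>(k, l).
      numerators \<rho> $$ (k div rep_dim \<sigma>, l div rep_dim \<sigma>) * numerators \<sigma> $$ (k mod rep_dim \<sigma>, l mod rep_dim \<sigma>)),
    det_exponent \<rho> + det_exponent \<sigma>)"

lemma div_mod_less:
  fixes k n m :: nat
  assumes "k < n * m"
  shows "k div m < n" "k mod m < m"
  using assms by (simp add: less_mult_imp_div_less) (use assms in \<open>cases "m = 0"; simp\<close>)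

lemma dim_tensor_rep: "rep_dim (tensor_rep \<rho> \<sigma>) = rep_dim \<rho> * rep_dim \<sigma>"
  by (simp add: tensor_rep_def)

lemma rep_subst_dims [simp]:
  "dim_row (rep_subst \<iota> \<rho> g) = rep_dim \<rho>" "dim_col (rep_subst \<iota> \<rho> g) = dim_col (numerators \<rho>)"
  by (simp_all add: rep_subst_def)

text \<open>Multiplicativity of \<open>inverse\<close> is a hypothesis because the lemma is applied
  over k, over K and over power series in \<epsilon>.\<close>

lemma rep_subst_tensor:
  fixes \<iota> :: "'k::comm_ring_1 \<Rightarrow> 'r::{comm_ring_1, inverse}"
  assumes \<iota>: "ring_map \<iota>" and inv: "\<And>x y :: 'r. inverse (x * y) = inverse x * inverse y"
    and sq: "square_mat (numerators \<rho>)" "square_mat (numerators \<sigma>)"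
    and kl: "k < rep_dim \<rho> * rep_dim \<sigma>" "l < rep_dim \<rho> * rep_dim \<sigma>"
  shows "rep_subst \<iota> (tensor_rep \<rho> \<sigma>) g $$ (k, l) =
    rep_subst \<iota> \<rho> g $$ (k div rep_dim \<sigma>, l div rep_dim \<sigma>) * rep_subst \<iota> \<sigma> g $$ (k mod rep_dim \<sigma>, l mod rep_dim \<sigma>)"
  using kl sq div_mod_less[OF kl(1)] div_mod_less[OF kl(2)]
  unfolding rep_subst_def tensor_rep_def
  by (simp add: power_add inv ring_mapD[OF ring_map_eval_entries[OF \<iota>]])

lemma sum_div_mod:
  fixes f :: "nat \<Rightarrow> nat \<Rightarrow> 'r::comm_monoid_add"
  shows "(\<Sum>l<n * m. f (l div m) (l mod m)) = (\<Sum>i<n. \<Sum>j<m. f i j)"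
proof (cases "m = 0")
  case False
  have "(\<Sum>l<n * m. f (l div m) (l mod m)) = (\<Sum>i<n. \<Sum>l\<in>{i * m..<i * m + m}. f (l div m) (l mod m))"
    by (rule sum.nat_group[symmetric])
  also have "\<dots> = (\<Sum>i<n. \<Sum>j<m. f i j)"
  proof (rule sum.cong[OF refl])
    fix i
    have "(\<Sum>l\<in>{i * m..<i * m + m}. f (l div m) (l mod m)) = (\<Sum>j\<in>{0..<m}. f ((j + i * m) div m) ((j + i * m) mod m))"
      using sum.shift_bounds_nat_ivl[of "\<lambda>l. f (l div m) (l mod m)" 0 "i * m" m] by (simp add: add.commute)
    also have "\<dots> = (\<Sum>j<m. f i j)"
      unfolding lessThan_atLeast0 using False by (intro sum.cong) auto
    finally show "(\<Sum>l\<in>{i * m..<i * m + m}. f (l div m) (l mod m)) = (\<Sum>j<m. f i j)" .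
  qed
  finally show ?thesis .
qed simp

lemma mat_mult_index_sum:
  "i < dim_row A \<Longrightarrow> j < dim_col B \<Longrightarrow> dim_col A = dim_row B \<Longrightarrow>
    (A * B) $$ (i, j) = (\<Sum>k<dim_row B. A $$ (i, k) * B $$ (k, j))"
  by (simp add: scalar_prod_def lessThan_atLeast0)

lemma rational_tensor_rep:
  fixes \<rho> \<sigma> :: "'k::Fields.field gl2_matrix"
  assumes \<rho>: "rational_rep \<rho>" and \<sigma>: "rational_rep \<sigma>"
  shows "rational_rep (tensor_rep \<rho> \<sigma>)"
proof -
  let ?n = "rep_dim \<rho>" and ?m = "rep_dim \<sigma>" and ?id = "\<lambda>c :: 'k. c"
  have sq: "square_mat (numerators \<rho>)" "square_mat (numerators \<sigma>)"
    using assms by (auto simp: rational_rep_def)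
  have id: "ring_map ?id" by (simp add: ring_map_def)
  note sub = rep_subst_tensor[OF id inverse_mult_distrib sq]
  have dims: "dim_row (rep_subst ?id (tensor_rep \<rho> \<sigma>) g) = ?n * ?m"
    "dim_col (rep_subst ?id (tensor_rep \<rho> \<sigma>) g) = ?n * ?m"
    "dim_col (rep_subst ?id \<rho> g) = ?n" "dim_col (rep_subst ?id \<sigma> g) = ?m" for g
    using sq by (simp_all add: tensor_rep_def)
  show ?thesis
    unfolding rational_rep_def
  proof (intro conjI allI impI)
    show "square_mat (numerators (tensor_rep \<rho> \<sigma>))" by (simp add: tensor_rep_def)
    show "rep_subst ?id (tensor_rep \<rho> \<sigma>) (1\<^sub>m 2) = 1\<^sub>m (rep_dim (tensor_rep \<rho> \<sigma>))"
    proof (rule eq_matI)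
      fix k l assume "k < dim_row (1\<^sub>m (rep_dim (tensor_rep \<rho> \<sigma>)) :: 'k mat)"
        "l < dim_col (1\<^sub>m (rep_dim (tensor_rep \<rho> \<sigma>)) :: 'k mat)"
      then have kl: "k < ?n * ?m" "l < ?n * ?m" by (simp_all add: dim_tensor_rep)
      have "k = l" if "k div ?m = l div ?m" "k mod ?m = l mod ?m"
        using that div_mult_mod_eq by metis
      then show "rep_subst ?id (tensor_rep \<rho> \<sigma>) (1\<^sub>m 2) $$ (k, l) = 1\<^sub>m (rep_dim (tensor_rep \<rho> \<sigma>)) $$ (k, l)"
        using \<rho> \<sigma> kl div_mod_less[OF kl(1)] div_mod_less[OF kl(2)]
        by (auto simp: sub[OF kl] rational_rep_def dim_tensor_rep)
    qed (simp_all add: dim_tensor_rep tensor_rep_def)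
    fix g h :: "'k mat"
    assume gh: "g \<in> carrier_mat 2 2 \<and> h \<in> carrier_mat 2 2 \<and> invertible_mat g \<and> invertible_mat h"
    show "rep_subst ?id (tensor_rep \<rho> \<sigma>) (g * h) = rep_subst ?id (tensor_rep \<rho> \<sigma>) g * rep_subst ?id (tensor_rep \<rho> \<sigma>) h"
      (is "_ = ?R")
    proof (rule eq_matI)
      fix k l assume "k < dim_row ?R" "l < dim_col ?R"
      then have kl: "k < ?n * ?m" "l < ?n * ?m" by (simp_all only: index_mult_mat dims)
      note dm = div_mod_less[OF kl(1)] div_mod_less[OF kl(2)]
      have mult: "rep_subst ?id \<rho> (g * h) = rep_subst ?id \<rho> g * rep_subst ?id \<rho> h"
        "rep_subst ?id \<sigma> (g * h) = rep_subst ?id \<sigma> g * rep_subst ?id \<sigma> h"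
        using \<rho> \<sigma> gh by (auto simp: rational_rep_def)
      have "?R $$ (k, l) = (\<Sum>j<?n * ?m. rep_subst ?id (tensor_rep \<rho> \<sigma>) g $$ (k, j) * rep_subst ?id (tensor_rep \<rho> \<sigma>) h $$ (j, l))"
        using kl by (subst mat_mult_index_sum) (simp_all only: dims)
      also have "\<dots> = (\<Sum>j<?n * ?m. (rep_subst ?id \<rho> g $$ (k div ?m, j div ?m) * rep_subst ?id \<rho> h $$ (j div ?m, l div ?m)) *
          (rep_subst ?id \<sigma> g $$ (k mod ?m, j mod ?m) * rep_subst ?id \<sigma> h $$ (j mod ?m, l mod ?m)))"
        using kl by (intro sum.cong) (simp_all add: sub)
      also have "\<dots> = (\<Sum>i<?n. \<Sum>j<?m. (rep_subst ?id \<rho> g $$ (k div ?m, i) * rep_subst ?id \<rho> h $$ (i, l div ?m)) *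
          (rep_subst ?id \<sigma> g $$ (k mod ?m, j) * rep_subst ?id \<sigma> h $$ (j, l mod ?m)))"
        by (rule sum_div_mod)
      also have "\<dots> = rep_subst ?id \<rho> (g * h) $$ (k div ?m, l div ?m) * rep_subst ?id \<sigma> (g * h) $$ (k mod ?m, l mod ?m)"
        unfolding mult sum_product[symmetric] using dm sq by (simp add: scalar_prod_def lessThan_atLeast0)
      finally show "rep_subst ?id (tensor_rep \<rho> \<sigma>) (g * h) $$ (k, l) = ?R $$ (k, l)" using sub[OF kl] by simp
    qed (simp_all add: tensor_rep_def)
  qed
qed

section \<open>Differentiating a tensor product of representations\<close>

definition eps_unit :: "nat \<Rightarrow> nat \<Rightarrow> 'k::Fields.field fps mat" where
  "eps_unit p i = 1\<^sub>m 2 + mat 2 2 (\<lambda>(a, b). if a = p \<and> b = i then fps_X else 0)"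

lemma rep_deriv_eps:
  "rep_deriv \<rho> p i = map_mat (\<lambda>F. fps_nth F 1) (rep_subst fps_const \<rho> (eps_unit p i))"
  by (simp add: rep_deriv_def eps_unit_def)

lemma ring_map_fps_nth_0: "ring_map (\<lambda>F :: 'k::comm_ring_1 fps. fps_nth F 0)"
  by (simp add: ring_map_def)

lemma det_natural:
  fixes \<psi> :: "'a::comm_ring_1 \<Rightarrow> 'b::comm_ring_1"
  assumes \<psi>: "ring_map \<psi>"
  shows "\<psi> (det A) = det (map_mat \<psi> A)"
proof -
  interpret comm_ring_hom \<psi>
    by unfold_locales (simp_all add: ring_mapD[OF \<psi>])
  show ?thesis by (rule hom_det[symmetric])
qed

text \<open>Setting \<epsilon> = 0 is a ring homomorphism; so it commutes with substitution and
  takes 1 + \<epsilon> E to the identity matrix, whose image under \<rho> is the identity.\<close>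

lemma rep_subst_eps_0:
  fixes \<rho> :: "'k::Fields.field gl2_matrix"
  assumes \<rho>: "rational_rep \<rho>" and kl: "k < rep_dim \<rho>" "l < rep_dim \<rho>"
  shows "fps_nth (rep_subst fps_const \<rho> (eps_unit p i) $$ (k, l)) 0 = (if k = l then 1 else 0)"
proof -
  let ?nth = "\<lambda>F :: 'k fps. fps_nth F 0"
  have sq: "dim_col (numerators \<rho>) = rep_dim \<rho>" using \<rho> by (auto simp: rational_rep_def)
  have c: "eps_unit p i \<in> carrier_mat 2 2" by (simp add: eps_unit_def)
  have one: "map_mat ?nth (eps_unit p i) = 1\<^sub>m 2"
    by (rule eq_matI) (auto simp: eps_unit_def)
  have det: "?nth (det (eps_unit p i)) = 1"
    by (simp only: det_natural[OF ring_map_fps_nth_0] one det_one)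
  have "?nth (rep_subst fps_const \<rho> (eps_unit p i) $$ (k, l)) =
      ?nth (eval_entries fps_const (eps_unit p i) (numerators \<rho> $$ (k, l)))"
    using kl sq det by (simp add: rep_subst_def fps_power_zeroth)
  also have "\<dots> = eval_entries (\<lambda>c. c) (1\<^sub>m 2) (numerators \<rho> $$ (k, l))"
    unfolding eval_entries_natural[where \<psi> = ?nth and \<iota> = fps_const, OF ring_map_fps_nth_0 fps_const_0_eq_0 c] one
    by simp
  also have "\<dots> = rep_subst (\<lambda>c. c) \<rho> (1\<^sub>m 2) $$ (k, l)"
    using kl sq by (simp add: rep_subst_def)
  also have "\<dots> = (if k = l then 1 else 0)"
    using \<rho> kl by (simp add: rational_rep_def)
  finally show ?thesis .
qed

text \<open>The coefficient of \<epsilon> in a product of two series; as the constant coefficients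
  form identity matrices, the result is E \<otimes> 1 + 1 \<otimes> E.\<close>

lemma rep_deriv_tensor:
  fixes \<rho> \<sigma> :: "'k::Fields.field gl2_matrix"
  assumes \<rho>: "rational_rep \<rho>" and \<sigma>: "rational_rep \<sigma>"
    and kl: "k < rep_dim \<rho> * rep_dim \<sigma>" "l < rep_dim \<rho> * rep_dim \<sigma>"
  shows "rep_deriv (tensor_rep \<rho> \<sigma>) p i $$ (k, l) =
    rep_deriv \<rho> p i $$ (k div rep_dim \<sigma>, l div rep_dim \<sigma>) * (if k mod rep_dim \<sigma> = l mod rep_dim \<sigma> then 1 else 0) +
    (if k div rep_dim \<sigma> = l div rep_dim \<sigma> then 1 else 0) * rep_deriv \<sigma> p i $$ (k mod rep_dim \<sigma>, l mod rep_dim \<sigma>)"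
proof -
  have sq: "square_mat (numerators \<rho>)" "square_mat (numerators \<sigma>)"
    using assms by (auto simp: rational_rep_def)
  have c: "ring_map (fps_const :: 'k \<Rightarrow> _)" by (simp add: ring_map_def)
  note dm = div_mod_less[OF kl(1)] div_mod_less[OF kl(2)]
  have "rep_deriv (tensor_rep \<rho> \<sigma>) p i $$ (k, l) =
      fps_nth (rep_subst fps_const (tensor_rep \<rho> \<sigma>) (eps_unit p i) $$ (k, l)) 1"
    unfolding rep_deriv_eps using kl by (subst index_map_mat) (simp_all add: tensor_rep_def)
  also have "\<dots> = fps_nth (rep_subst fps_const \<rho> (eps_unit p i) $$ (k div rep_dim \<sigma>, l div rep_dim \<sigma>) *
      rep_subst fps_const \<sigma> (eps_unit p i) $$ (k mod rep_dim \<sigma>, l mod rep_dim \<sigma>)) 1"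
    by (simp only: rep_subst_tensor[OF c fps_inverse_mult sq kl])
  finally show ?thesis
    unfolding fps_mult_nth_1 rep_subst_eps_0[OF \<rho> dm(1,3)] rep_subst_eps_0[OF \<sigma> dm(2,4)]
    using dm sq unfolding rep_deriv_eps by (simp add: add.commute)
qed

section \<open>Tensor products in a chart\<close>

definition outer :: "('i \<Rightarrow> 'f::comm_ring_1) \<Rightarrow> ('j \<Rightarrow> 'f) \<Rightarrow> 'i \<times> 'j \<Rightarrow> 'f" where
  "outer v w = (\<lambda>(k, l). v k * w l)"

lemma outer_apply: "outer v w (k, l) = v k * w l"
  by (simp add: outer_def)

lemma outer_simps:
  "outer (v + v') w = outer v w + outer v' w" "outer v (w + w') = outer v w + outer v w'"
  "outer (smul c v) w = smul c (outer v w)" "outer v (smul c w) = smul c (outer v w)"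
  "outer 0 w = 0" "outer v 0 = 0"
  by (auto simp: fun_eq_iff pointwise outer_def algebra_simps)

lemma outer_sum_left: "outer (sum f I) w = (\<Sum>i\<in>I. outer (f i) w)"
  by (induction I rule: infinite_finite_induct)
    (simp_all only: outer_simps sum.infinite sum.empty sum.insert simp_thms)

lemma outer_sum_right: "outer v (sum f I) = (\<Sum>i\<in>I. outer v (f i))"
  by (induction I rule: infinite_finite_induct)
    (simp_all only: outer_simps sum.infinite sum.empty sum.insert simp_thms)

lemma pd_outer: "pd h i (outer v w) = outer (pd h i v) w + outer v (pd h i w)"
  by (auto simp: fun_eq_iff pointwise outer_def pderiv_chart_mult)

definition frag_eval ::
  "('m \<Rightarrow> 'i \<Rightarrow> 'f::comm_ring_1) \<Rightarrow> ('n \<Rightarrow> 'j \<Rightarrow> 'f) \<Rightarrow> ('m \<times> 'n \<Rightarrow>\<^sub>0 int) \<Rightarrow> 'i \<times> 'j \<Rightarrow> 'f" where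
  "frag_eval \<phi> \<psi> u =
    (\<Sum>p\<in>Poly_Mapping.keys u. smul (of_int (Poly_Mapping.lookup u p)) (outer (\<phi> (fst p)) (\<psi> (snd p))))"

lemma frag_eval_superset:
  "finite S \<Longrightarrow> Poly_Mapping.keys u \<subseteq> S \<Longrightarrow>
    frag_eval \<phi> \<psi> u = (\<Sum>p\<in>S. smul (of_int (Poly_Mapping.lookup u p)) (outer (\<phi> (fst p)) (\<psi> (snd p))))"
  unfolding frag_eval_def
  by (rule sum.mono_neutral_left) (auto simp: smul_simps in_keys_iff)

lemma frag_eval_0 [simp]: "frag_eval \<phi> \<psi> 0 = 0"
  by (simp add: frag_eval_def)

lemma frag_eval_of: "frag_eval \<phi> \<psi> (frag_of (m, n)) = outer (\<phi> m) (\<psi> n)"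
  by (simp add: frag_eval_def keys_frag_of smul_simps)

lemma frag_eval_diff: "frag_eval \<phi> \<psi> (u - v) = frag_eval \<phi> \<psi> u - frag_eval \<phi> \<psi> v"
proof -
  let ?S = "Poly_Mapping.keys u \<union> Poly_Mapping.keys v"
  have "finite ?S" "Poly_Mapping.keys (u - v) \<subseteq> ?S" using keys_diff[of u v] by auto
  then show ?thesis
    by (simp add: frag_eval_superset[of ?S] sum_subtractf[symmetric] lookup_minus smul_simps)
qed

lemma frag_eval_add: "frag_eval \<phi> \<psi> (u + v) = frag_eval \<phi> \<psi> u + frag_eval \<phi> \<psi> v"
  using frag_eval_diff[of \<phi> \<psi> "u + v" v] by (simp add: algebra_simps)

text \<open>The choice of a representative is harmless, as \<open>frag_eval\<close> kills the
  relators (\<open>Phi_cls\<close>).\<close>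

definition tensor_map where
  "tensor_map \<phi> \<psi> t = frag_eval \<phi> \<psi> (SOME u. u \<in> t)"

text \<open>The operator E \<otimes> 1 + 1 \<otimes> E, acting on one index while the other is kept
  fixed.\<close>

definition tensor_units where
  "tensor_units e1 e2 p i v = (\<lambda>(k, l). e1 p i (\<lambda>k'. v (k', l)) k + e2 p i (\<lambda>l'. v (k, l')) l)"

lemma matrix_units_tensor:
  assumes "matrix_units e1" "matrix_units e2"
  shows "matrix_units (tensor_units e1 e2)"
proof -
  interpret A: matrix_units e1 by fact
  interpret B: matrix_units e2 by fact
  have 1: "(\<lambda>k'. (v + w) (k', l)) = (\<lambda>k'. v (k', l)) + (\<lambda>k'. w (k', l))"
    "(\<lambda>l'. (v + w) (k, l')) = (\<lambda>l'. v (k, l')) + (\<lambda>l'. w (k, l'))"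
    for v w :: "_ \<times> _ \<Rightarrow> _" and k l by (simp_all add: fun_eq_iff pointwise)
  have 2: "(\<lambda>k'. smul c v (k', l)) = smul c (\<lambda>k'. v (k', l))"
    "(\<lambda>l'. smul c v (k, l')) = smul c (\<lambda>l'. v (k, l'))"
    for v :: "_ \<times> _ \<Rightarrow> _" and c k l by (simp_all add: fun_eq_iff pointwise)
  have 3: "(\<lambda>k'. pd h j v (k', l)) = pd h j (\<lambda>k'. v (k', l))"
    "(\<lambda>l'. pd h j v (k, l')) = pd h j (\<lambda>l'. v (k, l'))"
    for v :: "_ \<times> _ \<Rightarrow> _" and h j k l by (simp_all add: fun_eq_iff pointwise)
  show ?thesis
  proof
    fix p i v w c h j
    show "tensor_units e1 e2 p i (v + w) = tensor_units e1 e2 p i v + tensor_units e1 e2 p i w"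
      unfolding tensor_units_def 1 A.e_add B.e_add by (auto simp: fun_eq_iff pointwise)
    show "tensor_units e1 e2 p i (smul c v) = smul c (tensor_units e1 e2 p i v)"
      unfolding tensor_units_def 2 A.e_smul B.e_smul by (auto simp: fun_eq_iff pointwise algebra_simps)
    show "pd h j (tensor_units e1 e2 p i v) = tensor_units e1 e2 p i (pd h j v)"
      unfolding tensor_units_def 3 A.e_pd[symmetric] B.e_pd[symmetric]
      by (auto simp: fun_eq_iff pointwise pderiv_chart_add)
  qed
qed

lemma tensor_units_outer:
  assumes "matrix_units e1" "matrix_units e2"
  shows "tensor_units e1 e2 p i (outer v w) = outer (e1 p i v) w + outer v (e2 p i w)"
proof -
  interpret A: matrix_units e1 by fact
  interpret B: matrix_units e2 by fact
  have *: "(\<lambda>k'. outer v w (k', l)) = smul (w l) v" "(\<lambda>l'. outer v w (k, l')) = smul (v k) w" for k l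
    by (simp_all add: fun_eq_iff pointwise outer_def mult.commute)
  have "tensor_units e1 e2 p i (outer v w) (k, l) = (outer (e1 p i v) w + outer v (e2 p i w)) (k, l)" for k l
    unfolding tensor_units_def prod.case * A.e_smul B.e_smul
    by (simp add: pointwise outer_apply mult.commute)
  then show ?thesis by (simp add: fun_eq_iff)
qed

locale embedding_pair = av_pair M N + M: chart_embedding M e1 h \<phi> + N: chart_embedding N e2 h \<psi>
  for M :: "('k::field_char_0 sphere, 'm) av_structure" and N :: "('k sphere, 'n) av_structure"
    and e1 :: "nat \<Rightarrow> nat \<Rightarrow> ('i \<Rightarrow> 'k sphere fract) \<Rightarrow> 'i \<Rightarrow> 'k sphere fract"
    and e2 :: "nat \<Rightarrow> nat \<Rightarrow> ('j \<Rightarrow> 'k sphere fract) \<Rightarrow> 'j \<Rightarrow> 'k sphere fract"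
    and h \<phi> \<psi>
begin

abbreviation "E \<equiv> tensor_units e1 e2"
abbreviation "\<Phi> \<equiv> tensor_map \<phi> \<psi>"

sublocale U: matrix_units E
  by (rule matrix_units_tensor[OF M.matrix_units_axioms N.matrix_units_axioms])

lemmas E_outer = tensor_units_outer[OF M.matrix_units_axioms N.matrix_units_axioms]

lemma frag_eval_Rel: "u \<in> Rel \<Longrightarrow> frag_eval \<phi> \<psi> u = 0"
proof (induction rule: tensor_relations.induct)
  case (diff u v)
  then show ?case by (simp add: frag_eval_diff)
qed (simp_all add: frag_eval_diff frag_eval_of M.phi_add N.phi_add M.phi_smult N.phi_smult outer_simps)

lemma Phi_cls: "\<Phi> (cls u) = frag_eval \<phi> \<psi> u"
proof -
  have "(SOME v. v \<in> cls u) \<in> cls u" by (rule someI[of _ u]) (simp add: mem_cls)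
  then have "(SOME v. v \<in> cls u) - u \<in> Rel" by (simp add: mem_cls equiv_frag_def)
  from frag_eval_Rel[OF this] show ?thesis by (simp add: tensor_map_def frag_eval_diff)
qed

lemma frag_eval_act:
  "Poly_Mapping.keys u \<subseteq> C \<Longrightarrow> frag_eval \<phi> \<psi> (act_frag a u) = smul (to_fract a) (frag_eval \<phi> \<psi> u)"
proof (induction rule: frag_induction)
  case (one p)
  then show ?case by (cases p) (simp add: frag_eval_of M.phi_smult outer_simps)
next
  case (diff u v)
  then show ?case by (simp add: frag_eval_diff smul_simps)
qed (simp add: smul_simps)

lemma chart_lie_outer:
  "U.chart_lie h \<eta> (outer v w) = outer (M.chart_lie h \<eta> v) w + outer v (N.chart_lie h \<eta> w)"
  unfolding U.chart_lie_def M.chart_lie_def N.chart_lie_def sum_lessThan_2 E_outer pd_outer smul_simps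
    outer_simps by (simp only: add.assoc add.left_commute)

lemma frag_eval_lie:
  assumes \<eta>: "\<eta> \<in> vector_fields"
  shows "Poly_Mapping.keys u \<subseteq> C \<Longrightarrow> frag_eval \<phi> \<psi> (lie_frag \<eta> u) = U.chart_lie h \<eta> (frag_eval \<phi> \<psi> u)"
proof (induction rule: frag_induction)
  case zero
  show ?case using U.chart_lie_diff[of h \<eta> 0 0] by simp
next
  case (one p)
  then show ?case
    by (cases p) (simp add: frag_eval_of frag_eval_add chart_lie_outer M.phi_lie[OF \<eta>] N.phi_lie[OF \<eta>])
next
  case (diff u v)
  then show ?case by (simp add: frag_eval_diff U.chart_lie_diff)
qed

lemma tensor_chart_embedding: "chart_embedding P E h \<Phi>"
proof -
  interpret T: av_module P by (rule tensor_av_module)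
  show ?thesis
  proof unfold_locales
    fix x assume "x \<in> carrier P"
    then obtain u where u: "x = cls u" "Poly_Mapping.keys u \<subseteq> C" by (rule carrierE)
    { fix y assume "y \<in> carrier P"
      then obtain v where v: "y = cls v" "Poly_Mapping.keys v \<subseteq> C" by (rule carrierE)
      show "\<Phi> (x \<oplus>\<^bsub>P\<^esub> y) = \<Phi> x + \<Phi> y"
        unfolding u(1) v(1) tensor_simps(3) Phi_cls by (rule frag_eval_add) }
    show "\<Phi> (a \<odot>\<^bsub>P\<^esub> x) = smul (to_fract a) (\<Phi> x)" for a
      unfolding u(1) tensor_simps(4) Phi_cls by (rule frag_eval_act[OF u(2)])
    show "\<Phi> (lie_act P \<eta> x) = U.chart_lie h \<eta> (\<Phi> x)" if "\<eta> \<in> vector_fields" for \<eta>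
      unfolding u(1) tensor_simps(5)[OF that] Phi_cls by (rule frag_eval_lie[OF that u(2)])
  qed
qed

end

sublocale embedding_pair \<subseteq> T: chart_embedding "av_tensor M N" "tensor_units e1 e2" h "tensor_map \<phi> \<psi>"
  by (rule tensor_chart_embedding)

text \<open>Let T be a submodule that contains the products of generators. For each generator n of
  N, the m with m \<otimes> n in T form a submodule of M, hence all of M; the same argument on the
  right extends this to all n.\<close>

lemma (in av_pair) tensor_finitely_generated:
  assumes "finitely_generated_over_A M" "finitely_generated_over_A N"
  shows "finitely_generated_over_A P"
proof -
  interpret T: av_module P by (rule tensor_av_module)
  obtain G where G: "G \<subseteq> carrier M" "finite G" "\<And>T. a_submodule T M \<Longrightarrow> G \<subseteq> T \<Longrightarrow> T = carrier M"
    using M.finitely_generatedD[OF assms(1)] by metis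
  obtain H where H: "H \<subseteq> carrier N" "finite H" "\<And>T. a_submodule T N \<Longrightarrow> H \<subseteq> T \<Longrightarrow> T = carrier N"
    using N.finitely_generatedD[OF assms(2)] by metis
  let ?g = "\<lambda>m n. cls (frag_of (m, n))"
  have g: "?g (m \<oplus>\<^bsub>M\<^esub> m') n = ?g m n \<oplus>\<^bsub>P\<^esub> ?g m' n" "?g m (n \<oplus>\<^bsub>N\<^esub> n') = ?g m n \<oplus>\<^bsub>P\<^esub> ?g m n'"
    "?g (a \<odot>\<^bsub>M\<^esub> m) n = a \<odot>\<^bsub>P\<^esub> ?g m n" "?g m (a \<odot>\<^bsub>N\<^esub> n) = a \<odot>\<^bsub>P\<^esub> ?g m n"
    if "m \<in> carrier M" "m' \<in> carrier M" "n \<in> carrier N" "n' \<in> carrier N" for m m' n n' a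
    unfolding tensor_simps(3,4) cls_eq_iff act_frag_simps
    using that by (auto intro: equiv_add_left equiv_add_right equiv_sym[OF equiv_balanced])
  have gc: "?g m n \<in> carrier P" if "m \<in> carrier M" "n \<in> carrier N" for m n
    using that by (intro cls_carrier) (simp add: keys_frag_of)
  have g0: "?g \<zero>\<^bsub>M\<^esub> n = \<zero>\<^bsub>P\<^esub>" if "n \<in> carrier N" for n
    using g(3)[of "\<zero>\<^bsub>M\<^esub>" "\<zero>\<^bsub>M\<^esub>" n n 0] gc[of "\<zero>\<^bsub>M\<^esub>" n] that by simp
  have g0': "?g m \<zero>\<^bsub>N\<^esub> = \<zero>\<^bsub>P\<^esub>" if "m \<in> carrier M" for m
    using g(4)[of m m "\<zero>\<^bsub>N\<^esub>" "\<zero>\<^bsub>N\<^esub>" 0] gc[of m "\<zero>\<^bsub>N\<^esub>"] that by simp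
  show ?thesis
  proof (rule T.finitely_generatedI)
    let ?G = "(\<lambda>(m, n). ?g m n) ` (G \<times> H)"
    show "?G \<subseteq> carrier P" using G(1) H(1) gc by auto
    show "finite ?G" using G(2) H(2) by simp
    fix T assume T: "a_submodule T P" "?G \<subseteq> T"
    note T1 = a_submoduleD[OF T(1)]
    have left: "?g m n \<in> T" if n: "n \<in> H" and m: "m \<in> carrier M" for m n
    proof -
      have n': "n \<in> carrier N" using n H(1) by blast
      let ?S = "{m \<in> carrier M. ?g m n \<in> T}"
      have "?S = carrier M"
      proof (rule G(3))
        show "a_submodule ?S M"
          unfolding a_submodule_def using n' by (auto simp: g g0 T1)
        show "G \<subseteq> ?S" using G(1) T(2) n by auto
      qed
      then show ?thesis using m by blast
    qed
    have gen: "?g m n \<in> T" if m: "m \<in> carrier M" and n: "n \<in> carrier N" for m n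
    proof -
      let ?S = "{n \<in> carrier N. ?g m n \<in> T}"
      have "?S = carrier N"
      proof (rule H(3))
        show "a_submodule ?S N"
          unfolding a_submodule_def using m by (auto simp: g g0' T1)
        show "H \<subseteq> ?S" using H(1) left[OF _ m] by auto
      qed
      then show ?thesis using n by blast
    qed
    have "Poly_Mapping.keys u \<subseteq> C \<and> cls u \<in> T" if "Poly_Mapping.keys u \<subseteq> C" for u
      using that
    proof (induction rule: frag_induction)
      case zero
      show ?case using T1(2) by (simp add: tensor_simps(2))
    next
      case (one p)
      then show ?case using gen by (auto simp: keys_frag_of)
    next
      case (diff u v)
      have "\<ominus>\<^bsub>P\<^esub> cls v = cls (- v)"
        by (rule T.M.minus_equality) (use diff in \<open>simp_all add: tensor_simps(2,3) cls_carrier\<close>)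
      then have "cls (- v) = (-1) \<odot>\<^bsub>P\<^esub> cls v"
        using T.inv_eq_smult[of "cls v"] diff by (simp add: cls_carrier)
      then have "cls (- v) \<in> T" using T1(4) diff by simp
      then have "cls u \<oplus>\<^bsub>P\<^esub> cls (- v) \<in> T" using T1(3) diff by blast
      then show ?case using diff keys_diff[of u v] by (auto simp: tensor_simps(3))
    qed
    then show "T = carrier P" using T(1) unfolding tensor_simps(1) a_submodule_def by blast
  qed
qed

section \<open>Products of strings and torsion in M \<otimes> N\<close>

lemma common_denominator:
  fixes f :: "'j \<Rightarrow> 'r::idom fract"
  assumes "finite J"
  shows "\<exists>D. D \<noteq> 0 \<and> (\<forall>j\<in>J. \<exists>c. to_fract D * f j = to_fract c)"
  using assms
proof (induction J)
  case empty
  show ?case by (intro exI[of _ 1]) simp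
next
  case (insert i J)
  then obtain D where D: "D \<noteq> 0" "\<And>j. j \<in> J \<Longrightarrow> \<exists>c. to_fract D * f j = to_fract c" by blast
  obtain p q where q: "f i = Fract p q" "q \<noteq> 0" by (cases "f i")
  have "\<exists>c. to_fract (D * q) * f j = to_fract c" if j: "j \<in> J" for j
  proof -
    obtain c where "to_fract D * f j = to_fract c" using D(2)[OF j] by blast
    then have "to_fract (D * q) * f j = to_fract (c * q)" by (simp add: mult_ac)
    then show ?thesis by blast
  qed
  moreover have "to_fract (D * q) * f i = to_fract (D * p)"
    using q by (simp add: Fract_conv_to_fract)
  ultimately have "\<forall>j\<in>insert i J. \<exists>c. to_fract (D * q) * f j = to_fract c" by blast
  moreover have "D * q \<noteq> 0" using D(1) q(2) by simp
  ultimately show ?case by blast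
qed

text \<open>Suitable multiples of the string vectors lie in the module and span a free submodule,
  into which D moves everything. In \<open>Phi_inj\<close> this reduces M \<otimes> N, up to the
  factor D, to a sum of copies of the second module.\<close>

lemma (in hw_string) exists_frame:
  assumes inj: "inj_on \<phi> (carrier P)" and fg: "finitely_generated_over_A P"
    and span: "kspan (carrier P) = string_space w N"
  shows "\<exists>a f D. D \<noteq> 0 \<and> (\<forall>j. a j \<noteq> 0 \<and> f j \<in> carrier P \<and> smul (to_fract (a j)) (b j) = \<phi> (f j)) \<and>
    (\<forall>x\<in>carrier P. \<exists>c. D \<odot>\<^bsub>P\<^esub> x = (\<Oplus>\<^bsub>P\<^esub>j\<in>{..N}. c j \<odot>\<^bsub>P\<^esub> f j))"
proof -
  have "\<exists>a s. a \<noteq> 0 \<and> s \<in> carrier P \<and> smul (to_fract a) (b j) = \<phi> s" for j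
    using b_V[of j] unfolding kspan_def by blast
  then obtain a f where af: "\<And>j. a j \<noteq> 0" "\<And>j. f j \<in> carrier P" "\<And>j. smul (to_fract (a j)) (b j) = \<phi> (f j)"
    by metis
  let ?S = "{x \<in> carrier P. \<exists>c. \<phi> x = (\<Sum>j\<le>N. smul (to_fract (c j)) (\<phi> (f j)))}"
  have "\<exists>D. D \<noteq> 0 \<and> (\<forall>x\<in>carrier P. D \<odot>\<^bsub>P\<^esub> x \<in> ?S)"
  proof (rule common_multiplier[OF fg])
    show "a_submodule ?S P"
      unfolding a_submodule_def
    proof (intro conjI ballI allI)
      show "\<zero>\<^bsub>P\<^esub> \<in> ?S" by (auto simp: smul_simps intro!: exI[of _ "\<lambda>_. 0"])
      fix x assume "x \<in> ?S"
      then obtain c where x: "x \<in> carrier P" "\<phi> x = (\<Sum>j\<le>N. smul (to_fract (c j)) (\<phi> (f j)))" by blast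
      { fix y assume "y \<in> ?S"
        then obtain c' where y: "y \<in> carrier P" "\<phi> y = (\<Sum>j\<le>N. smul (to_fract (c' j)) (\<phi> (f j)))" by blast
        have "\<phi> (x \<oplus>\<^bsub>P\<^esub> y) = (\<Sum>j\<le>N. smul (to_fract (c j + c' j)) (\<phi> (f j)))"
          unfolding phi_add[OF x(1) y(1)] x(2) y(2) to_fract_add smul_simps sum.distrib ..
        then show "x \<oplus>\<^bsub>P\<^esub> y \<in> ?S" 
          using x(1) y(1) by (intro CollectI conjI exI[of _ "\<lambda>j. c j + c' j"]) auto }
      fix a
      have "\<phi> (a \<odot>\<^bsub>P\<^esub> x) = (\<Sum>j\<le>N. smul (to_fract (a * c j)) (\<phi> (f j)))"
        unfolding phi_smult[OF x(1)] x(2) smul_sum to_fract_mult smul_simps ..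
      then show "a \<odot>\<^bsub>P\<^esub> x \<in> ?S"
        using x(1) by (intro CollectI conjI exI[of _ "\<lambda>j. a * c j"]) auto
    qed blast
    fix x assume x: "x \<in> carrier P"
    then have "\<phi> x \<in> string_space w N" using kspan_phi[OF x] span by simp
    then obtain k where k: "\<phi> x = (\<Sum>j\<le>N. smul (k j) (b j))" unfolding string_space_def by blast
    obtain D where D: "D \<noteq> 0" "\<And>j. j \<in> {..N} \<Longrightarrow> \<exists>c. to_fract D * (k j / to_fract (a j)) = to_fract c"
      using common_denominator[of "{..N}" "\<lambda>j. k j / to_fract (a j)"] by auto
    then obtain c where c: "\<And>j. j \<in> {..N} \<Longrightarrow> to_fract D * (k j / to_fract (a j)) = to_fract (c j)" by metis
    have "\<phi> (D \<odot>\<^bsub>P\<^esub> x) = (\<Sum>j\<le>N. smul (to_fract D * k j) (b j))"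
      unfolding phi_smult[OF x] k smul_sum smul_simps ..
    also have "\<dots> = (\<Sum>j\<le>N. smul (to_fract (c j)) (\<phi> (f j)))"
    proof (rule sum.cong[OF refl])
      fix j assume j: "j \<in> {..N}"
      have "to_fract (c j) * to_fract (a j) = to_fract D * k j"
        using c[OF j] af(1)[of j] by (simp add: field_simps)
      then show "smul (to_fract D * k j) (b j) = smul (to_fract (c j)) (\<phi> (f j))"
        unfolding af(3)[symmetric] smul_simps by simp
    qed
    finally show "\<exists>a. a \<noteq> 0 \<and> a \<odot>\<^bsub>P\<^esub> x \<in> ?S" using D(1) x by blast
  qed
  then obtain D where D: "D \<noteq> 0" "\<And>x. x \<in> carrier P \<Longrightarrow> D \<odot>\<^bsub>P\<^esub> x \<in> ?S" by blast
  have "\<exists>c. D \<odot>\<^bsub>P\<^esub> x = (\<Oplus>\<^bsub>P\<^esub>j\<in>{..N}. c j \<odot>\<^bsub>P\<^esub> f j)" if x: "x \<in> carrier P" for x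
  proof -
    obtain c where c: "\<phi> (D \<odot>\<^bsub>P\<^esub> x) = (\<Sum>j\<le>N. smul (to_fract (c j)) (\<phi> (f j)))" using D(2)[OF x] by blast
    have cl: "(\<lambda>j. c j \<odot>\<^bsub>P\<^esub> f j) \<in> {..N} \<rightarrow> carrier P" using af(2) by auto
    have "\<phi> (D \<odot>\<^bsub>P\<^esub> x) = \<phi> (\<Oplus>\<^bsub>P\<^esub>j\<in>{..N}. c j \<odot>\<^bsub>P\<^esub> f j)"
      unfolding c phi_finsum[OF cl] by (simp only: phi_smult[OF af(2)])
    then have "D \<odot>\<^bsub>P\<^esub> x = (\<Oplus>\<^bsub>P\<^esub>j\<in>{..N}. c j \<odot>\<^bsub>P\<^esub> f j)"
      using M.finsum_closed[OF cl] x by (intro inj_onD[OF inj]) auto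
    then show ?thesis by blast
  qed
  then show ?thesis using af D(1) by blast
qed

locale string_pair = embedding_pair M N e1 e2 h \<phi> \<psi> +
  M: hw_string M e1 h \<phi> w c d n + N: hw_string N e2 h \<psi> w' c' d' m
  for M :: "('k::field_char_0 sphere, 'm) av_structure" and N :: "('k sphere, 'n) av_structure"
    and e1 :: "nat \<Rightarrow> nat \<Rightarrow> ('i \<Rightarrow> 'k sphere fract) \<Rightarrow> 'i \<Rightarrow> 'k sphere fract"
    and e2 :: "nat \<Rightarrow> nat \<Rightarrow> ('j \<Rightarrow> 'k sphere fract) \<Rightarrow> 'j \<Rightarrow> 'k sphere fract"
    and h \<phi> \<psi> w c d n w' c' d' m +
  assumes inj_M: "inj_on \<phi> (carrier M)" and inj_N: "inj_on \<psi> (carrier N)"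
    and fg_M: "finitely_generated_over_A M" and fg_N: "finitely_generated_over_A N"
    and span_M: "M.kspan (carrier M) = M.string_space w n"
    and span_N: "N.kspan (carrier N) = N.string_space w' m"
begin

definition x where "x i j = outer (M.b i) (N.b j)"

lemma Phi_outer_span:
  assumes T: "lin_space T" "\<And>i j. x i j \<in> T" and p: "p \<in> carrier M" and q: "q \<in> carrier N"
  shows "outer (\<phi> p) (\<psi> q) \<in> T"
proof -
  have "\<phi> p \<in> M.string_space w n" using M.kspan_phi[OF p] span_M by simp
  then obtain a where a: "\<phi> p = (\<Sum>i\<le>n. smul (a i) (M.b i))" unfolding M.string_space_def by blast
  have "\<psi> q \<in> N.string_space w' m" using N.kspan_phi[OF q] span_N by simp
  then obtain a' where a': "\<psi> q = (\<Sum>j\<le>m. smul (a' j) (N.b j))" unfolding N.string_space_def by blast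
  show ?thesis
    unfolding a a' outer_sum_left outer_sum_right outer_simps x_def[symmetric]
    by (intro lin_space_sum[OF T(1)] lin_spaceD(3)[OF T(1)] T(2))
qed

lemma V_span:
  assumes T: "lin_space T" "\<And>i j. x i j \<in> T"
  shows "T.kspan (carrier P) \<subseteq> T"
proof
  fix v assume "v \<in> T.kspan (carrier P)"
  then obtain a t where at: "a \<noteq> 0" "t \<in> carrier P" "smul (to_fract a) v = \<Phi> t"
    unfolding T.kspan_def by blast
  obtain u where u: "t = cls u" "Poly_Mapping.keys u \<subseteq> C" using carrierE[OF at(2)] .
  have "frag_eval \<phi> \<psi> u \<in> T"
    using u(2)
  proof (induction rule: frag_induction)
    case zero
    show ?case using lin_spaceD(1)[OF T(1)] by simp
  next
    case (one p)
    then show ?case by (cases p) (auto simp: frag_eval_of intro: Phi_outer_span[OF T])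
  next
    case (diff u v)
    then show ?case by (auto simp: frag_eval_diff intro: lin_spaceD(4)[OF T(1)])
  qed
  then have "smul (inverse (to_fract a)) (smul (to_fract a) v) \<in> T"
    unfolding at(3) u(1) Phi_cls by (rule lin_spaceD(3)[OF T(1)])
  then show "v \<in> T" using at(1) by (simp add: smul_simps)
qed

lemma x_V: "x i j \<in> T.kspan (carrier P)"
proof -
  obtain a s where a: "a \<noteq> 0" "s \<in> carrier M" "smul (to_fract a) (M.b i) = \<phi> s"
    using M.b_V[of i] unfolding M.kspan_def by blast
  obtain a' s' where a': "a' \<noteq> 0" "s' \<in> carrier N" "smul (to_fract a') (N.b j) = \<psi> s'"
    using N.b_V[of j] unfolding N.kspan_def by blast
  have "smul (to_fract (a * a')) (x i j) = \<Phi> (cls (frag_of (s, s')))"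
    unfolding Phi_cls frag_eval_of a(3)[symmetric] a'(3)[symmetric] x_def outer_simps smul_simps to_fract_mult
    by (simp only: mult.commute)
  moreover have "cls (frag_of (s, s')) \<in> carrier P" using a(2) a'(2) by (intro cls_carrier) (simp add: keys_frag_of)
  moreover have "a * a' \<noteq> 0" using a(1) a'(1) by simp
  ultimately show ?thesis unfolding T.kspan_def by blast
qed

lemma string_raise:
  "e1 0 1 (M.b i) = smul (of_nat i * (of_nat n - of_nat i + 1)) (M.b (i - 1))"
  "e2 0 1 (N.b j) = smul (of_nat j * (of_nat m - of_nat j + 1)) (N.b (j - 1))"
proof -
  show "e1 0 1 (M.b i) = smul (of_nat i * (of_nat n - of_nat i + 1)) (M.b (i - 1))"
  proof (cases i)
    case 0
    then show ?thesis using M.hw by (simp add: M.hw_vector_def smul_simps)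
  next
    case (Suc k)
    show ?thesis unfolding Suc M.b_raise M.weight_diff by (simp add: algebra_simps)
  qed
  show "e2 0 1 (N.b j) = smul (of_nat j * (of_nat m - of_nat j + 1)) (N.b (j - 1))"
  proof (cases j)
    case 0
    then show ?thesis using N.hw by (simp add: N.hw_vector_def smul_simps)
  next
    case (Suc k)
    show ?thesis unfolding Suc N.b_raise N.weight_diff by (simp add: algebra_simps)
  qed
qed

text \<open>For a fixed second coordinate l the relation is one between the vectors
  \<open>M.b i\<close>, with coefficients \<open>a i * N.b (r - i) l\<close>. All of these vanish,
  while the vector \<open>N.b (r - i)\<close> is nonzero.\<close>

lemma x_independent:
  assumes sum: "(\<Sum>i\<le>r. smul (a i) (x i (r - i))) = 0" and r: "r \<le> min n m" and i: "i \<le> r"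
  shows "a i = 0"
proof -
  have "a i * N.b (r - i) l = 0" for l
  proof -
    let ?a = "\<lambda>i. if i \<le> r then a i * N.b (r - i) l else 0"
    have "(\<Sum>i\<le>n. smul (?a i) (M.b i)) = (\<Sum>i\<le>r. smul (a i * N.b (r - i) l) (M.b i))"
      by (rule sum.mono_neutral_cong_right) (use r in \<open>auto simp: smul_simps\<close>)
    also have "\<dots> = 0"
    proof (rule ext)
      fix k
      have "(\<Sum>i\<le>r. smul (a i) (x i (r - i))) (k, l) = 0" unfolding sum by (simp add: pointwise)
      then show "(\<Sum>i\<le>r. smul (a i * N.b (r - i) l) (M.b i)) k = 0 k"
        unfolding sum_fun_apply by (simp add: pointwise x_def outer_apply mult_ac)
    qed
    finally have "?a i = 0" by (rule M.b_independent) (use r i in simp)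
    then show ?thesis using i by simp
  qed
  then have "smul (a i) (N.b (r - i)) = 0" by (simp add: fun_eq_iff pointwise)
  moreover have "N.b (r - i) \<noteq> 0" by (intro N.nonzero le_trans[OF diff_le_self]) (use r in simp)
  ultimately show ?thesis by (simp add: smul_eq_0_iff)
qed

sublocale clebsch_gordan P E h \<Phi> n m x "c + c'" "d + d'"
proof unfold_locales
  fix i j
  show "x i j \<in> T.kspan (carrier P)" by (rule x_V)
  show "n < i \<or> m < j \<Longrightarrow> x i j = 0"
    using M.b_zero[of i] N.b_zero[of j] by (auto simp: x_def outer_simps)
  show "pd h k (x i j) = 0" if "k < 2" for k
    using M.b_pd[OF that] N.b_pd[OF that] by (simp add: x_def pd_outer outer_simps)
  show "E 0 0 (x i j) = smul (c + c' - of_nat (i + j)) (x i j)"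
    unfolding x_def E_outer M.b_weight N.b_weight outer_simps smul_simps(2)[symmetric]
    by (rule smul_cong) simp
  show "E 1 1 (x i j) = smul (d + d' + of_nat (i + j)) (x i j)"
    unfolding x_def E_outer M.b_weight N.b_weight outer_simps smul_simps(2)[symmetric]
    by (rule smul_cong) simp
  show "E 0 1 (x i j) = smul (of_nat i * (of_nat n - of_nat i + 1)) (x (i - 1) j) +
      smul (of_nat j * (of_nat m - of_nat j + 1)) (x i (j - 1))"
    unfolding x_def E_outer string_raise outer_simps ..
  show "E 1 0 (x i j) = x (Suc i) j + x i (Suc j)"
    unfolding x_def E_outer by simp
next
  show "(\<Sum>i\<le>r. smul (a i) (x i (r - i))) = 0 \<Longrightarrow> r \<le> min n m \<Longrightarrow> i \<le> r \<Longrightarrow> a i = 0" for a r i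
    by (rule x_independent)
  show "lin_space T \<Longrightarrow> (\<And>i j. x i j \<in> T) \<Longrightarrow> T.kspan (carrier P) \<subseteq> T" for T
    by (rule V_span)
  show "c + c' - (d + d') = of_nat (n + m)"
    using M.weight_diff N.weight_diff by (simp add: algebra_simps)
qed

lemma frag_sum_left:
  "finite J \<Longrightarrow> (\<And>j. j \<in> J \<Longrightarrow> f j \<in> carrier M) \<Longrightarrow> q \<in> carrier N \<Longrightarrow>
    frag_of (\<Oplus>\<^bsub>M\<^esub>j\<in>J. f j, q) \<approx> (\<Sum>j\<in>J. frag_of (f j, q))"
proof (induction J rule: finite_induct)
  case empty
  have "frag_of (\<zero>\<^bsub>M\<^esub>, q) \<approx> frag_of (\<zero>\<^bsub>M\<^esub>, q) + frag_of (\<zero>\<^bsub>M\<^esub>, q)"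
    using equiv_add_left[of "\<zero>\<^bsub>M\<^esub>" "\<zero>\<^bsub>M\<^esub>" q] empty by simp
  from equiv_diff[OF this equiv_refl[of "frag_of (\<zero>\<^bsub>M\<^esub>, q)"]]
  show ?case by (simp add: equiv_sym)
next
  case (insert i J)
  then have f: "f \<in> J \<rightarrow> carrier M" "f i \<in> carrier M" by auto
  have "frag_of (f i \<oplus>\<^bsub>M\<^esub> (\<Oplus>\<^bsub>M\<^esub>j\<in>J. f j), q) \<approx> frag_of (f i, q) + frag_of (\<Oplus>\<^bsub>M\<^esub>j\<in>J. f j, q)"
    by (rule equiv_add_left[OF f(2) M.M.finsum_closed[OF f(1)] insert.prems(2)])
  also have "\<dots> \<approx> frag_of (f i, q) + (\<Sum>j\<in>J. frag_of (f j, q))"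
    using insert by (intro equiv_add equiv_refl insert.IH) auto
  finally show ?case using insert f by (simp add: M.M.finsum_insert)
qed

lemma equiv_sum: "(\<And>j. j \<in> J \<Longrightarrow> f j \<approx> g j) \<Longrightarrow> sum f J \<approx> sum g J"
  by (induction J rule: infinite_finite_induct) (auto intro: equiv_add)

text \<open>Some nonzero element of \<open>A\<close> moves \<open>M\<close> into a free submodule, where the tensor product
  with the torsion free module \<open>N\<close> is torsion free; hence it kills the kernel.\<close>

lemma Phi_inj: "inj_on \<Phi> (carrier P)"
proof -
  obtain a f D where D: "D \<noteq> 0" and
    af: "\<And>j. a j \<noteq> 0" "\<And>j. f j \<in> carrier M" "\<And>j. smul (to_fract (a j)) (M.b j) = \<phi> (f j)" and
    frame: "\<And>p. p \<in> carrier M \<Longrightarrow> \<exists>k. D \<odot>\<^bsub>M\<^esub> p = (\<Oplus>\<^bsub>M\<^esub>j\<in>{..n}. k j \<odot>\<^bsub>M\<^esub> f j)"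
    using M.exists_frame[OF inj_M fg_M span_M] by blast
  \<comment> \<open>D p is a combination of the \<open>f j\<close>, whose coefficients are moved to
    the second factor. So D u becomes a sum of n + 1 pure tensors with first factors
    \<open>f j\<close>.\<close>
  have frame_frag: "\<exists>\<nu>. (\<forall>j. \<nu> j \<in> carrier N) \<and> act_frag D u \<approx> (\<Sum>j\<le>n. frag_of (f j, \<nu> j))"
    if "Poly_Mapping.keys u \<subseteq> C" for u
    using that
  proof (induction rule: frag_induction)
    case zero
    have "frag_of (f j, \<zero>\<^bsub>N\<^esub>) \<approx> 0" for j
      using equiv_diff_right[OF af(2)[of j] N.M.zero_closed N.M.zero_closed] by (simp add: N.M.r_neg N.M.minus_eq)
    then have "(\<Sum>j\<le>n. frag_of (f j, \<zero>\<^bsub>N\<^esub>)) \<approx> (\<Sum>j\<le>n. 0)" by (rule equiv_sum)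
    then show ?case by (intro exI[of _ "\<lambda>_. \<zero>\<^bsub>N\<^esub>"]) (simp add: equiv_sym)
  next
    case (one pq)
    obtain p q where pq: "pq = (p, q)" by (cases pq)
    then have p: "p \<in> carrier M" and q: "q \<in> carrier N" using one by auto
    obtain k where k: "D \<odot>\<^bsub>M\<^esub> p = (\<Oplus>\<^bsub>M\<^esub>j\<in>{..n}. k j \<odot>\<^bsub>M\<^esub> f j)" using frame[OF p] by blast
    have "frag_of (D \<odot>\<^bsub>M\<^esub> p, q) \<approx> (\<Sum>j\<le>n. frag_of (k j \<odot>\<^bsub>M\<^esub> f j, q))"
      unfolding k by (rule frag_sum_left) (use af(2) q in auto)
    also have "\<dots> \<approx> (\<Sum>j\<le>n. frag_of (f j, k j \<odot>\<^bsub>N\<^esub> q))"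
      by (intro equiv_sum equiv_balanced af(2) q)
    finally show ?case using q by (intro exI[of _ "\<lambda>j. k j \<odot>\<^bsub>N\<^esub> q"]) (simp add: pq)
  next
    case (diff u v)
    then obtain \<nu> \<mu> where \<nu>: "\<And>j. \<nu> j \<in> carrier N" "act_frag D u \<approx> (\<Sum>j\<le>n. frag_of (f j, \<nu> j))"
      and \<mu>: "\<And>j. \<mu> j \<in> carrier N" "act_frag D v \<approx> (\<Sum>j\<le>n. frag_of (f j, \<mu> j))" by blast
    have "act_frag D (u - v) \<approx> (\<Sum>j\<le>n. frag_of (f j, \<nu> j) - frag_of (f j, \<mu> j))"
      using equiv_diff[OF \<nu>(2) \<mu>(2)] by (simp add: sum_subtractf)
    also have "\<dots> \<approx> (\<Sum>j\<le>n. frag_of (f j, \<nu> j \<ominus>\<^bsub>N\<^esub> \<mu> j))"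
      by (intro equiv_sum equiv_sym[OF equiv_diff_right] af(2) \<nu>(1) \<mu>(1))
    finally show ?case using \<nu>(1) \<mu>(1) by (intro exI[of _ "\<lambda>j. \<nu> j \<ominus>\<^bsub>N\<^esub> \<mu> j"]) simp
  qed
  have kill: "D \<odot>\<^bsub>P\<^esub> t = \<zero>\<^bsub>P\<^esub>" if t: "t \<in> carrier P" "\<Phi> t = 0" for t
  proof -
    obtain u where u: "t = cls u" "Poly_Mapping.keys u \<subseteq> C" using carrierE[OF t(1)] .
    obtain \<nu> where \<nu>: "\<And>j. \<nu> j \<in> carrier N" "act_frag D u \<approx> (\<Sum>j\<le>n. frag_of (f j, \<nu> j))"
      using frame_frag[OF u(2)] by blast
    have fs: "frag_eval \<phi> \<psi> (sum g J) = (\<Sum>j\<in>J. frag_eval \<phi> \<psi> (g j))" for g and J :: "nat set"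
      by (induction J rule: infinite_finite_induct) (simp_all add: frag_eval_add)
    have "frag_eval \<phi> \<psi> (act_frag D u) = 0"
      unfolding frag_eval_act[OF u(2)] using t(2) unfolding u(1) Phi_cls by (simp add: smul_simps)
    moreover have "frag_eval \<phi> \<psi> (act_frag D u) - frag_eval \<phi> \<psi> (\<Sum>j\<le>n. frag_of (f j, \<nu> j)) = 0"
      unfolding frag_eval_diff[symmetric] by (rule frag_eval_Rel) (use \<nu>(2) in \<open>simp add: equiv_frag_def\<close>)
    ultimately have z: "(\<Sum>j\<le>n. outer (smul (to_fract (a j)) (M.b j)) (\<psi> (\<nu> j))) = 0"
      by (simp add: fs frag_eval_of af(3))
    \<comment> \<open>Independence of the string vectors, used at every coordinate l of the second
      factor, gives \<open>\<psi> (\<nu> j) = 0\<close>, and \<psi> is injective.\<close>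
    have "\<nu> j = \<zero>\<^bsub>N\<^esub>" if j: "j \<le> n" for j
    proof -
      have "to_fract (a j) * \<psi> (\<nu> j) l = 0" for l
      proof (rule M.b_independent[of "\<lambda>j. to_fract (a j) * \<psi> (\<nu> j) l", OF _ j])
        show "(\<Sum>j\<le>n. smul (to_fract (a j) * \<psi> (\<nu> j) l) (M.b j)) = 0"
        proof (rule ext)
          fix k
          have "(\<Sum>j\<le>n. outer (smul (to_fract (a j)) (M.b j)) (\<psi> (\<nu> j))) (k, l) = 0"
            unfolding z by (simp add: pointwise)
          then show "(\<Sum>j\<le>n. smul (to_fract (a j) * \<psi> (\<nu> j) l) (M.b j)) k = 0 k"
            unfolding sum_fun_apply by (simp add: pointwise outer_apply mult_ac)
        qed
      qed
      then have "\<psi> (\<nu> j) = 0" using af(1)[of j] by (simp add: fun_eq_iff pointwise)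
      then have "\<psi> (\<nu> j) = \<psi> \<zero>\<^bsub>N\<^esub>" by simp
      then show ?thesis using inj_onD[OF inj_N _ \<nu>(1)] by blast
    qed
    moreover have "frag_of (f j, \<zero>\<^bsub>N\<^esub>) \<approx> 0" for j
      using equiv_diff_right[OF af(2)[of j] N.M.zero_closed N.M.zero_closed] by (simp add: N.M.r_neg N.M.minus_eq)
    ultimately have "(\<Sum>j\<le>n. frag_of (f j, \<nu> j)) \<approx> (\<Sum>j\<le>n. 0)" by (intro equiv_sum) simp
    then have "act_frag D u \<approx> 0" using equiv_trans[OF \<nu>(2)] by simp
    then show ?thesis unfolding u(1) tensor_simps(2,4) cls_eq_iff .
  qed
  \<comment> \<open>The kernel is a submodule killed by D, so \<open>conductor_trick\<close>
    identifies it with the zero submodule.\<close>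
  have ker: "T.preimage {0} = {\<zero>\<^bsub>P\<^esub>}"
  proof (rule T.conductor_trick[symmetric])
    have "T.stable_space {0}" by (simp add: T.stable_space_def smul_simps)
    then show "av_submodule (T.preimage {0}) P" by (rule T.av_submodule_preimage)
    show "av_submodule {\<zero>\<^bsub>P\<^esub>} P"
      by (simp add: T.av_submodule_iff a_submodule_def T.lie_zero)
    show "{\<zero>\<^bsub>P\<^esub>} \<subseteq> T.preimage {0}" by (simp add: T.preimage_def)
    show "D \<noteq> 0" by (rule D)
    show "D \<odot>\<^bsub>P\<^esub> t \<in> {\<zero>\<^bsub>P\<^esub>}" if "t \<in> T.preimage {0}" for t
      using that kill by (simp add: T.preimage_def)
  qed
  show ?thesis
  proof (rule inj_onI)
    fix s t assume st: "s \<in> carrier P" "t \<in> carrier P" "\<Phi> s = \<Phi> t"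
    have "\<Phi> (s \<oplus>\<^bsub>P\<^esub> (-1) \<odot>\<^bsub>P\<^esub> t) = 0"
      using st by (simp add: T.phi_add T.phi_smult smul_simps)
    then have "s \<oplus>\<^bsub>P\<^esub> (-1) \<odot>\<^bsub>P\<^esub> t \<in> T.preimage {0}" using st by (simp add: T.preimage_def)
    then have "s \<ominus>\<^bsub>P\<^esub> t = \<zero>\<^bsub>P\<^esub>" unfolding ker using st by (simp add: T.minus_eq_smult)
    moreover have "s = (s \<ominus>\<^bsub>P\<^esub> t) \<oplus>\<^bsub>P\<^esub> t"
      using st by (simp add: T.M.minus_eq T.M.a_assoc T.M.l_neg)
    ultimately show "s = t" using st by simp
  qed
qed

sublocale clebsch_gordan_inj P E h \<Phi> n m x "c + c'" "d + d'"
  by unfold_locales (rule Phi_inj, rule tensor_finitely_generated[OF fg_M fg_N])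

end

section \<open>The tensor product of two simple tensor modules\<close>

definition rep_units ::
  "'k::field_char_0 gl2_matrix \<Rightarrow> nat \<Rightarrow> nat \<Rightarrow> (nat \<Rightarrow> 'k sphere fract) \<Rightarrow> nat \<Rightarrow> 'k sphere fract" where
  "rep_units \<rho> p i = mat_op (rep_dim \<rho>) (\<lambda>k l. frac_const (rep_deriv \<rho> p i $$ (k, l)))"

text \<open>Vectors padded by zeros to functions on all natural numbers, so that the pointwise
  operations apply without dimension conditions.\<close>

definition vec_fun :: "nat \<Rightarrow> ('m \<Rightarrow> 'f::comm_ring_1 vec) \<Rightarrow> 'm \<Rightarrow> nat \<Rightarrow> 'f" where
  "vec_fun n \<phi> x = (\<lambda>k. if k < n then vec_index (\<phi> x) k else 0)"

lemma pderiv_chart_sum: "pderiv_chart h j (sum f I) = (\<Sum>i\<in>I. pderiv_chart h j (f i))"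
  by (induction I rule: infinite_finite_induct) (simp_all add: pderiv_chart_add)

lemma matrix_units_rep: "matrix_units (rep_units \<rho>)"
proof
  fix p i v w c h j
  show "rep_units \<rho> p i (v + w) = rep_units \<rho> p i v + rep_units \<rho> p i w"
    "rep_units \<rho> p i (smul c v) = smul c (rep_units \<rho> p i v)"
    by (simp_all add: rep_units_def mat_op_add mat_op_smul)
  show "pd h j (rep_units \<rho> p i v) = rep_units \<rho> p i (pd h j v)"
    by (rule ext) (simp add: rep_units_def mat_op_def pointwise pderiv_chart_sum pderiv_chart_mult)
qed

lemma chart_module_simps:
  "carrier (chart_module \<rho> h) = {v \<in> carrier_vec (rep_dim \<rho>). set\<^sub>v v \<subseteq> localization h}"
  "v \<oplus>\<^bsub>chart_module \<rho> h\<^esub> w = v + w" "a \<odot>\<^bsub>chart_module \<rho> h\<^esub> v = to_fract a \<cdot>\<^sub>v v"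
  by (simp_all add: chart_module_def)

lemma vec_index_localization:
  "v \<in> carrier (chart_module \<rho> h) \<Longrightarrow> k < rep_dim \<rho> \<Longrightarrow> vec_index v k \<in> localization h"
  by (auto simp: chart_module_simps vec_set_def)

lemma field_coeff_localization: "field_coeff h \<eta> i \<in> localization h"
  by (simp add: field_coeff_def localization_to_fract)

lemma chart_module_lie:
  assumes v: "v \<in> carrier (chart_module \<rho> h)" and k: "k < rep_dim \<rho>"
    and sq: "dim_col (numerators \<rho>) = rep_dim \<rho>"
  shows "vec_index (lie_act (chart_module \<rho> h) \<eta> v) k =
    (\<Sum>i<2. field_coeff h \<eta> i * pderiv_chart h i (vec_index v k)) +
    (\<Sum>p<2. \<Sum>i<2. pderiv_chart h p (field_coeff h \<eta> i) *
      (\<Sum>l<rep_dim \<rho>. frac_const (rep_deriv \<rho> p i $$ (k, l)) * vec_index v l))"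
proof -
  have dims: "dim_row (rep_deriv \<rho> p i) = rep_dim \<rho>" "dim_col (rep_deriv \<rho> p i) = rep_dim \<rho>" for p i
    using sq by (simp_all add: rep_deriv_def rep_subst_def)
  have "dim_vec v = rep_dim \<rho>" using v by (auto simp: chart_module_simps)
  then have "vec_index (map_mat frac_const (rep_deriv \<rho> p i) *\<^sub>v v) k =
      (\<Sum>l<rep_dim \<rho>. frac_const (rep_deriv \<rho> p i $$ (k, l)) * vec_index v l)" for p i
    using k by (simp add: dims scalar_prod_def row_def lessThan_atLeast0)
  then show ?thesis
    using k unfolding chart_module_def
    by (simp add: chart_deriv_eq[OF _ vec_index_localization[OF v k]] chart_deriv_eq[OF _ field_coeff_localization])
qed

lemma chart_embedding_rep:
  assumes M: "av_module M" and sq: "dim_col (numerators \<rho>) = rep_dim \<rho>"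
    and \<phi>: "\<phi> \<in> av_hom M (chart_module \<rho> h)"
  shows "chart_embedding M (rep_units \<rho>) h (vec_fun (rep_dim \<rho>) \<phi>)"
proof -
  interpret M: av_module M by fact
  interpret matrix_units "rep_units \<rho>" by (rule matrix_units_rep)
  have car: "\<phi> x \<in> carrier (chart_module \<rho> h)" if "x \<in> carrier M" for x
    using \<phi> that by (auto simp: av_hom_def)
  have dim: "dim_vec (\<phi> x) = rep_dim \<rho>" if "x \<in> carrier M" for x
    using car[OF that] by (auto simp: chart_module_simps)
  show ?thesis
  proof unfold_locales
    fix x assume x: "x \<in> carrier M"
    show "vec_fun (rep_dim \<rho>) \<phi> (x \<oplus>\<^bsub>M\<^esub> y) = vec_fun (rep_dim \<rho>) \<phi> x + vec_fun (rep_dim \<rho>) \<phi> y"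
      if y: "y \<in> carrier M" for y
    proof -
      have "\<phi> (x \<oplus>\<^bsub>M\<^esub> y) = \<phi> x + \<phi> y" using \<phi> x y by (simp add: av_hom_def chart_module_simps)
      then show ?thesis using dim[OF y] by (auto simp: vec_fun_def fun_eq_iff pointwise)
    qed
    show "vec_fun (rep_dim \<rho>) \<phi> (a \<odot>\<^bsub>M\<^esub> x) = smul (to_fract a) (vec_fun (rep_dim \<rho>) \<phi> x)" for a
    proof -
      have "\<phi> (a \<odot>\<^bsub>M\<^esub> x) = to_fract a \<cdot>\<^sub>v \<phi> x" using \<phi> x by (simp add: av_hom_def chart_module_simps)
      then show ?thesis using dim[OF x] by (auto simp: vec_fun_def fun_eq_iff pointwise)
    qed
    show "vec_fun (rep_dim \<rho>) \<phi> (lie_act M \<eta> x) = chart_lie h \<eta> (vec_fun (rep_dim \<rho>) \<phi> x)"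
      if \<eta>: "\<eta> \<in> vector_fields" for \<eta>
    proof (rule ext)
      fix k
      have "\<phi> (lie_act M \<eta> x) = lie_act (chart_module \<rho> h) \<eta> (\<phi> x)" using \<phi> x \<eta> by (simp add: av_hom_def)
      then show "vec_fun (rep_dim \<rho>) \<phi> (lie_act M \<eta> x) k = chart_lie h \<eta> (vec_fun (rep_dim \<rho>) \<phi> x) k"
        using chart_module_lie[OF car[OF x] _ sq]
        by (simp add: vec_fun_def chart_lie_def sum_lessThan_2 pointwise rep_units_def mat_op_def)
    qed
  qed
qed

lemma chart_hom_dim:
  assumes "\<phi> \<in> av_hom M (chart_module \<rho> h)" "x \<in> carrier M"
  shows "dim_vec (\<phi> x) = rep_dim \<rho>"
proof -
  have "\<phi> x \<in> carrier (chart_module \<rho> h)" using assms unfolding av_hom_def by blast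
  then show ?thesis by (auto simp: chart_module_simps)
qed

lemma vec_fun_inj:
  assumes \<phi>: "\<phi> \<in> av_hom M (chart_module \<rho> h)" and inj: "inj_on \<phi> (carrier M)"
  shows "inj_on (vec_fun (rep_dim \<rho>) \<phi>) (carrier M)"
proof (rule inj_onI)
  fix x y assume xy: "x \<in> carrier M" "y \<in> carrier M" "vec_fun (rep_dim \<rho>) \<phi> x = vec_fun (rep_dim \<rho>) \<phi> y"
  have "\<phi> x = \<phi> y"
  proof (rule eq_vecI)
    fix i assume "i < dim_vec (\<phi> y)"
    then show "vec_index (\<phi> x) i = vec_index (\<phi> y) i"
      using fun_cong[OF xy(3), of i] chart_hom_dim[OF \<phi> xy(2)] by (simp add: vec_fun_def)
  qed (simp add: chart_hom_dim[OF \<phi>] xy)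
  then show "x = y" using inj xy by (auto dest: inj_onD)
qed

text \<open>The matrices of the differentiated representation are constant, so their eigenvalue
  lists over k feed \<open>exists_hw_string\<close>; simplicity makes the string found there the
  whole span.\<close>

lemma simple_hw_string:
  fixes M :: "('k::{alg_closed_field, field_char_0} sphere, 'm) av_structure"
  assumes M: "av_simple M" and sq: "dim_col (numerators \<rho>) = rep_dim \<rho>"
    and \<phi>: "\<phi> \<in> av_hom M (chart_module \<rho> h)" "inj_on \<phi> (carrier M)"
  shows "\<exists>w c d N. hw_string M (rep_units \<rho>) h (vec_fun (rep_dim \<rho>) \<phi>) w c d N \<and>
    chart_embedding.kspan (vec_fun (rep_dim \<rho>) \<phi>) (carrier M) = chart_embedding.string_space (rep_units \<rho>) w N"
proof -
  let ?f = "vec_fun (rep_dim \<rho>) \<phi>"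
  have av: "av_module M" using M by (simp add: av_simple_def)
  interpret chart_embedding M "rep_units \<rho>" h ?f by (rule chart_embedding_rep[OF av sq \<phi>(1)])
  interpret chart_embedding_inj M "rep_units \<rho>" h ?f by unfold_locales (rule vec_fun_inj[OF \<phi>])
  \<comment> \<open>The lists from \<open>exists_annihilating_list\<close> concern vectors that
    vanish from index \<open>rep_dim \<rho>\<close> on.\<close>
  have supp: "v k = 0" if v: "v \<in> kspan (carrier M)" and k: "k \<ge> rep_dim \<rho>" for v k
  proof -
    obtain a s where "a \<noteq> 0" "s \<in> carrier M" "smul (to_fract a) v = ?f s" using v unfolding kspan_def by blast
    then have "to_fract a * v k = ?f s k" by (metis smul_apply)
    then show ?thesis using k \<open>a \<noteq> 0\<close> by (simp add: vec_fun_def)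
  qed
  have ann: "\<exists>cs. \<forall>v\<in>kspan (carrier M). foldr (\<lambda>c v. rep_units \<rho> p p v - smul c v) (map frac_const cs) v = 0" for p
    unfolding rep_units_def using exists_annihilating_list[of "rep_dim \<rho>" "\<lambda>k l. rep_deriv \<rho> p p $$ (k, l)"] supp by blast
  obtain cs where cs: "\<forall>v\<in>kspan (carrier M). foldr (\<lambda>c v. rep_units \<rho> 0 0 v - smul c v) (map frac_const cs) v = 0"
    using ann by blast
  obtain ds where ds: "\<forall>v\<in>kspan (carrier M). foldr (\<lambda>c v. rep_units \<rho> 1 1 v - smul c v) (map frac_const ds) v = 0"
    using ann by blast
  obtain x where x: "x \<in> carrier M" "x \<noteq> \<zero>\<^bsub>M\<^esub>"
    using M M.zero_closed unfolding av_simple_def by blast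
  have "?f x \<noteq> 0" using x phi_eq_0 by blast
  then have "\<exists>w c d N. hw_string M (rep_units \<rho>) h ?f w c d N"
    using x(1) cs ds by (intro exists_hw_string[of "{..<rep_dim \<rho>}" cs ds x]) (auto simp: vec_fun_def)
  then show ?thesis using simple_imp_string[OF M] by blast
qed

lemma rational_rep_square: "rational_rep \<rho> \<Longrightarrow> dim_col (numerators \<rho>) = rep_dim \<rho>"
  by (auto simp: rational_rep_def)

definition tensor_vec_map where
  "tensor_vec_map n m \<phi> \<psi> t =
    vec (n * m) (\<lambda>k. tensor_map (vec_fun n \<phi>) (vec_fun m \<psi>) t (k div m, k mod m))"

locale rep_pair = av_pair M N
  for M :: "('k::{alg_closed_field, field_char_0} sphere, 'm) av_structure" and N :: "('k sphere, 'n) av_structure" +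
  fixes \<rho> \<sigma> \<phi> \<psi>
  assumes M_simple: "av_simple M" and N_simple: "av_simple N"
    and M_fg: "finitely_generated_over_A M" and N_fg: "finitely_generated_over_A N"
    and rho: "rational_rep \<rho>" and sigma: "rational_rep \<sigma>"
    and phi: "\<And>h. \<phi> h \<in> av_hom M (chart_module \<rho> h)" "\<And>h. inj_on (\<phi> h) (carrier M)"
    and psi: "\<And>h. \<psi> h \<in> av_hom N (chart_module \<sigma> h)" "\<And>h. inj_on (\<psi> h) (carrier N)"
    and phi_change: "\<And>h h' x. x \<in> carrier M \<Longrightarrow> rep_subst frac_const \<rho> (chart_change h h') *\<^sub>v \<phi> h x = \<phi> h' x"
    and psi_change: "\<And>h h' x. x \<in> carrier N \<Longrightarrow> rep_subst frac_const \<sigma> (chart_change h h') *\<^sub>v \<psi> h x = \<psi> h' x"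
begin

abbreviation "n \<equiv> rep_dim \<rho>"
abbreviation "m \<equiv> rep_dim \<sigma>"
abbreviation "f h \<equiv> vec_fun n (\<phi> h)"
abbreviation "g h \<equiv> vec_fun m (\<psi> h)"
abbreviation "F h \<equiv> tensor_map (f h) (g h)"
abbreviation "\<tau> \<equiv> tensor_rep \<rho> \<sigma>"
abbreviation "\<Theta> h \<equiv> tensor_vec_map n m (\<phi> h) (\<psi> h)"

lemmas dims = rational_rep_square[OF rho] rational_rep_square[OF sigma]

lemma embedding_pair: "embedding_pair M N (rep_units \<rho>) (rep_units \<sigma>) h (f h) (g h)"
proof -
  interpret M: chart_embedding M "rep_units \<rho>" h "f h"
    by (rule chart_embedding_rep[OF _ dims(1) phi(1)]) unfold_locales
  interpret N: chart_embedding N "rep_units \<sigma>" h "g h"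
    by (rule chart_embedding_rep[OF _ dims(2) psi(1)]) unfold_locales
  show ?thesis by unfold_locales
qed

lemma string_pair:
  "\<exists>w c d a w' c' d' b. string_pair M N (rep_units \<rho>) (rep_units \<sigma>) h (f h) (g h) w c d a w' c' d' b"
proof -
  interpret embedding_pair M N "rep_units \<rho>" "rep_units \<sigma>" h "f h" "g h" by (rule embedding_pair)
  obtain w c d a where 1: "hw_string M (rep_units \<rho>) h (f h) w c d a"
    "M.kspan (carrier M) = M.string_space w a"
    using simple_hw_string[OF M_simple dims(1) phi] by blast
  obtain w' c' d' b where 2: "hw_string N (rep_units \<sigma>) h (g h) w' c' d' b"
    "N.kspan (carrier N) = N.string_space w' b"
    using simple_hw_string[OF N_simple dims(2) psi] by blast
  interpret A: hw_string M "rep_units \<rho>" h "f h" w c d a by (rule 1)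
  interpret B: hw_string N "rep_units \<sigma>" h "g h" w' c' d' b by (rule 2)
  have "string_pair M N (rep_units \<rho>) (rep_units \<sigma>) h (f h) (g h) w c d a w' c' d' b"
    by unfold_locales (use 1(2) 2(2) vec_fun_inj[OF phi] vec_fun_inj[OF psi] M_fg N_fg in auto)
  then show ?thesis by blast
qed

lemma F_cls: "F h (cls u) = frag_eval (f h) (g h) u"
proof -
  interpret embedding_pair M N "rep_units \<rho>" "rep_units \<sigma>" h "f h" "g h" by (rule embedding_pair)
  show ?thesis by (rule Phi_cls)
qed

lemma F_localization:
  assumes t: "t \<in> carrier P"
  shows "F h t (k, l) \<in> localization h"
proof -
  obtain u where u: "t = cls u" "Poly_Mapping.keys u \<subseteq> C" using carrierE[OF t] .
  have fl: "f h x k \<in> localization h" if "x \<in> carrier M" for x k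
    using phi(1)[of h] that vec_index_localization[of "\<phi> h x" \<rho> h k] by (auto simp: vec_fun_def av_hom_def)
  have gl: "g h x k \<in> localization h" if "x \<in> carrier N" for x k
    using psi(1)[of h] that vec_index_localization[of "\<psi> h x" \<sigma> h k] by (auto simp: vec_fun_def av_hom_def)
  have neg: "- q \<in> localization h" if "q \<in> localization h" for q :: "'k sphere fract"
    using localization_mult[OF localization_to_fract[of "-1" h] that] by simp
  have "frag_eval (f h) (g h) u (k, l) \<in> localization h"
    using u(2)
  proof (induction rule: frag_induction)
    case zero
    show ?case by (simp add: pointwise)
  next
    case (one p)
    then show ?case by (cases p) (auto simp: frag_eval_of outer_apply intro!: localization_mult fl gl)
  next
    case (diff u v)
    then show ?case
      using localization_add[OF _ neg] by (fastforce simp: frag_eval_diff pointwise)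
  qed
  then show ?thesis unfolding u(1) F_cls .
qed

lemma Theta_index: "k < n * m \<Longrightarrow> vec_index (\<Theta> h t) k = F h t (k div m, k mod m)"
  and Theta_dim: "dim_vec (\<Theta> h t) = n * m"
  by (simp_all add: tensor_vec_map_def)

lemma Theta_carrier: "t \<in> carrier P \<Longrightarrow> \<Theta> h t \<in> carrier (chart_module \<tau> h)"
  by (auto simp: chart_module_simps dim_tensor_rep tensor_vec_map_def vec_set_def F_localization)

lemma Theta_lie:
  assumes \<eta>: "\<eta> \<in> vector_fields" and t: "t \<in> carrier P"
  shows "\<Theta> h (lie_act P \<eta> t) = lie_act (chart_module \<tau> h) \<eta> (\<Theta> h t)"
proof (rule eq_vecI)
  interpret embedding_pair M N "rep_units \<rho>" "rep_units \<sigma>" h "f h" "g h" by (rule embedding_pair)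
  fix k assume "k < dim_vec (lie_act (chart_module \<tau> h) \<eta> (\<Theta> h t))"
  then have k: "k < n * m" by (simp add: chart_module_def dim_tensor_rep)
  note k' = div_mod_less[OF k]
  \<comment> \<open>Row k of the matrix for \<tau> is a row of E \<otimes> 1 + 1 \<otimes> E;
    splitting l into quotient and remainder turns the matrix action into
    \<open>tensor_units\<close>.\<close>
  have E: "(\<Sum>l<n * m. frac_const (rep_deriv \<tau> p i $$ (k, l)) * vec_index (\<Theta> h t) l) =
      E p i (F h t) (k div m, k mod m)" for p i
  proof -
    let ?v = "F h t" and ?A = "\<lambda>i' j. frac_const (rep_deriv \<rho> p i $$ (k div m, i')) * (if k mod m = j then 1 else 0) +
      (if k div m = i' then 1 else 0) * frac_const (rep_deriv \<sigma> p i $$ (k mod m, j))"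
    have "(\<Sum>l<n * m. frac_const (rep_deriv \<tau> p i $$ (k, l)) * vec_index (\<Theta> h t) l) =
        (\<Sum>l<n * m. ?A (l div m) (l mod m) * ?v (l div m, l mod m))"
      by (rule sum.cong) (simp_all add: rep_deriv_tensor[OF rho sigma k] Theta_index)
    also have "\<dots> = (\<Sum>i'<n. \<Sum>j<m. ?A i' j * ?v (i', j))" by (rule sum_div_mod)
    also have "\<dots> = (\<Sum>i'<n. \<Sum>j<m. if k mod m = j then frac_const (rep_deriv \<rho> p i $$ (k div m, i')) * ?v (i', j) else 0) +
        (\<Sum>i'<n. \<Sum>j<m. if k div m = i' then frac_const (rep_deriv \<sigma> p i $$ (k mod m, j)) * ?v (i', j) else 0)"
      unfolding sum.distrib[symmetric] by (intro sum.cong refl) (auto simp: distrib_right)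
    also have "(\<Sum>i'<n. \<Sum>j<m. if k mod m = j then frac_const (rep_deriv \<rho> p i $$ (k div m, i')) * ?v (i', j) else 0) =
        rep_units \<rho> p i (\<lambda>k'. ?v (k', k mod m)) (k div m)"
      using k' by (simp add: rep_units_def mat_op_def)
    also have "(\<Sum>i'<n. \<Sum>j<m. if k div m = i' then frac_const (rep_deriv \<sigma> p i $$ (k mod m, j)) * ?v (i', j) else 0) =
        rep_units \<sigma> p i (\<lambda>l'. ?v (k div m, l')) (k mod m)"
      using k' by (subst sum.swap) (simp add: rep_units_def mat_op_def)
    also have "rep_units \<rho> p i (\<lambda>k'. ?v (k', k mod m)) (k div m) + rep_units \<sigma> p i (\<lambda>l'. ?v (k div m, l')) (k mod m) =
        E p i ?v (k div m, k mod m)"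
      by (simp add: tensor_units_def)
    finally show ?thesis .
  qed
  have "vec_index (\<Theta> h (lie_act P \<eta> t)) k = U.chart_lie h \<eta> (F h t) (k div m, k mod m)"
    using k T.phi_lie[OF \<eta> t] by (simp add: Theta_index)
  also have "\<dots> = vec_index (lie_act (chart_module \<tau> h) \<eta> (\<Theta> h t)) k"
    using chart_module_lie[OF Theta_carrier[OF t, of h], of k \<eta>] k
    unfolding dim_tensor_rep E rational_rep_square[OF rational_tensor_rep[OF rho sigma]]
    by (simp add: U.chart_lie_def sum_lessThan_2 pointwise Theta_index)
  finally show "vec_index (\<Theta> h (lie_act P \<eta> t)) k = vec_index (lie_act (chart_module \<tau> h) \<eta> (\<Theta> h t)) k" .
qed (simp add: chart_module_def dim_tensor_rep Theta_dim)

lemma Theta_hom: "\<Theta> h \<in> av_hom P (chart_module \<tau> h)"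
proof -
  interpret embedding_pair M N "rep_units \<rho>" "rep_units \<sigma>" h "f h" "g h" by (rule embedding_pair)
  have "\<Theta> h (s \<oplus>\<^bsub>P\<^esub> t) = \<Theta> h s + \<Theta> h t" if "s \<in> carrier P" "t \<in> carrier P" for s t
    using that by (intro eq_vecI) (simp_all add: Theta_dim Theta_index T.phi_add pointwise)
  moreover have "\<Theta> h (a \<odot>\<^bsub>P\<^esub> t) = to_fract a \<cdot>\<^sub>v \<Theta> h t" if "t \<in> carrier P" for a t
    using that by (intro eq_vecI) (simp_all add: Theta_dim Theta_index T.phi_smult pointwise)
  ultimately show ?thesis
    by (simp add: av_hom_def chart_module_simps(2,3) Theta_carrier Theta_lie)
qed

lemma F_support: "t \<in> carrier P \<Longrightarrow> n \<le> k \<or> m \<le> l \<Longrightarrow> F h t (k, l) = 0"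
proof -
  assume t: "t \<in> carrier P" and kl: "n \<le> k \<or> m \<le> l"
  obtain u where u: "t = cls u" "Poly_Mapping.keys u \<subseteq> C" using carrierE[OF t] .
  show ?thesis unfolding u(1) F_cls frag_eval_def
    using kl by (auto simp: sum_fun_apply pointwise outer_apply vec_fun_def intro!: sum.neutral)
qed

text \<open>Outside the rectangle k < n, l < m the function \<open>F h t\<close> vanishes, so
  passing to vectors loses nothing and \<open>Phi_inj\<close> for the chart h applies.\<close>

lemma Theta_inj: "inj_on (\<Theta> h) (carrier P)"
proof (rule inj_onI)
  obtain w c d a w' c' d' b where "string_pair M N (rep_units \<rho>) (rep_units \<sigma>) h (f h) (g h) w c d a w' c' d' b"
    using string_pair by blast
  then interpret string_pair M N "rep_units \<rho>" "rep_units \<sigma>" h "f h" "g h" w c d a w' c' d' b .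
  fix s t assume st: "s \<in> carrier P" "t \<in> carrier P" "\<Theta> h s = \<Theta> h t"
  have "F h s (k, l) = F h t (k, l)" for k l
  proof (cases "k < n \<and> l < m")
    case True
    then have "k * m + l < Suc k * m" by simp
    also have "\<dots> \<le> n * m" using True by (intro mult_le_mono1) simp
    finally have lt: "k * m + l < n * m" .
    have "vec_index (\<Theta> h s) (k * m + l) = vec_index (\<Theta> h t) (k * m + l)" using st(3) by simp
    then show ?thesis using True by (simp add: Theta_index[OF lt])
  next
    case False
    then show ?thesis using F_support[OF st(1), of k l] F_support[OF st(2), of k l] by auto
  qed
  then have "F h s = F h t" by auto
  then show "s = t" using Phi_inj st by (auto dest: inj_onD)
qed

text \<open>The transition matrix for \<tau> is the Kronecker product of the two given ones, so on
  pure tensors the identity is the product of those for \<phi> and \<psi>.\<close>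

lemma Theta_change:
  assumes t: "t \<in> carrier P"
  shows "rep_subst frac_const \<tau> (chart_change h h') *\<^sub>v \<Theta> h t = \<Theta> h' t"
proof (rule eq_vecI)
  let ?X = "rep_subst frac_const \<rho> (chart_change h h')" and ?Y = "rep_subst frac_const \<sigma> (chart_change h h')"
  have dimT: "dim_row (rep_subst frac_const \<tau> (chart_change h h')) = n * m"
    "dim_col (rep_subst frac_const \<tau> (chart_change h h')) = n * m"
    using rational_rep_square[OF rational_tensor_rep[OF rho sigma]] by (simp_all add: dim_tensor_rep)
  then show "dim_vec (rep_subst frac_const \<tau> (chart_change h h') *\<^sub>v \<Theta> h t) = dim_vec (\<Theta> h' t)"
    by (simp add: Theta_dim)
  fix k assume "k < dim_vec (\<Theta> h' t)"
  then have k: "k < n * m" by (simp add: Theta_dim)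
  note k' = div_mod_less[OF k]
  have rm: "ring_map (frac_const :: 'k \<Rightarrow> _)" by (simp add: ring_map_def)
  have sq: "square_mat (numerators \<rho>)" "square_mat (numerators \<sigma>)"
    using rho sigma by (auto simp: rational_rep_def)
  have X: "(\<Sum>i<n. ?X $$ (k div m, i) * f h x i) = f h' x (k div m)" if x: "x \<in> carrier M" for x
  proof -
    have "dim_vec (\<phi> h x) = n" by (rule chart_hom_dim[OF phi(1) x])
    then have "vec_index (?X *\<^sub>v \<phi> h x) (k div m) = (\<Sum>i<n. ?X $$ (k div m, i) * vec_index (\<phi> h x) i)"
      using k' dims by (simp add: scalar_prod_def row_def lessThan_atLeast0)
    then show ?thesis unfolding phi_change[OF x] using k' by (simp add: vec_fun_def)
  qed
  have Y: "(\<Sum>j<m. ?Y $$ (k mod m, j) * g h x j) = g h' x (k mod m)" if x: "x \<in> carrier N" for x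
  proof -
    have "dim_vec (\<psi> h x) = m" by (rule chart_hom_dim[OF psi(1) x])
    then have "vec_index (?Y *\<^sub>v \<psi> h x) (k mod m) = (\<Sum>j<m. ?Y $$ (k mod m, j) * vec_index (\<psi> h x) j)"
      using k' dims by (simp add: scalar_prod_def row_def lessThan_atLeast0)
    then show ?thesis unfolding psi_change[OF x] using k' by (simp add: vec_fun_def)
  qed
  let ?A = "\<lambda>v. \<Sum>i<n. \<Sum>j<m. ?X $$ (k div m, i) * ?Y $$ (k mod m, j) * v (i, j)"
  obtain u where u: "t = cls u" "Poly_Mapping.keys u \<subseteq> C" using carrierE[OF t] .
  have "?A (frag_eval (f h) (g h) u) = frag_eval (f h') (g h') u (k div m, k mod m)"
    using u(2)
  proof (induction rule: frag_induction)
    case zero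
    show ?case by (simp add: pointwise)
  next
    case (one p)
    then obtain x y where p: "p = (x, y)" "x \<in> carrier M" "y \<in> carrier N" by auto
    have "?A (outer (f h x) (g h y)) = (\<Sum>i<n. ?X $$ (k div m, i) * f h x i) * (\<Sum>j<m. ?Y $$ (k mod m, j) * g h y j)"
      unfolding sum_product outer_apply by (intro sum.cong refl) (simp add: mult_ac)
    then show ?case unfolding p(1) frag_eval_of X[OF p(2)] Y[OF p(3)] outer_apply .
  next
    case (diff u v)
    then show ?case
      by (simp add: frag_eval_diff pointwise right_diff_distrib sum_subtractf)
  qed
  then have A: "?A (F h t) = F h' t (k div m, k mod m)" unfolding u(1) F_cls .
  have "vec_index (rep_subst frac_const \<tau> (chart_change h h') *\<^sub>v \<Theta> h t) k =
      (\<Sum>l<n * m. rep_subst frac_const \<tau> (chart_change h h') $$ (k, l) * vec_index (\<Theta> h t) l)"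
    using k dimT by (simp add: scalar_prod_def row_def lessThan_atLeast0 Theta_dim)
  also have "\<dots> = (\<Sum>l<n * m. ?X $$ (k div m, l div m) * ?Y $$ (k mod m, l mod m) * F h t (l div m, l mod m))"
    by (rule sum.cong) (simp_all add: rep_subst_tensor[OF rm inverse_mult_distrib sq k] Theta_index)
  also have "\<dots> = ?A (F h t)" by (rule sum_div_mod)
  finally show "vec_index (rep_subst frac_const \<tau> (chart_change h h') *\<^sub>v \<Theta> h t) k = vec_index (\<Theta> h' t) k"
    unfolding A Theta_index[OF k] .
qed

text \<open>A tensor module is only asked to embed compatibly into the chart modules, so the maps
  \<Theta> for the full product representation serve every finitely generated submodule.\<close>

lemma submodule_tensor_module:
  assumes S: "av_submodule S P" and fg: "finitely_generated_over_A (P\<lparr>carrier := S\<rparr>)"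
  shows "tensor_module (P\<lparr>carrier := S\<rparr>)"
proof -
  interpret T: av_module P by (rule tensor_av_module)
  have sub: "S \<subseteq> carrier P" using T.av_submoduleD(1)[OF S] by (simp add: a_submodule_def)
  have hom: "\<Theta> h \<in> av_hom (P\<lparr>carrier := S\<rparr>) (chart_module \<tau> h)" for h
    using Theta_hom[of h] sub by (auto simp: av_hom_def subset_iff Pi_iff)
  have inj: "inj_on (\<Theta> h) (carrier (P\<lparr>carrier := S\<rparr>))" for h
    using inj_on_subset[OF Theta_inj sub] by simp
  show ?thesis
    unfolding tensor_module_def
    using T.restrict_av_module[OF S] fg rational_tensor_rep[OF rho sigma] hom inj Theta_change sub
    by (intro conjI exI[of _ \<tau>] exI[of _ \<Theta>]) auto
qed

lemma direct_sum: "direct_sum_of_simple_tensor_modules P"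
proof -
  \<comment> \<open>The chart is an arbitrary choice: the components are submodules of M \<otimes> N
    itself, and the other charts enter through \<open>submodule_tensor_module\<close>.\<close>
  obtain w c d a w' c' d' b where "string_pair M N (rep_units \<rho>) (rep_units \<sigma>) CX (f CX) (g CX) w c d a w' c' d' b"
    using string_pair by blast
  then interpret string_pair M N "rep_units \<rho>" "rep_units \<sigma>" CX "f CX" "g CX" w c d a w' c' d' b .
  show ?thesis
    unfolding direct_sum_of_simple_tensor_modules_def simple_tensor_module_def
    using tensor_av_module direct_sum_components component_simple component_fg component_av_submodule submodule_tensor_module
    by (intro conjI exI[of _ "component ` R"]) auto
qed

end

theorem theorem15:
  fixes M :: "('k::{alg_closed_field, field_char_0} sphere, 'm) av_structure"
    and N :: "('k sphere, 'n) av_structure"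
  assumes "simple_tensor_module M" and "simple_tensor_module N"
  shows "direct_sum_of_simple_tensor_modules (av_tensor M N)"
proof -
  have M: "av_module M" "av_simple M" "finitely_generated_over_A M"
    and N: "av_module N" "av_simple N" "finitely_generated_over_A N"
    using assms by (auto simp: simple_tensor_module_def tensor_module_def)
  obtain \<rho> \<phi> where \<rho>: "rational_rep \<rho>" "\<And>h. \<phi> h \<in> av_hom M (chart_module \<rho> h)" "\<And>h. inj_on (\<phi> h) (carrier M)"
    "\<And>h h' m. m \<in> carrier M \<Longrightarrow> rep_subst frac_const \<rho> (chart_change h h') *\<^sub>v \<phi> h m = \<phi> h' m"
    using assms(1) unfolding simple_tensor_module_def tensor_module_def by metis
  obtain \<sigma> \<psi> where \<sigma>: "rational_rep \<sigma>" "\<And>h. \<psi> h \<in> av_hom N (chart_module \<sigma> h)" "\<And>h. inj_on (\<psi> h) (carrier N)"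
    "\<And>h h' m. m \<in> carrier N \<Longrightarrow> rep_subst frac_const \<sigma> (chart_change h h') *\<^sub>v \<psi> h m = \<psi> h' m"
    using assms(2) unfolding simple_tensor_module_def tensor_module_def by metis
  interpret M: av_module M by (rule M)
  interpret N: av_module N by (rule N)
  interpret rep_pair M N \<rho> \<sigma> \<phi> \<psi>
    by unfold_locales (use M N \<rho> \<sigma> in auto)
  show ?thesis by (rule direct_sum)
qed

end
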